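(* Let $\theta\in[0,1]$ and $\Delta t>0$, and let $(\rho_h^n,\mathbf M_h^n,\mathbf E_h^n,\mathbf B_h^n,(\mathbf X_p^n,\mathbf U_p^n)_{p=1}^N)$, $n=0,1,2,\dots$, with $\rho_h^n\in Q_{k+1}$, $\mathbf M_h^n\in Q_{k+1}^d$, $\mathbf E_h^n\in\mathring N_k$, $\mathbf B_h^n\in\mathring{RT}_k$, $\mathbf X_p^n\in\Omega_h$, be a solution of the fully discrete implicit scheme (I) described in the context. Then the following quantities are exactly conserved, i.e. independent of $n$: 1. the total fluid mass $\int_{\Omega_h}\rho_h^n\,dx$; 2. the total particle mass $\sum_{p=1}^N w_p$; 3. the total energy $$\int_{\Omega_h}\rho_h^n\big(\gamma(m\mathbf M_h^n/\rho_h^n)-1\big)c^2\,dx+\sum_{p=1}^N w_p\big(\gamma(\mathbf U_p^n)-1\big)mc^2+\frac1{8\pi}\int_{\Omega_h}\big(|\mathbf E_h^n|^2+|\mathbf B_h^n|^2\big)\,dx;$$ 4. the weak Gauss law residual $$\int_{\Omega_h}\Big[\nabla_w\cdot\mathbf E_h^n-4\pi e\Big(\frac{\rho_h^n}{m}+\sum_{p=1}^N w_p\,\delta(\mathbf x-\mathbf X_p^n)\Big)\Big]\phi_h\,dx$$ for every $\phi_h\in\mathring Q_{k+1}$ (where $\int_{\Omega_h}\delta(\mathbf x-\mathbf X_p^n)\phi_h\,dx=\phi_h(\mathbf X_p^n)$); 5. the divergence $\nabla\cdot\mathbf B_h^n$.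
   Context: Let $d=3$, let $\Omega\subset\mathbb R^3$ be a bounded domain with a (finite, conforming, polyhedral) partition $\mathcal T_h$ into cells $K$, $\Omega_h=\bigcup_{K\in\mathcal T_h}K$ (identified with $\Omega$), and let $k\ge0$ be an integer. The constants $c>0$ (speed of light), $m>0$ (mass), $e$ (charge, a nonzero real number) and the particle weights $w_p$, $p=1,\dots,N$, are fixed. For $\mathbf u\in\mathbb R^3$, $\gamma(\mathbf u)=\sqrt{1+\frac{\mathbf u\cdot\mathbf u}{m^2c^2}}$. Finite element spaces ($P_k(K)$: polynomials of degree at most $k$ on $K$): $Q_k=\{f\in H^1(\Omega): f|_K\in P_k(K)\ \forall K\}$; $N_k=\{f\in H(\mathrm{curl},\Omega): f|_K\in P_k(K)^d+\mathbf x\times P_k(K)^d\ \forall K\}$; $RT_k=\{f\in H(\mathrm{div},\Omega): f|_K\in P_k(K)^d+\mathbf x P_k(K)\ \forall K\}$. $\mathring Q_k$, $\mathring N_k$, $\mathring{RT}_k$ are the subspaces of functions with, respectively, $f=0$, $\mathbf n\times f=0$, $\mathbf n\cdot f=0$ on $\partial\Omega$. The weak divergence $\nabla_w\cdot:\mathring N_k\to\mathring Q_{k+1}$ is defined by $\int_\Omega(\nabla_w\cdot\mathbf E_h)\phi_h\,dx=-\int_\Omega\mathbf E_h\cdot\nabla\phi_h\,dx$ for all $\phi_h\in\mathring Q_{k+1}$. Vector-gradient notation: $(\mathbf a\cdot\nabla\mathbf b)\cdot\mathbf c=\sum_{i,j}a_i(\partial_i b_j)c_j$. Time interpolation: for any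 discrete unknown $u$ and $\alpha\in[0,1]$, $u^{n,\alpha}=(1-\alpha)u^{n+1}+\alpha u^n$; write $u^\xi=u^{n,\xi}$ for the variable $\xi$ of integration over $[0,1]$, and $u^{n+1/2}=\frac12(u^n+u^{n+1})$. Particle trajectories: within each time step particle $p$ moves along the straight segment from $\mathbf X_p^n$ to $\mathbf X_p^{n+1}$, assumed contained in $\Omega_h$ and crossing $s=s_p$ cells. Put $\mathbf A_{p,0}=\mathbf X_p^n$, $\mathbf A_{p,s}=\mathbf X_p^{n+1}$, and let $\mathbf A_{p,1},\dots,\mathbf A_{p,s-1}$ be, in order along the segment, its intersection points with the element boundaries crossed, so that each sub-segment $[\mathbf A_{p,i-1},\mathbf A_{p,i}]$ ($i=1,\dots,s$) lies in one closed cell; fields on this sub-segment are evaluated from that cell (if there are several such cells, one fixed choice is used for all fields). Let $\mathbf X_{p,i}^\xi=(1-\xi)\mathbf A_{p,i}+\xi\mathbf A_{p,i-1}$. Let $\mathbf D_i=\mathbf D_{p,i}$ be the diagonal $3\times3$ matrix with entries $\frac{(\mathbf A_{p,i}-\mathbf A_{p,i-1})_j}{(\mathbf X_p^{n+1}-\mathbf X_p^n)_j}$, $j=1,2,3$. If $\mathbf X_p^{n+1}=\mathbf X_p^n$ then $s=1$ and $\mathbf D_1=\mathbf I$. If $\mathbf X_p^{n+1}\neq\mathbf X_p^n$ but the $j$-th denominator vanishes, the $j$-th entry is the common ratio $\lambda_i$ defined by $\mathbf A_{p,i}-\mathbf A_{p,i-1}=\lambda_i(\mathbf X_p^{n+1}-\mathbf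 X_p^n)$. Scheme (I). Let $\mathbf w_h$ be the $L^2(\Omega)$-projection onto $Q_{k+1}^d$ of $\int_0^1\frac{\mathbf M_h^\xi}{\rho_h^\xi\gamma(m\mathbf M_h^\xi/\rho_h^\xi)}\,d\xi$, and $G_h$ the $L^2(\Omega)$-projection onto $Q_{k+1}$ of $\int_0^1\Big(\gamma(m\mathbf M_h^\xi/\rho_h^\xi)-1-\frac{|\mathbf M_h^\xi|^2}{c^2(\rho_h^\xi)^2\gamma(m\mathbf M_h^\xi/\rho_h^\xi)}\Big)d\xi$. Then for each $n$: $$\int_\Omega\frac{\rho_h^{n+1}-\rho_h^n}{\Delta t}\phi_h\,dx=\int_\Omega\rho_h^{n,\theta}\mathbf w_h\cdot\nabla\phi_h\,dx\quad\forall\phi_h\in Q_{k+1},$$ $$\begin{aligned}\int_\Omega\frac{\mathbf M_h^{n+1}-\mathbf M_h^n}{\Delta t}\cdot\boldsymbol\mu_h\,dx&=\int_\Omega(\mathbf w_h\cdot\nabla\boldsymbol\mu_h-\boldsymbol\mu_h\cdot\nabla\mathbf w_h)\cdot\mathbf M_h^{n+1/2}\,dx-\int_\Omega\rho_h^{n,\theta}\,\boldsymbol\mu_h\cdot\nabla G_h\,c^2\,dx\\&\quad+\frac em\int_\Omega\rho_h^{n,\theta}\Big(\mathbf E_h^{n+1/2}+\mathbf w_h\times\frac{\mathbf B_h^{n+1/2}}c\Big)\cdot\boldsymbol\mu_h\,dx\quad\forall\boldsymbol\mu_h\in Q_{k+1}^d,\end{aligned}$$ $$\begin{aligned}\int_\Omega\frac{\mathbf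 E_h^{n+1}-\mathbf E_h^n}{\Delta t}\cdot\boldsymbol\nu_h\,dx&=c\int_\Omega\mathbf B_h^{n+1/2}\cdot(\nabla\times\boldsymbol\nu_h)\,dx-\frac{4\pi e}m\int_\Omega\rho_h^{n,\theta}\mathbf w_h\cdot\boldsymbol\nu_h\,dx\\&\quad-4\pi e\sum_{p=1}^N\sum_{i=1}^{s}w_p\frac{\mathbf A_{p,i}-\mathbf A_{p,i-1}}{\Delta t}\cdot\int_0^1\boldsymbol\nu_h(\mathbf X_{p,i}^\xi)\,d\xi\quad\forall\boldsymbol\nu_h\in\mathring N_k,\end{aligned}$$ $$\int_\Omega\frac{\mathbf B_h^{n+1}-\mathbf B_h^n}{\Delta t}\cdot\boldsymbol\tau_h\,dx=-c\int_\Omega\boldsymbol\tau_h\cdot(\nabla\times\mathbf E_h^{n+1/2})\,dx\quad\forall\boldsymbol\tau_h\in\mathring{RT}_k,$$ $$\frac{\mathbf X_p^{n+1}-\mathbf X_p^n}{\Delta t}=\int_0^1\frac{\mathbf U_p^\xi}{m\gamma(\mathbf U_p^\xi)}\,d\xi,$$ $$\frac{\mathbf U_p^{n+1}-\mathbf U_p^n}{\Delta t}=e\Big(\sum_{i=1}^s\mathbf D_i\int_0^1\mathbf E_h^{n+1/2}(\mathbf X_{p,i}^\xi)\,d\xi+\frac1m\int_0^1\frac{\mathbf U_p^\xi}{\gamma(\mathbf U_p^\xi)}\,d\xi\times\frac{\mathbf B_h^{n+1/2}(\mathbf X_p^{n+1/2})}c\Big).$$ A solution is understood to be such that $\rho_h^\xi$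 vanishes nowhere for $\xi\in[0,1]$, so that all expressions are defined. *)

theory Defs
  imports "HOL-Analysis.Analysis"
begin

type_synonym vec3 = "real^3"

section \<open>Sobolev spaces on an open set\<close>

definition partial :: "3 \<Rightarrow> (vec3 \<Rightarrow> real) \<Rightarrow> vec3 \<Rightarrow> real" where
  "partial i f x = frechet_derivative f (at x) (axis i 1)"

primrec C_diff :: "nat \<Rightarrow> (vec3 \<Rightarrow> real) \<Rightarrow> bool" where
  "C_diff 0 f \<longleftrightarrow> continuous_on UNIV f"
| "C_diff (Suc n) f \<longleftrightarrow> (\<forall>x. f differentiable (at x)) \<and> (\<forall>i. C_diff n (partial i f))"

definition test_fun :: "vec3 set \<Rightarrow> (vec3 \<Rightarrow> real) \<Rightarrow> bool" where
  "test_fun \<Omega> \<phi> \<longleftrightarrow> (\<forall>n. C_diff n \<phi>) \<and>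
     compact (closure {x. \<phi> x \<noteq> 0}) \<and> closure {x. \<phi> x \<noteq> 0} \<subseteq> \<Omega>"

definition test_field :: "vec3 set \<Rightarrow> (vec3 \<Rightarrow> vec3) \<Rightarrow> bool" where
  "test_field \<Omega> \<phi> \<longleftrightarrow> (\<forall>j. test_fun \<Omega> (\<lambda>x. \<phi> x $ j))"

definition classical_grad :: "(vec3 \<Rightarrow> real) \<Rightarrow> vec3 \<Rightarrow> vec3" where
  "classical_grad \<phi> x = (\<chi> i. partial i \<phi> x)"

definition classical_curl :: "(vec3 \<Rightarrow> vec3) \<Rightarrow> vec3 \<Rightarrow> vec3" where
  "classical_curl \<phi> x = vector
     [partial 2 (\<lambda>y. \<phi> y $ 3) x - partial 3 (\<lambda>y. \<phi> y $ 2) x,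
      partial 3 (\<lambda>y. \<phi> y $ 1) x - partial 1 (\<lambda>y. \<phi> y $ 3) x,
      partial 1 (\<lambda>y. \<phi> y $ 2) x - partial 2 (\<lambda>y. \<phi> y $ 1) x]"

definition L2 :: "vec3 set \<Rightarrow> (vec3 \<Rightarrow> 'a::euclidean_space) set" where
  "L2 \<Omega> = {f. f \<in> borel_measurable (lebesgue_on \<Omega>) \<and> (\<lambda>x. (norm (f x))\<^sup>2) integrable_on \<Omega>}"

definition has_weak_grad :: "vec3 set \<Rightarrow> (vec3 \<Rightarrow> real) \<Rightarrow> (vec3 \<Rightarrow> vec3) \<Rightarrow> bool" where
  "has_weak_grad \<Omega> f g \<longleftrightarrow> g \<in> L2 \<Omega> \<and>
     (\<forall>\<phi>. test_fun \<Omega> \<phi> \<longrightarrow>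
        integral \<Omega> (\<lambda>x. f x *\<^sub>R classical_grad \<phi> x) = - integral \<Omega> (\<lambda>x. \<phi> x *\<^sub>R g x))"

definition has_weak_curl :: "vec3 set \<Rightarrow> (vec3 \<Rightarrow> vec3) \<Rightarrow> (vec3 \<Rightarrow> vec3) \<Rightarrow> bool" where
  "has_weak_curl \<Omega> f g \<longleftrightarrow> g \<in> L2 \<Omega> \<and>
     (\<forall>\<phi>. test_field \<Omega> \<phi> \<longrightarrow>
        integral \<Omega> (\<lambda>x. f x \<bullet> classical_curl \<phi> x) = integral \<Omega> (\<lambda>x. g x \<bullet> \<phi> x))"

definition has_weak_div :: "vec3 set \<Rightarrow> (vec3 \<Rightarrow> vec3) \<Rightarrow> (vec3 \<Rightarrow> real) \<Rightarrow> bool" where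
  "has_weak_div \<Omega> f g \<longleftrightarrow> g \<in> L2 \<Omega> \<and>
     (\<forall>\<phi>. test_fun \<Omega> \<phi> \<longrightarrow>
        integral \<Omega> (\<lambda>x. f x \<bullet> classical_grad \<phi> x) = - integral \<Omega> (\<lambda>x. g x * \<phi> x))"

definition H1 :: "vec3 set \<Rightarrow> (vec3 \<Rightarrow> real) set" where
  "H1 \<Omega> = {f \<in> L2 \<Omega>. \<exists>g. has_weak_grad \<Omega> f g}"

definition Hcurl :: "vec3 set \<Rightarrow> (vec3 \<Rightarrow> vec3) set" where
  "Hcurl \<Omega> = {f \<in> L2 \<Omega>. \<exists>g. has_weak_curl \<Omega> f g}"

definition Hdiv :: "vec3 set \<Rightarrow> (vec3 \<Rightarrow> vec3) set" where
  "Hdiv \<Omega> = {f \<in> L2 \<Omega>. \<exists>g. has_weak_div \<Omega> f g}"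

text \<open>The differential operators of the scheme are the distributional ones. They are determined
  only up to null sets, so each of the following is a choice of representative, meaningful on
  \<open>H1\<close>, \<open>Hcurl\<close> and \<open>Hdiv\<close> respectively.\<close>

definition grad :: "vec3 set \<Rightarrow> (vec3 \<Rightarrow> real) \<Rightarrow> vec3 \<Rightarrow> vec3" where
  "grad \<Omega> f = (SOME g. has_weak_grad \<Omega> f g)"

definition curl :: "vec3 set \<Rightarrow> (vec3 \<Rightarrow> vec3) \<Rightarrow> vec3 \<Rightarrow> vec3" where
  "curl \<Omega> f = (SOME g. has_weak_curl \<Omega> f g)"

definition divergence :: "vec3 set \<Rightarrow> (vec3 \<Rightarrow> vec3) \<Rightarrow> vec3 \<Rightarrow> real" where
  "divergence \<Omega> f = (SOME g. has_weak_div \<Omega> f g)"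

text \<open>\<open>(a \<cdot> \<nabla>b) \<cdot> c\<close>, where \<open>b\<close> has components in \<open>H1\<close>.\<close>

definition convect :: "vec3 set \<Rightarrow> (vec3 \<Rightarrow> vec3) \<Rightarrow> (vec3 \<Rightarrow> vec3) \<Rightarrow> (vec3 \<Rightarrow> vec3) \<Rightarrow> vec3 \<Rightarrow> real" where
  "convect \<Omega> a b c x = (\<Sum>i\<in>UNIV. \<Sum>j\<in>UNIV. a x $ i * grad \<Omega> (\<lambda>y. b y $ j) x $ i * c x $ j)"


section \<open>Meshes\<close>

text \<open>Cells are closed polyhedra, not necessarily convex: finite unions of full-dimensional convex
  polytopes whose interior is connected.\<close>

definition polyhedral_cell :: "vec3 set \<Rightarrow> bool" where
  "polyhedral_cell K \<longleftrightarrow>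
     (\<exists>P. finite P \<and> P \<noteq> {} \<and> (\<forall>C\<in>P. polytope C \<and> interior C \<noteq> {}) \<and> K = \<Union>P) \<and>
     connected (interior K)"

text \<open>\<open>n\<close> is the outward unit normal of \<open>K\<close> at \<open>x\<close>, a point in the relative interior of a facet:
  near \<open>x\<close>, the cell is a half-space. Facets are the closures of the connected components of the
  set of such points; for convex polytopes these are the facets in the sense of \<open>facet_of\<close>.\<close>

definition outer_normal :: "vec3 set \<Rightarrow> vec3 \<Rightarrow> vec3 \<Rightarrow> bool" where
  "outer_normal K x n \<longleftrightarrow> norm n = 1 \<and>
     (\<exists>r>0. K \<inter> ball x r = {y \<in> ball x r. n \<bullet> (y - x) \<le> 0})"

definition facets :: "vec3 set \<Rightarrow> vec3 set set" where
  "facets K = closure ` components {x. \<exists>n. outer_normal K x n}"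

text \<open>Conformity: every facet of a cell either lies on the boundary of the domain or is also a facet
  of another cell. The domain itself is open; the union of the (closed) cells is its closure.\<close>

definition conforming_mesh :: "vec3 set \<Rightarrow> vec3 set set \<Rightarrow> bool" where
  "conforming_mesh \<Omega> \<T> \<longleftrightarrow>
     finite \<T> \<and> (\<forall>K\<in>\<T>. polyhedral_cell K \<and> interior K \<subseteq> \<Omega>) \<and> \<Union>\<T> = closure \<Omega> \<and>
     (\<forall>K\<in>\<T>. \<forall>K'\<in>\<T>. K \<noteq> K' \<longrightarrow> interior K \<inter> interior K' = {}) \<and>
     (\<forall>K\<in>\<T>. \<forall>F\<in>facets K. F \<subseteq> frontier \<Omega> \<or> (\<exists>K'\<in>\<T> - {K}. F \<in> facets K'))"


section \<open>Finite element spaces\<close>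

definition Poly :: "nat \<Rightarrow> (vec3 \<Rightarrow> real) set" where
  "Poly k = {p. \<exists>a :: (3 \<Rightarrow> nat) \<Rightarrow> real.
     p = (\<lambda>x. \<Sum>\<alpha> | sum \<alpha> UNIV \<le> k. a \<alpha> * (\<Prod>i\<in>UNIV. x $ i ^ \<alpha> i))}"

definition VPoly :: "nat \<Rightarrow> (vec3 \<Rightarrow> vec3) set" where
  "VPoly k = {p. \<forall>j. (\<lambda>x. p x $ j) \<in> Poly k}"

text \<open>Finite element functions are functions on the whole space of which only the values in the
  interiors of the cells matter. \<open>trace (interior K) f x\<close> is the value at a point \<open>x\<close> of the
  closed cell \<open>K\<close> of the polynomial \<open>f|\<^sub>K\<close>, i.e. \<open>f\<close> evaluated from the cell \<open>K\<close>.\<close>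

definition trace :: "vec3 set \<Rightarrow> (vec3 \<Rightarrow> 'a::t2_space) \<Rightarrow> vec3 \<Rightarrow> 'a" where
  "trace S f x = Lim (at x within S) f"

definition Q :: "vec3 set \<Rightarrow> vec3 set set \<Rightarrow> nat \<Rightarrow> (vec3 \<Rightarrow> real) set" where
  "Q \<Omega> \<T> k = {f \<in> H1 \<Omega>. \<forall>K\<in>\<T>. \<exists>p\<in>Poly k. \<forall>x\<in>interior K. f x = p x}"

definition VQ :: "vec3 set \<Rightarrow> vec3 set set \<Rightarrow> nat \<Rightarrow> (vec3 \<Rightarrow> vec3) set" where
  "VQ \<Omega> \<T> k = {f. \<forall>j. (\<lambda>x. f x $ j) \<in> Q \<Omega> \<T> k}"

definition Ned :: "vec3 set \<Rightarrow> vec3 set set \<Rightarrow> nat \<Rightarrow> (vec3 \<Rightarrow> vec3) set" where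
  "Ned \<Omega> \<T> k = {f \<in> Hcurl \<Omega>. \<forall>K\<in>\<T>. \<exists>p\<in>VPoly k. \<exists>q\<in>VPoly k.
     \<forall>x\<in>interior K. f x = p x + cross3 x (q x)}"

definition RT :: "vec3 set \<Rightarrow> vec3 set set \<Rightarrow> nat \<Rightarrow> (vec3 \<Rightarrow> vec3) set" where
  "RT \<Omega> \<T> k = {f \<in> Hdiv \<Omega>. \<forall>K\<in>\<T>. \<exists>p\<in>VPoly k. \<exists>q\<in>Poly k.
     \<forall>x\<in>interior K. f x = p x + q x *\<^sub>R x}"

definition Q0 :: "vec3 set \<Rightarrow> vec3 set set \<Rightarrow> nat \<Rightarrow> (vec3 \<Rightarrow> real) set" where
  "Q0 \<Omega> \<T> k = {f \<in> Q \<Omega> \<T> k. \<forall>K\<in>\<T>. \<forall>x\<in>K \<inter> frontier \<Omega>. trace (interior K) f x = 0}"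

definition Ned0 :: "vec3 set \<Rightarrow> vec3 set set \<Rightarrow> nat \<Rightarrow> (vec3 \<Rightarrow> vec3) set" where
  "Ned0 \<Omega> \<T> k = {f \<in> Ned \<Omega> \<T> k. \<forall>K\<in>\<T>. \<forall>F\<in>facets K. F \<subseteq> frontier \<Omega> \<longrightarrow>
     (\<forall>x\<in>F. \<forall>n. outer_normal K x n \<longrightarrow> cross3 n (trace (interior K) f x) = 0)}"

definition RT0 :: "vec3 set \<Rightarrow> vec3 set set \<Rightarrow> nat \<Rightarrow> (vec3 \<Rightarrow> vec3) set" where
  "RT0 \<Omega> \<T> k = {f \<in> RT \<Omega> \<T> k. \<forall>K\<in>\<T>. \<forall>F\<in>facets K. F \<subseteq> frontier \<Omega> \<longrightarrow>
     (\<forall>x\<in>F. \<forall>n. outer_normal K x n \<longrightarrow> n \<bullet> trace (interior K) f x = 0)}"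

definition is_L2_projection ::
  "vec3 set \<Rightarrow> (vec3 \<Rightarrow> 'a::euclidean_space) set \<Rightarrow> (vec3 \<Rightarrow> 'a) \<Rightarrow> (vec3 \<Rightarrow> 'a) \<Rightarrow> bool" where
  "is_L2_projection \<Omega> V g u \<longleftrightarrow> u \<in> V \<and>
     (\<forall>v\<in>V. integral \<Omega> (\<lambda>x. u x \<bullet> v x) = integral \<Omega> (\<lambda>x. g x \<bullet> v x))"

text \<open>The discrete divergence \<open>Ned0 \<Omega> \<T> k \<rightarrow> Q0 \<Omega> \<T> (k + 1)\<close>, unique up to null sets.\<close>

definition weak_divergence :: "vec3 set \<Rightarrow> vec3 set set \<Rightarrow> nat \<Rightarrow> (vec3 \<Rightarrow> vec3) \<Rightarrow> vec3 \<Rightarrow> real" where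
  "weak_divergence \<Omega> \<T> k E = (SOME d. d \<in> Q0 \<Omega> \<T> (k + 1) \<and>
     (\<forall>\<phi>\<in>Q0 \<Omega> \<T> (k + 1). integral \<Omega> (\<lambda>x. d x * \<phi> x) = - integral \<Omega> (\<lambda>x. E x \<bullet> grad \<Omega> \<phi> x)))"


section \<open>Discrete states and trajectories\<close>

record pic_state =
  density :: "vec3 \<Rightarrow> real"
  momentum :: "vec3 \<Rightarrow> vec3"
  electric :: "vec3 \<Rightarrow> vec3"
  magnetic :: "vec3 \<Rightarrow> vec3"
  position :: "nat \<Rightarrow> vec3"
  impulse :: "nat \<Rightarrow> vec3"

definition pic_states :: "vec3 set \<Rightarrow> vec3 set set \<Rightarrow> nat \<Rightarrow> nat \<Rightarrow> pic_state set" where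
  "pic_states \<Omega> \<T> k N = {st.
     density st \<in> Q \<Omega> \<T> (k + 1) \<and> momentum st \<in> VQ \<Omega> \<T> (k + 1) \<and>
     electric st \<in> Ned0 \<Omega> \<T> k \<and> magnetic st \<in> RT0 \<Omega> \<T> k \<and>
     (\<forall>p\<in>{1..N}. position st p \<in> \<Union>\<T>)}"

text \<open>Time interpolation between the old value \<open>u\<close> and the new value \<open>u'\<close>; note that
  \<open>\<alpha> = 1\<close> is the old time level.\<close>

definition interp :: "real \<Rightarrow> 'a \<Rightarrow> 'a \<Rightarrow> 'a::real_vector" where
  "interp \<alpha> u u' = (1 - \<alpha>) *\<^sub>R u' + \<alpha> *\<^sub>R u"

definition interp_field :: "real \<Rightarrow> (vec3 \<Rightarrow> 'a) \<Rightarrow> (vec3 \<Rightarrow> 'a) \<Rightarrow> vec3 \<Rightarrow> 'a::real_vector" where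
  "interp_field \<alpha> u u' x = interp \<alpha> (u x) (u' x)"

text \<open>The splitting of a particle segment: \<open>breakpt 0, \<dots>, breakpt nseg\<close> are the points \<open>A\<^sub>0, \<dots>, A\<^sub>s\<close>,
  \<open>cell i\<close> is the cell from which all fields are evaluated on the sub-segment from
  \<open>A\<^bsub>i-1\<^esub>\<close> to \<open>A\<^sub>i\<close>, and \<open>midseg\<close> is the index of a sub-segment containing the midpoint,
  where the magnetic field is evaluated.\<close>

record trajectory =
  nseg :: nat
  breakpt :: "nat \<Rightarrow> vec3"
  cell :: "nat \<Rightarrow> vec3 set"
  midseg :: nat

definition is_trajectory :: "vec3 set set \<Rightarrow> vec3 \<Rightarrow> vec3 \<Rightarrow> trajectory \<Rightarrow> bool" where
  "is_trajectory \<T> X X' tr \<longleftrightarrow>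
     1 \<le> nseg tr \<and> (X' = X \<longrightarrow> nseg tr = 1) \<and>
     (\<exists>t. t 0 = 0 \<and> t (nseg tr) = 1 \<and> strict_mono_on {0..nseg tr} t \<and>
        (\<forall>i\<le>nseg tr. breakpt tr i = X + t i *\<^sub>R (X' - X))) \<and>
     (\<forall>i\<in>{1..nseg tr}. cell tr i \<in> \<T> \<and>
        closed_segment (breakpt tr (i - 1)) (breakpt tr i) \<subseteq> cell tr i) \<and>
     (\<forall>i\<in>{1..<nseg tr}. breakpt tr i \<in> frontier (cell tr i) \<inter> frontier (cell tr (i + 1))) \<and>
     midseg tr \<in> {1..nseg tr} \<and>
     interp (1/2) X X' \<in> closed_segment (breakpt tr (midseg tr - 1)) (breakpt tr (midseg tr))"

definition step_vec :: "trajectory \<Rightarrow> nat \<Rightarrow> vec3" where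
  "step_vec tr i = breakpt tr i - breakpt tr (i - 1)"

text \<open>\<open>\<integral>\<^sub>0\<^sup>1 f(X\<^sub>i\<^sup>\<xi>) d\<xi>\<close> with \<open>X\<^sub>i\<^sup>\<xi> = (1 - \<xi>) A\<^sub>i + \<xi> A\<^bsub>i-1\<^esub>\<close>.\<close>

definition segment_mean :: "trajectory \<Rightarrow> (vec3 \<Rightarrow> vec3) \<Rightarrow> nat \<Rightarrow> vec3" where
  "segment_mean tr f i = integral {0..1} (\<lambda>\<xi>::real.
     trace (interior (cell tr i)) f (interp \<xi> (breakpt tr (i - 1)) (breakpt tr i)))"

definition D_matrix :: "vec3 \<Rightarrow> vec3 \<Rightarrow> trajectory \<Rightarrow> nat \<Rightarrow> real^3^3" where
  "D_matrix X X' tr i = (\<chi> j l. if j \<noteq> l then 0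
     else if X' = X then 1
     else if (X' - X) $ j \<noteq> 0 then step_vec tr i $ j / (X' - X) $ j
     else (THE r. step_vec tr i = r *\<^sub>R (X' - X)))"


section \<open>The scheme\<close>

definition lorentz :: "real \<Rightarrow> real \<Rightarrow> vec3 \<Rightarrow> real" where
  "lorentz m c u = sqrt (1 + (u \<bullet> u) / (m\<^sup>2 * c\<^sup>2))"

definition mean_velocity :: "real \<Rightarrow> real \<Rightarrow> pic_state \<Rightarrow> pic_state \<Rightarrow> vec3 \<Rightarrow> vec3" where
  "mean_velocity m c st st' x = integral {0..1} (\<lambda>\<xi>::real.
     let r = interp \<xi> (density st x) (density st' x);
         M = interp \<xi> (momentum st x) (momentum st' x)
     in (1 / (r * lorentz m c ((m / r) *\<^sub>R M))) *\<^sub>R M)"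

definition mean_G :: "real \<Rightarrow> real \<Rightarrow> pic_state \<Rightarrow> pic_state \<Rightarrow> vec3 \<Rightarrow> real" where
  "mean_G m c st st' x = integral {0..1} (\<lambda>\<xi>::real.
     let r = interp \<xi> (density st x) (density st' x);
         M = interp \<xi> (momentum st x) (momentum st' x);
         g = lorentz m c ((m / r) *\<^sub>R M)
     in g - 1 - (norm M)\<^sup>2 / (c\<^sup>2 * r\<^sup>2 * g))"

definition continuity_eq where
  "continuity_eq \<Omega> \<T> k \<theta> dt w st st' \<longleftrightarrow>
     (\<forall>\<phi>\<in>Q \<Omega> \<T> (k + 1).
        integral \<Omega> (\<lambda>x. (density st' x - density st x) / dt * \<phi> x) =
        integral \<Omega> (\<lambda>x. interp_field \<theta> (density st) (density st') x * (w x \<bullet> grad \<Omega> \<phi> x)))"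

definition momentum_eq where
  "momentum_eq \<Omega> \<T> k m c e \<theta> dt w G st st' \<longleftrightarrow>
     (let \<rho> = interp_field \<theta> (density st) (density st');
          M = interp_field (1/2) (momentum st) (momentum st');
          E = interp_field (1/2) (electric st) (electric st');
          B = interp_field (1/2) (magnetic st) (magnetic st')
      in \<forall>\<mu>\<in>VQ \<Omega> \<T> (k + 1).
        integral \<Omega> (\<lambda>x. ((momentum st' x - momentum st x) /\<^sub>R dt) \<bullet> \<mu> x) =
        integral \<Omega> (\<lambda>x. convect \<Omega> w \<mu> M x - convect \<Omega> \<mu> w M x)
        - integral \<Omega> (\<lambda>x. \<rho> x * (\<mu> x \<bullet> grad \<Omega> G x) * c\<^sup>2)
        + e / m * integral \<Omega> (\<lambda>x. \<rho> x * ((E x + cross3 (w x) (B x /\<^sub>R c)) \<bullet> \<mu> x)))"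

definition ampere_eq where
  "ampere_eq \<Omega> \<T> k N wt m c e \<theta> dt w tr st st' \<longleftrightarrow>
     (let \<rho> = interp_field \<theta> (density st) (density st');
          B = interp_field (1/2) (magnetic st) (magnetic st')
      in \<forall>\<nu>\<in>Ned0 \<Omega> \<T> k.
        integral \<Omega> (\<lambda>x. ((electric st' x - electric st x) /\<^sub>R dt) \<bullet> \<nu> x) =
        c * integral \<Omega> (\<lambda>x. B x \<bullet> curl \<Omega> \<nu> x)
        - 4 * pi * e / m * integral \<Omega> (\<lambda>x. \<rho> x * (w x \<bullet> \<nu> x))
        - 4 * pi * e * (\<Sum>p\<in>{1..N::nat}. \<Sum>i\<in>{1..nseg (tr p)}.
            wt p * ((step_vec (tr p) i /\<^sub>R dt) \<bullet> segment_mean (tr p) \<nu> i)))"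

definition faraday_eq where
  "faraday_eq \<Omega> \<T> k c dt st st' \<longleftrightarrow>
     (let E = interp_field (1/2) (electric st) (electric st')
      in \<forall>\<tau>\<in>RT0 \<Omega> \<T> k.
        integral \<Omega> (\<lambda>x. ((magnetic st' x - magnetic st x) /\<^sub>R dt) \<bullet> \<tau> x) =
        - c * integral \<Omega> (\<lambda>x. \<tau> x \<bullet> curl \<Omega> E x))"

definition particle_eqs where
  "particle_eqs N m c e dt tr st st' \<longleftrightarrow>
     (let E = interp_field (1/2) (electric st) (electric st');
          B = interp_field (1/2) (magnetic st) (magnetic st')
      in \<forall>p\<in>{1..N::nat}.
        let X = position st p; X' = position st' p; U = impulse st p; U' = impulse st' p
        in (X' - X) /\<^sub>R dt =
             integral {0..1} (\<lambda>\<xi>::real. interp \<xi> U U' /\<^sub>R (m * lorentz m c (interp \<xi> U U'))) \<and>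
           (U' - U) /\<^sub>R dt =
             e *\<^sub>R ((\<Sum>i\<in>{1..nseg (tr p)}. D_matrix X X' (tr p) i *v segment_mean (tr p) E i)
               + (1 / m) *\<^sub>R cross3
                   (integral {0..1} (\<lambda>\<xi>::real. interp \<xi> U U' /\<^sub>R lorentz m c (interp \<xi> U U')))
                   (trace (interior (cell (tr p) (midseg (tr p)))) B (interp (1/2) X X') /\<^sub>R c)))"

text \<open>One time step from \<open>st\<close> to \<open>st'\<close>. The density is required to vanish nowhere in \<open>\<Omega>\<close>
  at any intermediate time.\<close>

definition scheme_I ::
  "vec3 set \<Rightarrow> vec3 set set \<Rightarrow> nat \<Rightarrow> nat \<Rightarrow> (nat \<Rightarrow> real) \<Rightarrow> real \<Rightarrow> real \<Rightarrow> real \<Rightarrow> real \<Rightarrow> real \<Rightarrow>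
   pic_state \<Rightarrow> pic_state \<Rightarrow> bool" where
  "scheme_I \<Omega> \<T> k N wt m c e \<theta> dt st st' \<longleftrightarrow>
     (\<forall>\<xi>\<in>{0..1}. \<forall>K\<in>\<T>. \<forall>x\<in>K \<inter> \<Omega>.
        trace (interior K) (interp_field \<xi> (density st) (density st')) x \<noteq> 0) \<and>
     (\<exists>w G tr.
        is_L2_projection \<Omega> (VQ \<Omega> \<T> (k + 1)) (mean_velocity m c st st') w \<and>
        is_L2_projection \<Omega> (Q \<Omega> \<T> (k + 1)) (mean_G m c st st') G \<and>
        (\<forall>p\<in>{1..N}. is_trajectory \<T> (position st p) (position st' p) (tr p)) \<and>
        continuity_eq \<Omega> \<T> k \<theta> dt w st st' \<and>
        momentum_eq \<Omega> \<T> k m c e \<theta> dt w G st st' \<and>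
        ampere_eq \<Omega> \<T> k N wt m c e \<theta> dt w tr st st' \<and>
        faraday_eq \<Omega> \<T> k c dt st st' \<and>
        particle_eqs N m c e dt tr st st')"


section \<open>Conserved quantities\<close>

definition fluid_mass :: "vec3 set set \<Rightarrow> pic_state \<Rightarrow> real" where
  "fluid_mass \<T> st = integral (\<Union>\<T>) (density st)"

text \<open>The weights do not depend on the time level, so this is constant by construction.\<close>

definition particle_mass :: "nat \<Rightarrow> (nat \<Rightarrow> real) \<Rightarrow> pic_state \<Rightarrow> real" where
  "particle_mass N wt st = (\<Sum>p\<in>{1..N}. wt p)"

definition total_energy ::
  "vec3 set set \<Rightarrow> nat \<Rightarrow> (nat \<Rightarrow> real) \<Rightarrow> real \<Rightarrow> real \<Rightarrow> pic_state \<Rightarrow> real" where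
  "total_energy \<T> N wt m c st =
     integral (\<Union>\<T>) (\<lambda>x. density st x *
       (lorentz m c ((m / density st x) *\<^sub>R momentum st x) - 1) * c\<^sup>2)
     + (\<Sum>p\<in>{1..N}. wt p * (lorentz m c (impulse st p) - 1) * m * c\<^sup>2)
     + 1 / (8 * pi) * integral (\<Union>\<T>) (\<lambda>x. (norm (electric st x))\<^sup>2 + (norm (magnetic st x))\<^sup>2)"

text \<open>Tested against \<open>\<phi> \<in> Q0 \<Omega> \<T> (k + 1)\<close>, the point mass at \<open>X\<^sub>p\<close> yields the value \<open>\<phi>(X\<^sub>p)\<close> of
  the continuous representative of \<open>\<phi>\<close>, i.e. its limit from the cell interiors.\<close>

definition gauss_residual ::
  "vec3 set \<Rightarrow> vec3 set set \<Rightarrow> nat \<Rightarrow> nat \<Rightarrow> (nat \<Rightarrow> real) \<Rightarrow> real \<Rightarrow> real \<Rightarrow>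
   pic_state \<Rightarrow> (vec3 \<Rightarrow> real) \<Rightarrow> real" where
  "gauss_residual \<Omega> \<T> k N wt m e st \<phi> =
     integral (\<Union>\<T>) (\<lambda>x.
       (weak_divergence \<Omega> \<T> k (electric st) x - 4 * pi * e * (density st x / m)) * \<phi> x)
     - 4 * pi * e * (\<Sum>p\<in>{1..N}. wt p * trace (\<Union>K\<in>\<T>. interior K) \<phi> (position st p))"

end

theory Submission
  imports Defs
begin

text \<open>
  Each conserved quantity is the sum of a few equations of the scheme for well-chosen test
  functions; the difficulty is to show that these test functions are admissible and that the
  expressions obtained match.

  \<^item> Mass: the constant function 1 in the continuity equation (\<open>fluid_mass_step\<close>).

  \<^item> Energy: the density \<open>\<rho> (\<gamma>(m M / \<rho>) - 1) c\<^sup>2\<close> has the derivative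
    \<open>M / (\<rho> \<gamma>)\<close> in \<open>M\<close> and \<open>c\<^sup>2\<close> times the integrand of \<open>G\<close> in \<open>\<rho>\<close>.
    Integrated along the segment joining two time levels, its increment is therefore
    exactly \<open>c\<^sup>2 (\<rho>' - \<rho>) mean_G + (M' - M) \<bullet> mean_velocity\<close>, and since
    \<open>\<rho>' - \<rho>\<close> and \<open>M' - M\<close> are finite element functions the two means may be replaced
    by their projections \<open>G\<close> and \<open>w\<close> (\<open>fluid_energy_step\<close>). The continuity equation tested
    with \<open>G\<close> and the momentum equation tested with \<open>w\<close> then leave only the work of the electric
    field (\<open>fluid_work\<close>): the convective terms and the magnetic force cancel. This work, and the
    work on the particles (\<open>particle_work\<close>, where the matrices \<open>D\<close> turn the displacement into
    the displacement within one cell), is what the field loses by the equations of Ampere and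
    Faraday tested with the mean fields (\<open>field_energy_step\<close>).

  \<^item> Gauss law: Ampere's equation is tested with \<open>\<nabla>\<phi>\<close> and the continuity equation
    with \<open>\<phi>\<close>. This needs \<open>\<nabla>\<phi>\<close> to be an admissible Nedelec field without curl
    (\<open>classical_grad_Ned0\<close>), and the line integrals of \<open>\<nabla>\<phi>\<close> over the sub-segments of a
    trajectory to telescope (\<open>sum_segment_mean_grad\<close>), that is, \<open>\<phi>\<close> to have the same value
    in all cells meeting at a point (\<open>Q0_trace_unique\<close>).

  \<^item> Divergence: \<open>curl E\<close> is an admissible Raviart-Thomas field (\<open>classical_curl_RT0\<close>), so that
    Faraday's equation holds pointwise almost everywhere, and a curl has no divergence
    (\<open>divergence_step\<close>).

  The weak derivatives are arbitrary representatives of classes modulo null sets. They are made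
  concrete by the fundamental lemma of the calculus of variations
  (\<open>negligible_if_test_fun_integrals_0\<close>): inside a cell they agree almost everywhere with the
  classical derivatives of the polynomial living there, and so \<open>classical_grad \<phi>\<close> and
  \<open>classical_curl E\<close> serve as representatives which are polynomial in every cell interior.

  The continuity of a piecewise polynomial function of class \<open>H1\<close> at points shared by cells is
  obtained without looking at the geometry of the cells: its weak gradient is bounded, so its
  averages against a fixed bump change by at most a constant times the displacement of the bump
  (\<open>integral_bump_diff\<close>); averages over small cubes inside two cells near a common point can thus
  not stay apart (\<open>Q_le_across_cells\<close>). This works at points of the open domain. At its boundary
  continuity may fail in \<open>H1\<close>, as two cells may touch in a single boundary point, but there the
  functions vanish in all cells by the boundary condition.
\<close>

section \<open>Smooth functions and bumps\<close>

lemma partial_eq: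
  assumes "(f has_derivative f') (at x)"
  shows "partial i f x = f' (axis i 1)"
  using frechet_derivative_at[OF assms] by (simp add: partial_def)

lemma sum_axis_mult: "(\<Sum>j\<in>UNIV. axis i 1 $ j * c j) = (c i :: real)"
proof -
  have "(\<Sum>j\<in>UNIV. axis i 1 $ j * c j) = (\<Sum>j\<in>UNIV. if j = i then c j else 0)"
    by (rule sum.cong) (auto simp: axis_def)
  then show ?thesis by simp
qed

lemma has_derivative_partial:
  assumes "f differentiable (at x)"
  shows "(f has_derivative (\<lambda>v. \<Sum>i\<in>UNIV. v $ i * partial i f x)) (at x)"
proof -
  have d: "(f has_derivative frechet_derivative f (at x)) (at x)"
    using assms frechet_derivative_works by blast
  have "frechet_derivative f (at x) v = (\<Sum>i\<in>UNIV. v $ i * partial i f x)" for v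
  proof -
    interpret bounded_linear "frechet_derivative f (at x)"
      using d by (rule has_derivative_bounded_linear)
    have "frechet_derivative f (at x) v = frechet_derivative f (at x) (\<Sum>i\<in>UNIV. v $ i *\<^sub>R axis i 1)"
      using basis_expansion[of v] by (simp add: scalar_mult_eq_scaleR)
    also have "\<dots> = (\<Sum>i\<in>UNIV. v $ i * partial i f x)"
      by (simp add: sum scaleR partial_def)
    finally show ?thesis .
  qed
  then have "frechet_derivative f (at x) = (\<lambda>v. \<Sum>i\<in>UNIV. v $ i * partial i f x)" by auto
  then show ?thesis using d by simp
qed

lemma partial_add:
  assumes "f differentiable (at x)" "g differentiable (at x)"
  shows "partial i (\<lambda>x. f x + g x) x = partial i f x + partial i g x"
  using partial_eq[OF has_derivative_add[OF assms[THEN has_derivative_partial]], of i]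
  by (simp add: sum_axis_mult)

lemma partial_diff:
  assumes "f differentiable (at x)" "g differentiable (at x)"
  shows "partial i (\<lambda>x. f x - g x) x = partial i f x - partial i g x"
  using partial_eq[OF has_derivative_diff[OF assms[THEN has_derivative_partial]], of i]
  by (simp add: sum_axis_mult)

lemma partial_mult:
  assumes "f differentiable (at x)" "g differentiable (at x)"
  shows "partial i (\<lambda>x. f x * g x) x = f x * partial i g x + partial i f x * g x"
  using partial_eq[OF has_derivative_mult[OF assms[THEN has_derivative_partial]], of i]
  by (simp add: sum_axis_mult)

lemma partial_const [simp]: "partial i (\<lambda>x. c) x = 0"
  by (rule partial_eq) simp

lemma C_diff_continuous: "C_diff n f \<Longrightarrow> continuous_on S f"
proof -
  assume "C_diff n f"
  then have "continuous_on UNIV f"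
    by (cases n) (auto intro!: differentiable_imp_continuous_on simp: differentiable_on_def
        intro: differentiable_at_withinI)
  then show ?thesis by (rule continuous_on_subset) simp
qed

lemma C_diff_SucD: "C_diff (Suc n) f \<Longrightarrow> C_diff n f"
proof (induction n arbitrary: f)
  case 0 then show ?case using C_diff_continuous[of "Suc 0" f UNIV] by simp
qed auto

lemma C_diff_const: "C_diff n (\<lambda>x. c)"
proof (induction n arbitrary: c)
  case (Suc n)
  have "partial i (\<lambda>x. c) = (\<lambda>x. 0)" for i by (auto simp: fun_eq_iff)
  with Suc show ?case by simp
qed simp

lemma C_diff_add: "C_diff n f \<Longrightarrow> C_diff n g \<Longrightarrow> C_diff n (\<lambda>x. f x + g x)"
proof (induction n arbitrary: f g)
  case 0 then show ?case by (auto intro: continuous_intros)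
next
  case (Suc n)
  then have "partial i (\<lambda>x. f x + g x) = (\<lambda>x. partial i f x + partial i g x)" for i
    by (auto simp: partial_add)
  with Suc show ?case by auto
qed

lemma C_diff_mult: "C_diff n f \<Longrightarrow> C_diff n g \<Longrightarrow> C_diff n (\<lambda>x. f x * g x)"
proof (induction n arbitrary: f g)
  case 0 then show ?case by (auto intro: continuous_intros)
next
  case (Suc n)
  then have "partial i (\<lambda>x. f x * g x) = (\<lambda>x. f x * partial i g x + partial i f x * g x)" for i
    by (auto simp: partial_mult)
  with Suc show ?case
    using C_diff_SucD[OF Suc.prems(1)] C_diff_SucD[OF Suc.prems(2)] by (auto intro!: C_diff_add)
qed

lemma C_diff_diff: "C_diff n f \<Longrightarrow> C_diff n g \<Longrightarrow> C_diff n (\<lambda>x. f x - g x)"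
  using C_diff_add[OF _ C_diff_mult[OF C_diff_const[of n "-1"]], of f g] by simp

lemma C_diff_prod: "(\<And>j. j \<in> J \<Longrightarrow> C_diff n (f j)) \<Longrightarrow> C_diff n (\<lambda>x. \<Prod>j\<in>J. f j x)"
  by (induction J rule: infinite_finite_induct) (auto intro: C_diff_const C_diff_mult)

lemma has_real_derivative_along_axis:
  assumes "f differentiable (at (x + t *\<^sub>R axis i 1))"
  shows "((\<lambda>t. f (x + t *\<^sub>R axis i 1)) has_real_derivative partial i f (x + t *\<^sub>R axis i 1)) (at t)"
proof -
  have 1: "((\<lambda>t. x + t *\<^sub>R axis i 1) has_derivative (\<lambda>s. s *\<^sub>R axis i 1)) (at t)"
    by (auto intro!: derivative_eq_intros)
  have "((\<lambda>t. f (x + t *\<^sub>R axis i 1)) has_derivative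
      (\<lambda>s. \<Sum>j\<in>UNIV. (s *\<^sub>R axis i 1) $ j * partial j f (x + t *\<^sub>R axis i 1))) (at t)"
    using has_derivative_compose[OF 1 has_derivative_partial[OF assms]] .
  also have "(\<lambda>s. \<Sum>j\<in>UNIV. (s *\<^sub>R axis i 1) $ j * partial j f (x + t *\<^sub>R axis i 1)) =
     (*) (partial i f (x + t *\<^sub>R axis i 1))"
    by (auto simp: fun_eq_iff mult.assoc sum_axis_mult simp flip: sum_distrib_left)
  finally show ?thesis by (simp add: has_field_derivative_def)
qed

text \<open>The mean value theorem is applied along \<open>e\<^sub>i\<close> and then along \<open>e\<^sub>j\<close>. The left-hand side is
  symmetric in \<open>i\<close> and \<open>j\<close>, and so relates the two orders of differentiation.\<close>
lemma second_difference_eq_mixed_partial: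
  assumes f: "C_diff 2 f" and h: "h > 0"
  shows "\<exists>y. norm (y - x) \<le> 2 * h \<and>
    f (x + h *\<^sub>R axis i 1 + h *\<^sub>R axis j 1) - f (x + h *\<^sub>R axis i 1) - f (x + h *\<^sub>R axis j 1) + f x
     = h\<^sup>2 * partial j (partial i f) y"
proof -
  have df: "f differentiable (at z)" and dpf: "partial i f differentiable (at z)" for z i
    using f by (auto simp: numeral_2_eq_2)
  let ?g = "\<lambda>s. f (x + h *\<^sub>R axis j 1 + s *\<^sub>R axis i 1) - f (x + s *\<^sub>R axis i 1)"
  have "\<exists>s. 0 < s \<and> s < h \<and> ?g h - ?g 0 = (h - 0) * (partial i f (x + h *\<^sub>R axis j 1 + s *\<^sub>R axis i 1) - partial i f (x + s *\<^sub>R axis i 1))"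
    by (rule MVT2) (use h in \<open>auto intro!: derivative_intros has_real_derivative_along_axis df\<close>)
  then obtain s where s: "0 < s" "s < h" "?g h - ?g 0 = h * (partial i f (x + h *\<^sub>R axis j 1 + s *\<^sub>R axis i 1) - partial i f (x + s *\<^sub>R axis i 1))"
    by auto
  let ?k = "\<lambda>r. partial i f (x + s *\<^sub>R axis i 1 + r *\<^sub>R axis j 1)"
  have "\<exists>r. 0 < r \<and> r < h \<and> ?k h - ?k 0 = (h - 0) * partial j (partial i f) (x + s *\<^sub>R axis i 1 + r *\<^sub>R axis j 1)"
    by (rule MVT2) (use h in \<open>auto intro!: derivative_intros has_real_derivative_along_axis dpf\<close>)
  then obtain r where r: "0 < r" "r < h" "?k h - ?k 0 = h * partial j (partial i f) (x + s *\<^sub>R axis i 1 + r *\<^sub>R axis j 1)"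
    by auto
  have "norm (s *\<^sub>R axis i (1::real) + r *\<^sub>R axis j 1 :: vec3) \<le> s + r"
    using norm_triangle_ineq[of "s *\<^sub>R axis i (1::real) :: vec3" "r *\<^sub>R axis j 1"] s r by simp
  then have "norm ((x + s *\<^sub>R axis i 1 + r *\<^sub>R axis j 1) - x) \<le> 2 * h"
    using s r by (simp add: algebra_simps)
  moreover have "?g h - ?g 0 = h * (h * partial j (partial i f) (x + s *\<^sub>R axis i 1 + r *\<^sub>R axis j 1))"
    using s(3) r(3) by (simp add: algebra_simps)
  ultimately show ?thesis
    by (intro exI[of _ "x + s *\<^sub>R axis i 1 + r *\<^sub>R axis j 1"]) (simp add: algebra_simps power2_eq_square)
qed

text \<open>Schwarz's theorem: by symmetry of the second difference, the two mixed derivatives take a common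
  value at two points arbitrarily close to \<open>x\<close>.\<close>
lemma partial_commute:
  assumes f: "C_diff 2 f"
  shows "partial i (partial j f) x = partial j (partial i f) x"
proof (rule ccontr)
  let ?a = "partial i (partial j f)" and ?b = "partial j (partial i f)"
  assume ne: "?a x \<noteq> ?b x"
  define e where "e = \<bar>?a x - ?b x\<bar> / 2"
  have e: "e > 0" using ne by (simp add: e_def)
  have "continuous_on UNIV ?a" "continuous_on UNIV ?b"
    using f by (auto simp: numeral_2_eq_2)
  then have "isCont ?a x" "isCont ?b x"
    by (auto simp: continuous_on_eq_continuous_at)
  with e obtain d1 d2 where d: "d1 > 0" "d2 > 0"
     "\<And>y. norm (y - x) < d1 \<Longrightarrow> \<bar>?a y - ?a x\<bar> < e" "\<And>y. norm (y - x) < d2 \<Longrightarrow> \<bar>?b y - ?b x\<bar> < e"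
    unfolding continuous_at_eps_delta dist_norm real_norm_def by metis
  define h where "h = min d1 d2 / 4"
  have h: "h > 0" "2 * h < d1" "2 * h < d2" using d by (auto simp: h_def)
  obtain y where y: "norm (y - x) \<le> 2 * h"
    "f (x + h *\<^sub>R axis i 1 + h *\<^sub>R axis j 1) - f (x + h *\<^sub>R axis i 1) - f (x + h *\<^sub>R axis j 1) + f x
     = h\<^sup>2 * ?b y"
    using second_difference_eq_mixed_partial[OF f h(1), of x i j] by auto
  obtain z where z: "norm (z - x) \<le> 2 * h"
    "f (x + h *\<^sub>R axis j 1 + h *\<^sub>R axis i 1) - f (x + h *\<^sub>R axis j 1) - f (x + h *\<^sub>R axis i 1) + f x
     = h\<^sup>2 * ?a z"
    using second_difference_eq_mixed_partial[OF f h(1), of x j i] by auto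
  have "h\<^sup>2 * ?b y = h\<^sup>2 * ?a z" using y(2) z(2) by (simp add: algebra_simps)
  then have "?b y = ?a z" using h by simp
  moreover have "\<bar>?a z - ?a x\<bar> < e" "\<bar>?b y - ?b x\<bar> < e" using d y z h by auto
  ultimately show False unfolding e_def by (smt (verit) field_sum_of_halves)
qed

text \<open>The case \<open>k = 0\<close> is the classical smooth function that vanishes to infinite order at 0; the
  powers of \<open>t\<close> make the family closed under differentiation. As \<open>\<epsilon>\<close> tends to 0,
  \<open>flat \<epsilon> 0\<close> tends to the indicator of the positive reals.\<close>
definition flat :: "real \<Rightarrow> nat \<Rightarrow> real \<Rightarrow> real" where
  "flat \<epsilon> k t = (if t \<le> 0 then 0 else exp (- \<epsilon> / t) / t ^ k)"

lemma flat_tendsto_0: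
  assumes "\<epsilon> > 0"
  shows "(flat \<epsilon> k \<longlongrightarrow> 0) (at 0)"
proof -
  have "filterlim (\<lambda>t::real. \<epsilon> / t) at_top (at_right 0)"
    using assms by real_asymp
  then have "((\<lambda>t. (\<epsilon>/t) ^ k / exp (\<epsilon>/t)) \<longlongrightarrow> 0) (at_right 0)"
    by (rule filterlim_compose[OF tendsto_power_div_exp_0])
  then have "((\<lambda>t. (1 / \<epsilon>) ^ k * ((\<epsilon>/t) ^ k / exp (\<epsilon>/t))) \<longlongrightarrow> 0) (at_right 0)"
    using tendsto_mult_right_zero by blast
  moreover have "\<forall>\<^sub>F t in at_right 0. (1 / \<epsilon>) ^ k * ((\<epsilon>/t) ^ k / exp (\<epsilon>/t)) = flat \<epsilon> k t"
    using assms by (auto simp: eventually_at_filter flat_def exp_minus field_simps power_divide)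
  ultimately have 1: "(flat \<epsilon> k \<longlongrightarrow> 0) (at_right 0)"
    using Lim_transform_eventually by blast
  have "(flat \<epsilon> k \<longlongrightarrow> 0) (at_left 0)"
    by (rule Lim_transform_eventually[OF tendsto_const]) (auto simp: eventually_at_filter flat_def)
  with 1 show ?thesis by (simp add: filterlim_split_at)
qed

lemma has_real_derivative_flat:
  assumes "\<epsilon> > 0"
  shows "(flat \<epsilon> k has_real_derivative \<epsilon> * flat \<epsilon> (k + 2) t - real k * flat \<epsilon> (k + 1) t) (at t)"
proof -
  consider "t < 0" | "t = 0" | "t > 0" by linarith
  then show ?thesis
  proof cases
    case 1
    have "((\<lambda>t. 0) has_real_derivative 0) (at t)" by simp
    then have "(flat \<epsilon> k has_real_derivative 0) (at t)"
      by (rule DERIV_cong_ev[THEN iffD1, rotated -1, OF _ refl _ refl])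
         (use 1 in \<open>auto simp: flat_def intro!: eventually_mono[OF order_tendstoD(2)[OF tendsto_ident_at]]
            simp: eventually_nhds intro: exI[of _ "{..<0}"]\<close>)
    with 1 show ?thesis by (simp add: flat_def)
  next
    case 2
    have "(\<lambda>h. (flat \<epsilon> k (0 + h) - flat \<epsilon> k 0) / h) = flat \<epsilon> (k + 1)"
      by (auto simp: flat_def)
    with flat_tendsto_0[OF assms, of "k+1"] show ?thesis
      by (simp add: DERIV_def 2) (simp add: flat_def)
  next
    case 3
    have "((\<lambda>t. exp (- \<epsilon> / t) / t ^ k) has_real_derivative
       \<epsilon> * (exp (- \<epsilon> / t) / t ^ (k+2)) - real k * (exp (- \<epsilon> / t) / t ^ (k+1))) (at t)"
      by (use 3 in \<open>auto intro!: derivative_eq_intros simp: field_simps power2_eq_square\<close>)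
         (cases k; use 3 in \<open>simp add: field_simps\<close>)
    then have "(flat \<epsilon> k has_real_derivative
       \<epsilon> * (exp (- \<epsilon> / t) / t ^ (k+2)) - real k * (exp (- \<epsilon> / t) / t ^ (k+1))) (at t)"
      by (rule DERIV_cong_ev[THEN iffD1, rotated -1, OF _ refl _ refl])
         (use 3 in \<open>auto simp: flat_def eventually_nhds intro: exI[of _ "{0<..}"]\<close>)
    with 3 show ?thesis by (simp add: flat_def)
  qed
qed

text \<open>The induction is possible because a derivative is again a combination of such functions, with larger
  exponents \<open>k\<close>.\<close>
lemma C_diff_flat_affine:
  assumes "\<epsilon> > 0"
  shows "C_diff n (\<lambda>x. flat \<epsilon> k (v \<bullet> x - a))"
proof (induction n arbitrary: k)
  have d: "((\<lambda>x::vec3. flat \<epsilon> k (v \<bullet> x - a)) has_derivative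
     (\<lambda>y. (\<epsilon> * flat \<epsilon> (k + 2) (v \<bullet> x - a) - real k * flat \<epsilon> (k + 1) (v \<bullet> x - a)) * (v \<bullet> y))) (at x)" for x k
    by (rule has_derivative_compose[OF _ has_real_derivative_flat[OF assms, unfolded has_field_derivative_def]])
       (auto intro!: derivative_eq_intros)
  case 0 show ?case using d by (auto intro!: has_derivative_continuous_on[of UNIV] simp: has_derivative_at_withinI)
  case (Suc n)
  have "partial i (\<lambda>x. flat \<epsilon> k (v \<bullet> x - a)) =
    (\<lambda>x. (v \<bullet> axis i 1) * (\<epsilon> * flat \<epsilon> (k + 2) (v \<bullet> x - a) - real k * flat \<epsilon> (k + 1) (v \<bullet> x - a)))" for i
    using partial_eq[OF d] by (auto simp: fun_eq_iff)
  with d Suc show ?case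
    by (auto intro!: C_diff_mult C_diff_diff C_diff_const simp: differentiable_def simp del: add_2_eq_Suc' add_2_eq_Suc)
qed

text \<open>For \<open>\<epsilon> \<rightarrow> 0\<close> these functions tend, from below, to the indicator of the box: this is
  how statements about test functions become statements about boxes.\<close>
definition bump :: "real \<Rightarrow> vec3 \<Rightarrow> vec3 \<Rightarrow> vec3 \<Rightarrow> real" where
  "bump \<epsilon> a b x = (\<Prod>j\<in>UNIV. flat \<epsilon> 0 (x $ j - a $ j) * flat \<epsilon> 0 (b $ j - x $ j))"

lemma flat_0_bounds: "\<epsilon> > 0 \<Longrightarrow> 0 \<le> flat \<epsilon> 0 t" "\<epsilon> > 0 \<Longrightarrow> flat \<epsilon> 0 t \<le> 1"
  by (auto simp: flat_def divide_nonneg_nonneg)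

lemma C_diff_bump: "\<epsilon> > 0 \<Longrightarrow> C_diff n (bump \<epsilon> a b)"
proof -
  assume e: "\<epsilon> > 0"
  have "C_diff n (\<lambda>x. flat \<epsilon> 0 (x $ j - a $ j) * flat \<epsilon> 0 (b $ j - x $ j))" for j
    using C_diff_mult[OF C_diff_flat_affine[OF e, of n 0 "axis j 1" "a $ j"]
        C_diff_flat_affine[OF e, of n 0 "- axis j 1" "- b $ j"]]
    by (simp add: inner_axis' algebra_simps)
  then show ?thesis unfolding bump_def by (intro C_diff_prod)
qed

lemma bump_bounds: "\<epsilon> > 0 \<Longrightarrow> 0 \<le> bump \<epsilon> a b x" "\<epsilon> > 0 \<Longrightarrow> bump \<epsilon> a b x \<le> 1"
  unfolding bump_def
  by (auto intro!: prod_nonneg prod_le_1 mult_le_one simp: flat_0_bounds)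

lemma bump_eq_0_iff: "bump \<epsilon> a b x = 0 \<longleftrightarrow> x \<notin> box a b"
  by (auto simp: bump_def flat_def mem_box_cart) (meson not_le)+

lemma bump_tendsto_1:
  assumes "x \<in> box a b"
  shows "(\<lambda>n. bump (1 / real (Suc n)) a b x) \<longlonglongrightarrow> 1"
proof -
  have 1: "(\<lambda>n. flat (1 / real (Suc n)) 0 t) \<longlonglongrightarrow> 1" if "t > 0" for t
  proof -
    have "(\<lambda>n. exp (- (1 / real (Suc n)) / t)) \<longlonglongrightarrow> exp (- 0 / t)"
      by (intro tendsto_intros LIMSEQ_Suc[OF lim_1_over_n]) (use that in auto)
    with that show ?thesis by (simp add: flat_def)
  qed
  have "(\<lambda>n. bump (1 / real (Suc n)) a b x) \<longlonglongrightarrow> (\<Prod>j\<in>(UNIV::3 set). 1 * 1)"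
    unfolding bump_def
    by (intro tendsto_prod tendsto_mult 1) (use assms in \<open>auto simp: mem_box_cart\<close>)
  then show ?thesis by simp
qed

lemma test_fun_bump:
  assumes "\<epsilon> > 0" "cbox a b \<subseteq> U"
  shows "test_fun U (bump \<epsilon> a b)"
proof -
  have "closure {x. bump \<epsilon> a b x \<noteq> 0} \<subseteq> cbox a b"
    by (rule closure_minimal) (auto simp: bump_eq_0_iff intro: box_subset_cbox[THEN subsetD])
  moreover from this have "compact (closure {x. bump \<epsilon> a b x \<noteq> 0})"
    by (metis closed_closure compact_Int_closed compact_cbox inf.absorb_iff2)
  ultimately show ?thesis using assms C_diff_bump
    by (auto simp: test_fun_def)
qed

lemma bump_translate: "bump \<epsilon> (a + v) (b + v) (x + v) = bump \<epsilon> a b x"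
  by (simp add: bump_def)

section \<open>Test functions and the fundamental lemma\<close>

lemma negligible_if_integral_norm_0:
  fixes f :: "'a::euclidean_space \<Rightarrow> 'b::euclidean_space"
  assumes f: "f absolutely_integrable_on S" and 0: "integral S (\<lambda>x. norm (f x)) = 0"
  shows "negligible {x\<in>S. f x \<noteq> 0}"
proof -
  have n: "(\<lambda>x. norm (f x)) absolutely_integrable_on S"
    using f by (rule set_integrable_norm)
  have "integral\<^sup>L lebesgue (\<lambda>x. indicator S x *\<^sub>R norm (f x)) = 0"
    using set_lebesgue_integral_eq_integral(2)[OF n] 0 by (simp add: set_lebesgue_integral_def)
  then have "AE x in lebesgue. indicator S x *\<^sub>R norm (f x) = 0"
    using integral_nonneg_eq_0_iff_AE[of lebesgue "\<lambda>x. indicator S x *\<^sub>R norm (f x)"] n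
    by (auto simp: set_integrable_def)
  then obtain N where "negligible N" "{x. \<not> indicator S x *\<^sub>R norm (f x) = 0} \<subseteq> N"
    unfolding eventually_ae_filter_negligible by auto
  then show ?thesis by (elim negligible_subset) (auto simp: indicator_def)
qed

text \<open>If all integrals over boxes vanish, a Riemann sum of \<open>norm \<circ> f\<close> is the sum of the defects
  \<open>norm (content K *\<^sub>R f x - integral K f)\<close>, which Henstock's lemma makes arbitrarily small; so
  \<open>norm \<circ> f\<close> has integral 0.\<close>
lemma negligible_if_box_integrals_0:
  fixes f :: "'a::euclidean_space \<Rightarrow> 'b::euclidean_space"
  assumes f: "f absolutely_integrable_on cbox a b"
    and 0: "\<And>c d. cbox c d \<subseteq> cbox a b \<Longrightarrow> integral (cbox c d) f = 0"
  shows "negligible {x\<in>cbox a b. f x \<noteq> 0}"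
proof -
  have fi: "f integrable_on cbox a b" using f by (simp add: set_lebesgue_integral_eq_integral)
  have "((\<lambda>x. norm (f x)) has_integral 0) (cbox a b)"
    unfolding has_integral
  proof (intro allI impI)
    fix e :: real assume "e > 0"
    have "\<exists>\<gamma>. gauge \<gamma> \<and> (\<forall>p. p tagged_partial_division_of cbox a b \<longrightarrow> \<gamma> fine p \<longrightarrow>
             sum (\<lambda>(x,k). norm(measure lborel k *\<^sub>R f x - integral k f)) p < e)"
    proof (rule Henstock_lemma[OF fi \<open>e > 0\<close>])
      fix \<gamma> assume "gauge \<gamma>" and h: "\<And>p. \<lbrakk>p tagged_partial_division_of cbox a b; \<gamma> fine p\<rbrakk> \<Longrightarrow>
             sum (\<lambda>(x,k). norm(measure lborel k *\<^sub>R f x - integral k f)) p < e"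
      then show ?thesis by (intro exI[of _ \<gamma>] conjI allI impI h)
    qed
    then obtain \<gamma> where \<gamma>: "gauge \<gamma>" "\<forall>p. p tagged_partial_division_of cbox a b \<longrightarrow> \<gamma> fine p \<longrightarrow>
             sum (\<lambda>(x,k). norm(measure lborel k *\<^sub>R f x - integral k f)) p < e"
      by (elim exE conjE)
    have "norm ((\<Sum>(x, k)\<in>p. measure lborel k *\<^sub>R norm (f x)) - 0) < e"
      if p: "p tagged_division_of cbox a b" "\<gamma> fine p" for p
    proof -
      have "(\<Sum>(x, k)\<in>p. measure lborel k *\<^sub>R norm (f x)) = sum (\<lambda>(x,k). norm(measure lborel k *\<^sub>R f x - integral k f)) p"
      proof (rule sum.cong)
        fix z assume z: "z \<in> p"
        obtain x k where zxk: "z = (x, k)" by (cases z)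
        obtain c d where "k = cbox c d" "cbox c d \<subseteq> cbox a b"
          using tagged_division_ofD(3)[OF p(1), of x k] tagged_division_ofD(4)[OF p(1), of x k] z zxk by auto
        then show "(case z of (x, k) \<Rightarrow> measure lborel k *\<^sub>R norm (f x)) =
            (case z of (x,k) \<Rightarrow> norm(measure lborel k *\<^sub>R f x - integral k f))"
          using 0 zxk by simp
      qed simp
      also have "\<dots> < e" using \<gamma>(2) p by (simp add: tagged_division_of_def)
      finally show ?thesis by (simp add: sum_nonneg split_beta)
    qed
    with \<gamma>(1) show "\<exists>\<gamma>. gauge \<gamma> \<and> (\<forall>\<D>. \<D> tagged_division_of cbox a b \<and> \<gamma> fine \<D> \<longrightarrow>
       norm ((\<Sum>(x, k)\<in>\<D>. measure lborel k *\<^sub>R norm (f x)) - 0) < e)" by (intro exI[of _ \<gamma>]) auto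
  qed
  then show ?thesis using negligible_if_integral_norm_0[OF f] by (simp add: integral_unique)
qed

lemma continuous_on_if_differentiable:
  "(\<And>x. f differentiable (at x)) \<Longrightarrow> continuous_on S f"
  by (rule differentiable_imp_continuous_on) (simp add: differentiable_on_def differentiable_at_withinI)

lemma compact_support_bounded:
  fixes u :: "'a::topological_space \<Rightarrow> real"
  assumes "continuous_on UNIV u" "compact K" "\<And>x. x \<notin> K \<Longrightarrow> u x = 0"
  obtains B where "B \<ge> 0" "\<And>x. \<bar>u x\<bar> \<le> B"
proof -
  have "bounded (u ` K)"
    by (intro compact_imp_bounded compact_continuous_image continuous_on_subset[OF assms(1)] assms(2)) simp
  then obtain B where "\<And>x. x \<in> K \<Longrightarrow> \<bar>u x\<bar> \<le> B" unfolding bounded_iff by auto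
  then have "\<bar>u x\<bar> \<le> max B 0" for x
    using assms(3)[of x] by (cases "x \<in> K") (auto simp: le_max_iff_disj)
  then show ?thesis using that[of "max B 0"] by auto
qed

lemma compact_support_absolutely_integrable:
  fixes u :: "vec3 \<Rightarrow> real"
  assumes "continuous_on UNIV u" "compact K" "\<And>x. x \<notin> K \<Longrightarrow> u x = 0" "K \<subseteq> \<Omega>"
  shows "u absolutely_integrable_on \<Omega>"
proof -
  obtain a b where ab: "K \<subseteq> cbox a b"
    using assms(2) bounded_subset_cbox_symmetric compact_imp_bounded by metis
  have "u absolutely_integrable_on cbox a b"
    using assms(1) by (intro absolutely_integrable_continuous) (auto intro: continuous_on_subset)
  moreover have "{x \<in> cbox a b - \<Omega>. u x \<noteq> 0} = {}" "{x \<in> \<Omega> - cbox a b. u x \<noteq> 0} = {}"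
    using assms(3,4) ab by auto
  ultimately show ?thesis
    using absolutely_integrable_spike_set_eq[of "cbox a b" \<Omega> u] by (simp only: negligible_empty)
qed

lemma partial_eq_0_outside:
  assumes "closed K" "\<And>x. x \<notin> K \<Longrightarrow> u x = 0" "x \<notin> K"
  shows "partial i u x = 0"
proof -
  have "((\<lambda>x. 0 :: real) has_derivative (\<lambda>_. 0)) (at x)" by simp
  then have "(u has_derivative (\<lambda>_. 0)) (at x)"
    by (rule has_derivative_transform_within_open[of _ _ _ UNIV "- K"]) (use assms in auto)
  then show ?thesis by (simp add: partial_eq)
qed

text \<open>Differentiation under the integral sign by dominated convergence, the difference quotients of \<open>u\<close>
  along \<open>e\<^sub>i\<close> being bounded by \<open>M\<close>. It yields both integration by parts (shifting a compactly
  supported function does not change its integral) and the dependence of averages of \<open>f\<close> on the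
  position of the weight.\<close>
lemma has_real_derivative_integral_shift:
  fixes f u :: "vec3 \<Rightarrow> real"
  assumes \<Omega>: "\<Omega> \<in> sets lebesgue" and f: "f absolutely_integrable_on \<Omega>"
    and u: "\<And>x. u differentiable (at x)" "\<And>x. \<bar>u x\<bar> \<le> B" "\<And>x. \<bar>partial i u x\<bar> \<le> M"
  shows "((\<lambda>t. integral \<Omega> (\<lambda>x. f x * u (x + t *\<^sub>R axis i 1))) has_real_derivative
     integral \<Omega> (\<lambda>x. f x * partial i u (x + t *\<^sub>R axis i 1))) (at t)"
proof -
  let ?e = "axis i 1 :: vec3"
  have cu: "continuous_on UNIV u"
    by (rule continuous_on_if_differentiable[OF u(1)])
  have int: "(\<lambda>x. f x * u (x + t *\<^sub>R ?e)) absolutely_integrable_on \<Omega>" for t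
  proof -
    have "continuous_on \<Omega> (\<lambda>x. u (x + t *\<^sub>R ?e))"
      by (intro continuous_on_compose2[OF cu] continuous_intros) auto
    then have "(\<lambda>x. u (x + t *\<^sub>R ?e)) \<in> borel_measurable (lebesgue_on \<Omega>)"
      using \<Omega> by (rule continuous_imp_measurable_on_sets_lebesgue)
    moreover have "bounded ((\<lambda>x. u (x + t *\<^sub>R ?e)) ` \<Omega>)"
      using u(2) by (auto simp: bounded_iff)
    ultimately show ?thesis
      using absolutely_integrable_bounded_measurable_product[of "\<lambda>a b. b * a", OF _ _ \<Omega> _ f]
      by (simp add: bilinear_conv_bounded_bilinear bounded_bilinear.flip bounded_bilinear_mult)
  qed
  have lip: "\<bar>u (x + (t + h) *\<^sub>R ?e) - u (x + t *\<^sub>R ?e)\<bar> \<le> M * \<bar>h\<bar>" for x h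
  proof -
    have "norm (u (x + (t + h) *\<^sub>R ?e) - u (x + t *\<^sub>R ?e)) \<le> M * norm ((t + h) - t)"
      by (rule field_differentiable_bound[of UNIV "\<lambda>s. u (x + s *\<^sub>R ?e)" "\<lambda>s. partial i u (x + s *\<^sub>R ?e)"])
         (use u in \<open>auto intro!: has_real_derivative_along_axis\<close>)
    then show ?thesis by simp
  qed
  show ?thesis
    unfolding DERIV_def tendsto_at_iff_sequentially comp_def
  proof (intro allI impI)
    fix X :: "nat \<Rightarrow> real" assume X: "\<forall>n. X n \<in> UNIV - {0}" "X \<longlonglongrightarrow> 0"
    let ?q = "\<lambda>n x. f x * u (x + (t + X n) *\<^sub>R ?e) / X n - f x * u (x + t *\<^sub>R ?e) / X n"
    have "(\<lambda>n. integral \<Omega> (?q n)) \<longlonglongrightarrow> integral \<Omega> (\<lambda>x. f x * partial i u (x + t *\<^sub>R ?e))"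
    proof (rule dominated_convergence(2)[where h = "\<lambda>x. M * \<bar>f x\<bar>"])
      show "?q n integrable_on \<Omega>" for n
        using int[THEN set_lebesgue_integral_eq_integral(1)] by (intro integrable_diff integrable_on_divide)
      show "(\<lambda>x. M * \<bar>f x\<bar>) integrable_on \<Omega>"
        using f by (intro integrable_on_mult_right) (simp add: absolutely_integrable_on_def)
      show "norm (?q n x) \<le> M * \<bar>f x\<bar>" for n x
      proof -
        have "norm (?q n x) = \<bar>f x\<bar> * (\<bar>u (x + (t + X n) *\<^sub>R ?e) - u (x + t *\<^sub>R ?e)\<bar> / \<bar>X n\<bar>)"
          by (simp add: abs_mult flip: right_diff_distrib diff_divide_distrib)
        also have "\<dots> \<le> \<bar>f x\<bar> * M"
          using lip[of x "X n"] X by (intro mult_left_mono) (auto simp: divide_le_eq)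
        finally show ?thesis by (simp add: mult.commute)
      qed
      show "(\<lambda>n. ?q n x) \<longlonglongrightarrow> f x * partial i u (x + t *\<^sub>R ?e)" for x
      proof -
        have "(\<lambda>n. (u (x + (t + X n) *\<^sub>R ?e) - u (x + t *\<^sub>R ?e)) / X n) \<longlonglongrightarrow> partial i u (x + t *\<^sub>R ?e)"
          using has_real_derivative_along_axis[of u x t i, OF u(1)] X
          unfolding DERIV_def tendsto_at_iff_sequentially comp_def by blast
        from tendsto_mult_left[OF this, of "f x"] show ?thesis
          by (simp add: diff_divide_distrib right_diff_distrib)
      qed
    qed
    moreover have "integral \<Omega> (?q n) = (integral \<Omega> (\<lambda>x. f x * u (x + (t + X n) *\<^sub>R ?e)) - integral \<Omega> (\<lambda>x. f x * u (x + t *\<^sub>R ?e))) / X n" for n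
      using int[THEN set_lebesgue_integral_eq_integral(1)]
      by (simp add: integral_diff integrable_on_divide diff_divide_distrib)
    ultimately show "(\<lambda>n. (integral \<Omega> (\<lambda>x. f x * u (x + (t + X n) *\<^sub>R ?e)) - integral \<Omega> (\<lambda>x. f x * u (x + t *\<^sub>R ?e))) / X n)
      \<longlonglongrightarrow> integral \<Omega> (\<lambda>x. f x * partial i u (x + t *\<^sub>R ?e))" by simp
  qed
qed

text \<open>The integral of \<open>u\<close> shifted by \<open>t\<close> along \<open>e\<^sub>i\<close>, taken over a box so large that the support does
  not leave it, does not depend on \<open>t\<close>; its derivative at \<open>t = 0\<close> is the integral of the partial
  derivative.\<close>
lemma integral_partial_eq_0:
  assumes u: "\<And>x. u differentiable (at x)" "continuous_on UNIV (partial i u)"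
    and K: "compact K" "K \<subseteq> \<Omega>" "\<And>x. x \<notin> K \<Longrightarrow> u x = 0"
  shows "integral \<Omega> (partial i u) = 0"
proof -
  let ?e = "axis i 1 :: vec3"
  have cu: "continuous_on UNIV u"
    by (rule continuous_on_if_differentiable[OF u(1)])
  have p0: "partial i u x = 0" if "x \<notin> K" for x
    using partial_eq_0_outside[OF compact_imp_closed[OF K(1)] K(3) that] .
  obtain B where B: "\<And>x. \<bar>u x\<bar> \<le> B" using compact_support_bounded[OF cu K(1,3)] by metis
  obtain M where M: "\<And>x. \<bar>partial i u x\<bar> \<le> M" using compact_support_bounded[OF u(2) K(1) p0] by metis
  have "bounded (\<Union>x\<in>K. \<Union>y\<in>cball (0::vec3) 1. {x + y})"
    using bounded_sums[OF compact_imp_bounded[OF K(1)] bounded_cball] .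
  then obtain a b where ab: "(\<Union>x\<in>K. \<Union>y\<in>cball (0::vec3) 1. {x + y}) \<subseteq> cbox a b"
    using bounded_subset_cbox_symmetric by metis
  have inbox: "x + s *\<^sub>R ?e \<in> cbox a b" if "x \<in> K" "\<bar>s\<bar> \<le> 1" for x s
    using that by (intro subsetD[OF ab] UN_I[of x] UN_I[of "s *\<^sub>R ?e"]) auto
  define F where "F = (\<lambda>t. integral (cbox a b) (\<lambda>x. 1 * u (x + t *\<^sub>R ?e)))"
  have const: "F t = F 0" if "\<bar>t\<bar> < 1" for t
  proof -
    have "(u has_integral F 0) (cbox a b)"
      using cu by (auto simp: F_def intro!: integrable_integral integrable_continuous intro: continuous_on_subset)
    from has_integral_affinity[OF this, of 1 "t *\<^sub>R ?e"]
    have 1: "((\<lambda>x. u (x + t *\<^sub>R ?e)) has_integral F 0) ((\<lambda>x. x - t *\<^sub>R ?e) ` cbox a b)" by simp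
    have e1: "{x \<in> (\<lambda>x. x - t *\<^sub>R ?e) ` cbox a b - cbox a b. u (x + t *\<^sub>R ?e) \<noteq> 0} = {}"
    proof -
      have "u (x + t *\<^sub>R ?e) = 0" if "x \<notin> cbox a b" for x
        using inbox[of "x + t *\<^sub>R ?e" "-t"] K(3) that \<open>\<bar>t\<bar> < 1\<close> by fastforce
      then show ?thesis by auto
    qed
    have e2: "{x \<in> cbox a b - (\<lambda>x. x - t *\<^sub>R ?e) ` cbox a b. u (x + t *\<^sub>R ?e) \<noteq> 0} = {}"
    proof -
      have "u (x + t *\<^sub>R ?e) = 0" if "x \<notin> (\<lambda>x. x - t *\<^sub>R ?e) ` cbox a b" for x
      proof -
        have "x + t *\<^sub>R ?e \<notin> cbox a b"
          using that by (metis add_diff_cancel_right' image_eqI)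
        then show ?thesis using K(3) inbox[of "x + t *\<^sub>R ?e" 0] by auto
      qed
      then show ?thesis by auto
    qed
    have "((\<lambda>x. u (x + t *\<^sub>R ?e)) has_integral F 0) (cbox a b)"
      using has_integral_spike_set_eq[of "(\<lambda>x. x - t *\<^sub>R ?e) ` cbox a b" "cbox a b" "\<lambda>x. u (x + t *\<^sub>R ?e)"] 1
      unfolding e1 e2 by simp
    then show ?thesis by (simp add: F_def integral_unique)
  qed
  have "(F has_real_derivative integral (cbox a b) (\<lambda>x. 1 * partial i u (x + 0 *\<^sub>R ?e))) (at 0)"
    unfolding F_def by (rule has_real_derivative_integral_shift[OF _ _ u(1) B M]) auto
  moreover have "(F has_real_derivative 0) (at 0)"
  proof -
    have "((\<lambda>t. F 0) has_real_derivative 0) (at 0)" by simp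
    then show ?thesis
      by (rule has_field_derivative_transform_within_open[where S = "{-1<..<1}"]) (simp, simp, rule const[symmetric], simp add: abs_less_iff)
  qed
  ultimately have "integral (cbox a b) (partial i u) = 0"
    using DERIV_unique by force
  moreover have "integral (cbox a b) (partial i u) = integral \<Omega> (partial i u)"
  proof (rule integral_spike_set)
    have "{x \<in> cbox a b - \<Omega>. partial i u x \<noteq> 0} = {}" "{x \<in> \<Omega> - cbox a b. partial i u x \<noteq> 0} = {}"
      using p0 K(2) inbox[of _ 0] by auto
    then show "negligible {x \<in> cbox a b - \<Omega>. partial i u x \<noteq> 0}" "negligible {x \<in> \<Omega> - cbox a b. partial i u x \<noteq> 0}"
      by (simp_all only: negligible_empty)
  qed
  ultimately show ?thesis by simp
qed

lemma test_fun_C_diff: "test_fun U \<phi> \<Longrightarrow> C_diff n \<phi>"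
  by (simp add: test_fun_def)

lemma test_fun_differentiable: "test_fun U \<phi> \<Longrightarrow> \<phi> differentiable (at x)"
  using test_fun_C_diff[of U \<phi> "Suc 0"] by simp

lemma test_fun_continuous: "test_fun U \<phi> \<Longrightarrow> continuous_on S \<phi>"
  using test_fun_C_diff[of U \<phi> 0] by (rule C_diff_continuous)

lemma test_fun_mono: "test_fun U \<phi> \<Longrightarrow> U \<subseteq> V \<Longrightarrow> test_fun V \<phi>"
  by (auto simp: test_fun_def)

lemma test_fun_support:
  assumes "test_fun U \<phi>"
  obtains K where "compact K" "K \<subseteq> U" "\<And>x. x \<notin> K \<Longrightarrow> \<phi> x = 0"
proof (rule that[of "closure {x. \<phi> x \<noteq> 0}"])
  show "\<phi> x = 0" if "x \<notin> closure {x. \<phi> x \<noteq> 0}" for x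
    using that closure_subset[of "{x. \<phi> x \<noteq> 0}"] by blast
qed (use assms in \<open>simp_all add: test_fun_def\<close>)

lemma test_funI:
  assumes "\<And>n. C_diff n \<phi>" "compact K" "K \<subseteq> U" "\<And>x. x \<notin> K \<Longrightarrow> \<phi> x = 0"
  shows "test_fun U \<phi>"
proof -
  have sub: "closure {x. \<phi> x \<noteq> 0} \<subseteq> K"
    by (rule closure_minimal) (use assms(4) compact_imp_closed[OF assms(2)] in auto)
  have "compact (K \<inter> closure {x. \<phi> x \<noteq> 0})"
    using assms(2) by (rule compact_Int_closed) simp
  with sub have "compact (closure {x. \<phi> x \<noteq> 0})" by (simp add: Int_absorb1)
  with sub assms(1,3) show ?thesis unfolding test_fun_def by (intro conjI allI) (assumption | rule order_trans)+
qed

lemma test_fun_partial: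
  assumes "test_fun U \<phi>"
  shows "test_fun U (partial i \<phi>)"
proof -
  obtain K where K: "compact K" "K \<subseteq> U" "\<And>x. x \<notin> K \<Longrightarrow> \<phi> x = 0" using test_fun_support[OF assms] by metis
  show ?thesis
  proof (rule test_funI[OF _ K(1,2)])
    show "C_diff n (partial i \<phi>)" for n using test_fun_C_diff[OF assms, of "Suc n"] by simp
    show "partial i \<phi> x = 0" if "x \<notin> K" for x
      using partial_eq_0_outside[OF compact_imp_closed[OF K(1)] K(3) that] .
  qed
qed

lemma test_fun_0: "test_fun U (\<lambda>x. 0)"
  by (rule test_funI[of _ "{}"]) (auto simp: C_diff_const)

lemma test_fun_absolutely_integrable:
  assumes "test_fun U \<phi>" "U \<subseteq> \<Omega>" "continuous_on UNIV p"
  shows "(\<lambda>x. p x * \<phi> x) absolutely_integrable_on \<Omega>"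
proof -
  obtain K where K: "compact K" "K \<subseteq> U" "\<And>x. x \<notin> K \<Longrightarrow> \<phi> x = 0" using test_fun_support[OF assms(1)] by metis
  show ?thesis
  proof (rule compact_support_absolutely_integrable[OF _ K(1) _ order_trans[OF K(2) assms(2)]])
    show "continuous_on UNIV (\<lambda>x. p x * \<phi> x)"
      by (intro continuous_on_mult assms(3) test_fun_continuous[OF assms(1)])
  qed (simp add: K(3))
qed

lemma integral_by_parts_test_fun:
  assumes \<phi>: "test_fun U \<phi>" "U \<subseteq> \<Omega>"
    and p: "\<And>x. p differentiable (at x)" "continuous_on UNIV (partial i p)"
  shows "integral \<Omega> (\<lambda>x. p x * partial i \<phi> x) = - integral \<Omega> (\<lambda>x. partial i p x * \<phi> x)"
proof -
  obtain K where K: "compact K" "K \<subseteq> U" "\<And>x. x \<notin> K \<Longrightarrow> \<phi> x = 0" using test_fun_support[OF \<phi>(1)] by metis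
  have cp: "continuous_on UNIV p"
    by (rule continuous_on_if_differentiable[OF p(1)])
  have pm: "partial i (\<lambda>x. p x * \<phi> x) = (\<lambda>x. p x * partial i \<phi> x + partial i p x * \<phi> x)"
    by (rule ext) (simp add: partial_mult[OF p(1) test_fun_differentiable[OF \<phi>(1)]])
  have "integral \<Omega> (partial i (\<lambda>x. p x * \<phi> x)) = 0"
  proof (rule integral_partial_eq_0[OF _ _ K(1) order_trans[OF K(2) \<phi>(2)]])
    show "(\<lambda>x. p x * \<phi> x) differentiable at x" for x
      by (rule differentiable_mult[OF p(1) test_fun_differentiable[OF \<phi>(1)]])
    show "continuous_on UNIV (partial i (\<lambda>x. p x * \<phi> x))"
      unfolding pm
      by (intro continuous_on_add continuous_on_mult cp p(2) test_fun_continuous[OF \<phi>(1)]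
          test_fun_continuous[OF test_fun_partial[OF \<phi>(1)]])
  qed (simp add: K(3))
  also have "integral \<Omega> (partial i (\<lambda>x. p x * \<phi> x)) =
     integral \<Omega> (\<lambda>x. p x * partial i \<phi> x) + integral \<Omega> (\<lambda>x. partial i p x * \<phi> x)"
    unfolding pm using test_fun_absolutely_integrable[OF test_fun_partial[OF \<phi>(1)] \<phi>(2) cp]
      test_fun_absolutely_integrable[OF \<phi> p(2)]
    by (intro integral_add) (auto simp: set_lebesgue_integral_eq_integral)
  finally show ?thesis by simp
qed

text \<open>The fundamental lemma of the calculus of variations: bumps tend to the indicator of a box, hence
  the integrals of \<open>g\<close> over all boxes in \<open>U\<close> vanish.\<close>
lemma negligible_if_test_fun_integrals_0:
  fixes g :: "vec3 \<Rightarrow> real"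
  assumes g: "g absolutely_integrable_on \<Omega>" and U: "open U" "U \<subseteq> \<Omega>"
    and 0: "\<And>\<phi>. test_fun U \<phi> \<Longrightarrow> integral \<Omega> (\<lambda>x. \<phi> x * g x) = 0"
  shows "negligible {x\<in>U. g x \<noteq> 0}"
proof -
  have box0: "integral (cbox c d) g = 0" if cd: "cbox c d \<subseteq> U" for c d
  proof -
    let ?b = "\<lambda>n x. bump (1 / real (Suc n)) c d x * g x"
    have "(\<lambda>n. integral \<Omega> (?b n)) \<longlonglongrightarrow> integral \<Omega> (\<lambda>x. if x \<in> box c d then g x else 0)"
    proof (rule dominated_convergence(2)[where h = "\<lambda>x. \<bar>g x\<bar>"])
      show "?b n integrable_on \<Omega>" for n
      proof -
        have 1: "?b n absolutely_integrable_on \<Omega> \<inter> cbox c d"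
        proof -
          have gc: "g absolutely_integrable_on cbox c d"
            using g by (rule absolutely_integrable_on_subcbox) (rule order_trans[OF cd U(2)])
          have "continuous_on (cbox c d) (bump (1 / real (Suc n)) c d)"
            by (rule C_diff_continuous[of 0, OF C_diff_bump]) simp
          then have "?b n absolutely_integrable_on cbox c d"
            by (intro absolutely_integrable_bounded_measurable_product[of "(*)" "bump (1 / real (Suc n)) c d" "cbox c d" g]
                continuous_imp_measurable_on_sets_lebesgue compact_imp_bounded[OF compact_continuous_image] gc bilinear_times)
               simp_all
          then show ?thesis using cd U by (simp add: Int_absorb1 subset_trans)
        qed
        have e: "{x \<in> cbox c d - \<Omega>. ?b n x \<noteq> 0} = {}" "{x \<in> \<Omega> - cbox c d. ?b n x \<noteq> 0} = {}"
          using cd U by (auto simp: bump_eq_0_iff intro: box_subset_cbox[THEN subsetD])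
        have "?b n integrable_on cbox c d"
          using 1 cd U by (simp add: Int_absorb1 subset_trans set_lebesgue_integral_eq_integral)
        then show ?thesis by (rule integrable_spike_set) (simp_all only: e negligible_empty)
      qed
      show "(\<lambda>x. \<bar>g x\<bar>) integrable_on \<Omega>" using g by (simp add: absolutely_integrable_on_def)
      show "norm (?b n x) \<le> \<bar>g x\<bar>" for n x
        using bump_bounds[of "1 / real (Suc n)" c d x] by (simp add: abs_mult mult_left_le_one_le del: of_nat_Suc)
      show "(\<lambda>n. ?b n x) \<longlonglongrightarrow> (if x \<in> box c d then g x else 0)" for x
      proof (cases "x \<in> box c d")
        case True
        with tendsto_mult_right[OF bump_tendsto_1[OF True], of "g x"] show ?thesis by (simp del: of_nat_Suc)
      next
        case False then show ?thesis by (simp add: bump_eq_0_iff[THEN iffD2])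
      qed
    qed
    moreover have "integral \<Omega> (?b n) = 0" for n
      by (rule 0[OF test_fun_bump[OF _ cd]]) simp
    ultimately have "integral \<Omega> (\<lambda>x. if x \<in> box c d then g x else 0) = 0"
      by (simp add: LIMSEQ_const_iff)
    moreover have "box c d \<subseteq> \<Omega>" using box_subset_cbox cd U(2) by (metis order_trans)
    ultimately have "integral (box c d) g = 0"
      by (simp add: integral_restrict_Int Int_absorb2)
    then show ?thesis by (simp only: integral_open_interval)
  qed
  have neg: "negligible {x\<in>cbox c d. g x \<noteq> 0}" if "cbox c d \<subseteq> U" for c d
    by (intro negligible_if_box_integrals_0 box0 absolutely_integrable_on_subcbox[OF g] order_trans[OF that U(2)] order_trans[OF _ that])
  obtain \<D> where \<D>: "countable \<D>" "\<D> \<subseteq> Pow U" "\<And>X. X \<in> \<D> \<Longrightarrow> \<exists>a b. X = cbox a b" "\<Union>\<D> = U"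
    by (rule open_countable_Union_open_cbox[OF U(1)]) (rule that)
  have "negligible (\<Union>X\<in>\<D>. {x\<in>X. g x \<noteq> 0})"
  proof (rule negligible_countable_Union)
    fix Y assume "Y \<in> (\<lambda>X. {x \<in> X. g x \<noteq> 0}) ` \<D>"
    then obtain X where X: "X \<in> \<D>" "Y = {x \<in> X. g x \<noteq> 0}" by auto
    obtain a b where "X = cbox a b" using \<D>(3)[OF X(1)] by auto
    moreover have "X \<subseteq> U" using \<D>(2) X(1) by auto
    ultimately show "negligible Y" using neg X(2) by simp
  qed (simp add: \<D>(1))
  then show ?thesis by (rule negligible_subset) (use \<D>(4) in auto)
qed

section \<open>Square-integrable functions\<close>

lemma L2_measurable: "f \<in> L2 \<Omega> \<Longrightarrow> f \<in> borel_measurable (lebesgue_on \<Omega>)"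
  by (simp add: L2_def)

lemma L2_I:
  assumes "\<Omega> \<in> sets lebesgue" "f \<in> borel_measurable (lebesgue_on \<Omega>)" "g integrable_on \<Omega>"
    "\<And>x. x \<in> \<Omega> \<Longrightarrow> (norm (f x))\<^sup>2 \<le> g x"
  shows "f \<in> L2 \<Omega>"
proof -
  have "(\<lambda>x. (norm (f x))\<^sup>2) integrable_on \<Omega>"
    by (rule measurable_bounded_by_integrable_imp_integrable[OF _ assms(3) _ assms(1)])
       (use assms in \<open>auto intro!: borel_measurable_power borel_measurable_norm\<close>)
  with assms(2) show ?thesis by (simp add: L2_def)
qed

lemma L2_inner_absolutely_integrable:
  assumes \<Omega>: "\<Omega> \<in> sets lebesgue" and f: "f \<in> L2 \<Omega>" and g: "g \<in> L2 \<Omega>"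
  shows "(\<lambda>x. f x \<bullet> g x) absolutely_integrable_on \<Omega>"
proof (rule measurable_bounded_by_integrable_imp_absolutely_integrable[OF _ \<Omega>])
  show "(\<lambda>x. f x \<bullet> g x) \<in> borel_measurable (lebesgue_on \<Omega>)"
    using f g by (intro borel_measurable_inner L2_measurable)
  show "(\<lambda>x. (norm (f x))\<^sup>2 + (norm (g x))\<^sup>2) integrable_on \<Omega>"
    using f g by (intro integrable_add) (simp_all add: L2_def)
  fix x
  have "norm (f x \<bullet> g x) \<le> norm (f x) * norm (g x)" by (simp add: Cauchy_Schwarz_ineq2)
  also have "\<dots> \<le> (norm (f x))\<^sup>2 + (norm (g x))\<^sup>2"
    using sum_squares_bound[of "norm (f x)" "norm (g x)"] mult_nonneg_nonneg[OF norm_ge_zero[of "f x"] norm_ge_zero[of "g x"]]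
    by linarith
  finally show "norm (f x \<bullet> g x) \<le> (norm (f x))\<^sup>2 + (norm (g x))\<^sup>2" .
qed

lemma L2_add:
  assumes \<Omega>: "\<Omega> \<in> sets lebesgue" and f: "f \<in> L2 \<Omega>" and g: "g \<in> L2 \<Omega>"
  shows "(\<lambda>x. f x + g x) \<in> L2 \<Omega>"
proof (rule L2_I[OF \<Omega>])
  show "(\<lambda>x. f x + g x) \<in> borel_measurable (lebesgue_on \<Omega>)"
    using f g by (intro borel_measurable_add L2_measurable)
  show "(\<lambda>x. 2 * (norm (f x))\<^sup>2 + 2 * (norm (g x))\<^sup>2) integrable_on \<Omega>"
    using f g by (intro integrable_add integrable_on_mult_right) (simp_all add: L2_def)
  fix x
  have "(norm (f x + g x))\<^sup>2 \<le> (norm (f x) + norm (g x))\<^sup>2"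
    by (intro power_mono norm_triangle_ineq) simp
  also have "\<dots> \<le> 2 * (norm (f x))\<^sup>2 + 2 * (norm (g x))\<^sup>2"
    using sum_squares_bound[of "norm (f x)" "norm (g x)"] by (simp add: power2_sum)
  finally show "(norm (f x + g x))\<^sup>2 \<le> 2 * (norm (f x))\<^sup>2 + 2 * (norm (g x))\<^sup>2" .
qed

lemma L2_scaleR:
  assumes "f \<in> L2 \<Omega>"
  shows "(\<lambda>x. c *\<^sub>R f x) \<in> L2 \<Omega>"
  using assms unfolding L2_def
  by (auto simp: power_mult_distrib intro!: integrable_on_mult_right)

lemma L2_diff:
  assumes \<Omega>: "\<Omega> \<in> sets lebesgue" and f: "f \<in> L2 \<Omega>" and g: "g \<in> L2 \<Omega>"
  shows "(\<lambda>x. f x - g x) \<in> L2 \<Omega>"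
  using L2_add[OF \<Omega> f L2_scaleR[OF g, of "-1"]] by simp

lemma L2_inner_const:
  assumes \<Omega>: "\<Omega> \<in> sets lebesgue" and f: "f \<in> L2 \<Omega>"
  shows "(\<lambda>x. f x \<bullet> v) \<in> L2 \<Omega>"
proof (rule L2_I[OF \<Omega>])
  show "(\<lambda>x. f x \<bullet> v) \<in> borel_measurable (lebesgue_on \<Omega>)"
    using L2_measurable[OF f] by (intro borel_measurable_inner) auto
  show "(\<lambda>x. (norm v)\<^sup>2 * (norm (f x))\<^sup>2) integrable_on \<Omega>"
    using f by (intro integrable_on_mult_right) (simp_all add: L2_def)
  fix x
  have "\<bar>f x \<bullet> v\<bar> \<le> norm v * norm (f x)" by (metis Cauchy_Schwarz_ineq2 mult.commute)
  from power_mono[OF this, of 2] show "(norm (f x \<bullet> v))\<^sup>2 \<le> (norm v)\<^sup>2 * (norm (f x))\<^sup>2"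
    by (simp add: power_mult_distrib)
qed

lemma L2_nth:
  fixes f :: "vec3 \<Rightarrow> vec3"
  assumes \<Omega>: "\<Omega> \<in> sets lebesgue" and f: "f \<in> L2 \<Omega>"
  shows "(\<lambda>x. f x $ i) \<in> L2 \<Omega>"
  using L2_inner_const[OF assms, of "axis i 1"] by (simp add: inner_axis)

lemma L2_scaleR_const:
  assumes "\<Omega> \<in> sets lebesgue" and f: "f \<in> L2 \<Omega>"
  shows "(\<lambda>x. f x *\<^sub>R v) \<in> L2 \<Omega>"
  using f unfolding L2_def
  by (auto simp: power_mult_distrib intro!: integrable_on_mult_left borel_measurable_scaleR)

lemma L2_0: "(\<lambda>x. 0) \<in> L2 \<Omega>"
  by (simp add: L2_def integrable_0)

lemma L2_sum:
  assumes "\<Omega> \<in> sets lebesgue" "\<And>i. i \<in> I \<Longrightarrow> f i \<in> L2 \<Omega>"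
  shows "(\<lambda>x. \<Sum>i\<in>I. f i x) \<in> L2 \<Omega>"
  using assms(2) by (induction I rule: infinite_finite_induct) (auto intro: L2_add[OF assms(1)] L2_0)

lemma L2_vec:
  fixes f :: "vec3 \<Rightarrow> vec3"
  assumes "\<Omega> \<in> sets lebesgue" "\<And>i. (\<lambda>x. f x $ i) \<in> L2 \<Omega>"
  shows "f \<in> L2 \<Omega>"
proof -
  have "(\<lambda>x. \<Sum>i\<in>UNIV. (f x $ i) *\<^sub>R axis i (1::real)) \<in> L2 \<Omega>"
    by (intro L2_sum L2_scaleR_const assms)
  moreover have "(\<Sum>i\<in>UNIV. (f x $ i) *\<^sub>R axis i (1::real)) = f x" for x
    using basis_expansion[of "f x"] by (simp add: scalar_mult_eq_scaleR)
  ultimately show ?thesis by simp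
qed

lemma L2_mult_absolutely_integrable:
  fixes f g :: "vec3 \<Rightarrow> real"
  assumes "\<Omega> \<in> sets lebesgue" "f \<in> L2 \<Omega>" "g \<in> L2 \<Omega>"
  shows "(\<lambda>x. f x * g x) absolutely_integrable_on \<Omega>"
  using L2_inner_absolutely_integrable[OF assms] by simp

lemma L2_bounded:
  fixes f :: "vec3 \<Rightarrow> 'a::euclidean_space"
  assumes "\<Omega> \<in> lmeasurable" "f \<in> borel_measurable (lebesgue_on \<Omega>)" "\<And>x. x \<in> \<Omega> \<Longrightarrow> norm (f x) \<le> B"
  shows "f \<in> L2 \<Omega>"
proof (rule L2_I[OF _ assms(2)])
  show "(\<lambda>x. B\<^sup>2) integrable_on \<Omega>" using assms(1) by (rule integrable_on_const)
qed (use assms in \<open>auto intro!: power_mono\<close>)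

lemma L2_absolutely_integrable:
  fixes f :: "vec3 \<Rightarrow> 'a::euclidean_space"
  assumes \<Omega>: "\<Omega> \<in> lmeasurable" and f: "f \<in> L2 \<Omega>"
  shows "f absolutely_integrable_on \<Omega>"
proof (rule measurable_bounded_by_integrable_imp_absolutely_integrable[OF L2_measurable[OF f]])
  show "(\<lambda>x. (norm (f x))\<^sup>2 + 1) integrable_on \<Omega>"
    using f \<Omega> by (intro integrable_add integrable_on_const) (simp_all add: L2_def)
  fix x show "norm (f x) \<le> (norm (f x))\<^sup>2 + 1"
    using sum_squares_bound[of "norm (f x)" 1] norm_ge_zero[of "f x"] unfolding power_one mult_1_right by linarith
qed (use \<Omega> in auto)

lemma L2_spike:
  assumes \<Omega>: "\<Omega> \<in> sets lebesgue" and f: "f \<in> L2 \<Omega>" and N: "negligible N" "\<And>x. x \<in> \<Omega> - N \<Longrightarrow> g x = f x"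
  shows "g \<in> L2 \<Omega>"
proof -
  have "(\<lambda>x. if x \<in> \<Omega> then f x else 0) \<in> borel_measurable lebesgue"
    using L2_measurable[OF f] by (simp add: borel_measurable_if[OF \<Omega>])
  then have "(\<lambda>x. if x \<in> \<Omega> then g x else 0) \<in> borel_measurable lebesgue"
  proof (rule borel_measurable_AE)
    have "{x. (if x \<in> \<Omega> then f x else 0) \<noteq> (if x \<in> \<Omega> then g x else 0)} \<subseteq> N"
    proof
      fix x assume "x \<in> {x. (if x \<in> \<Omega> then f x else 0) \<noteq> (if x \<in> \<Omega> then g x else 0)}"
      then have "x \<in> \<Omega>" "f x \<noteq> g x" by (simp_all split: if_splits)
      with N(2)[of x] show "x \<in> N" by auto
    qed
    with N(1) show "AE x in lebesgue. (if x \<in> \<Omega> then f x else 0) = (if x \<in> \<Omega> then g x else 0)"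
      unfolding eventually_ae_filter_negligible by (intro exI[of _ N] conjI)
  qed
  then have "g \<in> borel_measurable (lebesgue_on \<Omega>)"
    using borel_measurable_if[OF \<Omega>, of g] by simp
  moreover have "(\<lambda>x. (norm (g x))\<^sup>2) integrable_on \<Omega>"
  proof (rule integrable_spike[OF _ N(1)])
    show "(\<lambda>x. (norm (f x))\<^sup>2) integrable_on \<Omega>" using f by (simp add: L2_def)
  qed (simp add: N(2))
  ultimately show ?thesis by (simp add: L2_def)
qed

lemma test_fun_L2:
  assumes "test_fun U \<phi>" "\<Omega> \<in> lmeasurable"
  shows "\<phi> \<in> L2 \<Omega>"
proof -
  obtain K where K: "compact K" "K \<subseteq> U" "\<And>x. x \<notin> K \<Longrightarrow> \<phi> x = 0" using test_fun_support[OF assms(1)] by metis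
  obtain B where "B \<ge> 0" "\<And>x. \<bar>\<phi> x\<bar> \<le> B"
    using compact_support_bounded[OF test_fun_continuous[OF assms(1)] K(1,3)] by metis
  then show ?thesis
    using assms(2) test_fun_continuous[OF assms(1)]
    by (intro L2_bounded[where B = B] continuous_imp_measurable_on_sets_lebesgue) auto
qed

text \<open>Taking for \<open>U\<close> the interior of a cell identifies a weak derivative on \<open>\<Omega>\<close> within that cell.\<close>
lemma negligible_neq_if_test_fun_integrals_eq:
  fixes g h :: "vec3 \<Rightarrow> real"
  assumes \<Omega>: "\<Omega> \<in> lmeasurable" and g: "g \<in> L2 \<Omega>" and h: "h \<in> L2 \<Omega>" and U: "open U" "U \<subseteq> \<Omega>"
    and eq: "\<And>\<phi>. test_fun U \<phi> \<Longrightarrow> integral \<Omega> (\<lambda>x. \<phi> x * g x) = integral \<Omega> (\<lambda>x. \<phi> x * h x)"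
  shows "negligible {x\<in>U. g x \<noteq> h x}"
proof -
  have \<Omega>': "\<Omega> \<in> sets lebesgue" using \<Omega> by auto
  have "negligible {x\<in>U. g x - h x \<noteq> 0}"
  proof (rule negligible_if_test_fun_integrals_0[OF _ U])
    show "(\<lambda>x. g x - h x) absolutely_integrable_on \<Omega>"
      by (intro L2_absolutely_integrable[OF \<Omega>] L2_diff[OF \<Omega>' g h])
    fix \<phi> assume \<phi>: "test_fun U \<phi>"
    have "integral \<Omega> (\<lambda>x. \<phi> x * (g x - h x)) = integral \<Omega> (\<lambda>x. \<phi> x * g x) - integral \<Omega> (\<lambda>x. \<phi> x * h x)"
      unfolding right_diff_distrib
      by (intro integral_diff set_lebesgue_integral_eq_integral(1) L2_mult_absolutely_integrable[OF \<Omega>'] test_fun_L2[OF \<phi> \<Omega>] g h)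
    then show "integral \<Omega> (\<lambda>x. \<phi> x * (g x - h x)) = 0" using eq[OF \<phi>] by simp
  qed
  then show ?thesis by simp
qed

lemma negligible_neq_vec:
  fixes g h :: "vec3 \<Rightarrow> vec3"
  assumes "\<And>i. negligible {x\<in>U. g x $ i \<noteq> h x $ i}"
  shows "negligible {x\<in>U. g x \<noteq> h x}"
proof -
  have "negligible (\<Union>i\<in>UNIV. {x\<in>U. g x $ i \<noteq> h x $ i})"
    using assms by (intro negligible_Union) auto
  then show ?thesis by (rule negligible_subset) (auto simp: vec_eq_iff)
qed

lemma classical_grad_L2:
  assumes "test_fun U \<phi>" "\<Omega> \<in> lmeasurable"
  shows "classical_grad \<phi> \<in> L2 \<Omega>"
  using assms by (intro L2_vec) (auto simp: classical_grad_def intro!: test_fun_L2 test_fun_partial)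

lemma test_fieldD: "test_field U \<psi> \<Longrightarrow> test_fun U (\<lambda>x. \<psi> x $ j)"
  by (simp add: test_field_def)

lemma test_field_L2:
  assumes "test_field U \<psi>" "\<Omega> \<in> lmeasurable"
  shows "\<psi> \<in> L2 \<Omega>"
  using assms by (intro L2_vec) (auto intro!: test_fun_L2 test_fieldD)

lemma test_field_axis:
  assumes "test_fun U \<phi>"
  shows "test_field U (\<lambda>x. \<phi> x *\<^sub>R axis i 1)"
  unfolding test_field_def
proof
  fix j show "test_fun U (\<lambda>x. (\<phi> x *\<^sub>R axis i 1) $ j)"
    using assms test_fun_0[of U] by (cases "i = j") (simp_all add: axis_def)
qed

lemma classical_curl_nth:
  "classical_curl \<psi> x $ 1 = partial 2 (\<lambda>y. \<psi> y $ 3) x - partial 3 (\<lambda>y. \<psi> y $ 2) x"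
  "classical_curl \<psi> x $ 2 = partial 3 (\<lambda>y. \<psi> y $ 1) x - partial 1 (\<lambda>y. \<psi> y $ 3) x"
  "classical_curl \<psi> x $ 3 = partial 1 (\<lambda>y. \<psi> y $ 2) x - partial 2 (\<lambda>y. \<psi> y $ 1) x"
  by (simp_all add: classical_curl_def)

lemma classical_curl_L2:
  assumes "test_field U \<psi>" "\<Omega> \<in> lmeasurable"
  shows "classical_curl \<psi> \<in> L2 \<Omega>"
proof (rule L2_vec)
  show "(\<lambda>x. classical_curl \<psi> x $ i) \<in> L2 \<Omega>" for i
    using exhaust_3[of i] assms(2) assms(1)[THEN test_fieldD, THEN test_fun_partial, THEN test_fun_L2]
    by (auto simp: classical_curl_nth intro!: L2_diff)
qed (use assms in auto)

lemma integral_spike_on: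
  assumes "negligible {x\<in>\<Omega>. f x \<noteq> g x}"
  shows "integral \<Omega> f = integral \<Omega> g"
  by (rule integral_spike[OF assms]) auto

section \<open>Polynomials\<close>

definition monomial :: "(3 \<Rightarrow> nat) \<Rightarrow> vec3 \<Rightarrow> real" where
  "monomial \<alpha> x = (\<Prod>i\<in>UNIV. x $ i ^ \<alpha> i)"

lemma finite_multiindices: "finite {\<alpha> :: 3 \<Rightarrow> nat. sum \<alpha> UNIV \<le> k}"
proof (rule finite_subset)
  show "{\<alpha> :: 3 \<Rightarrow> nat. sum \<alpha> UNIV \<le> k} \<subseteq> PiE UNIV (\<lambda>_. {..k})"
  proof
    fix \<alpha> :: "3 \<Rightarrow> nat" assume "\<alpha> \<in> {\<alpha>. sum \<alpha> UNIV \<le> k}"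
    then have "\<alpha> i \<le> k" for i using member_le_sum[of i UNIV \<alpha>] by simp
    then show "\<alpha> \<in> PiE UNIV (\<lambda>_. {..k})" by (intro PiE_I) auto
  qed
  show "finite (PiE UNIV (\<lambda>_::3. {..k}))" by (intro finite_PiE) auto
qed

lemma Poly_eq: "Poly k = {p. \<exists>a. p = (\<lambda>x. \<Sum>\<alpha> | sum \<alpha> UNIV \<le> k. a \<alpha> * monomial \<alpha> x)}"
  by (simp add: Poly_def monomial_def)

lemma Poly_I: "p = (\<lambda>x. \<Sum>\<alpha> | sum \<alpha> UNIV \<le> k. a \<alpha> * monomial \<alpha> x) \<Longrightarrow> p \<in> Poly k"
  by (auto simp: Poly_eq)

lemma Poly_E:
  assumes "p \<in> Poly k"
  obtains a where "p = (\<lambda>x. \<Sum>\<alpha> | sum \<alpha> UNIV \<le> k. a \<alpha> * monomial \<alpha> x)"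
  using assms unfolding Poly_eq by blast

lemma Poly_add:
  assumes "p \<in> Poly k" "q \<in> Poly k"
  shows "(\<lambda>x. p x + q x) \<in> Poly k"
proof -
  obtain a where a: "p = (\<lambda>x. \<Sum>\<alpha> | sum \<alpha> UNIV \<le> k. a \<alpha> * monomial \<alpha> x)" using Poly_E[OF assms(1)] .
  obtain b where b: "q = (\<lambda>x. \<Sum>\<alpha> | sum \<alpha> UNIV \<le> k. b \<alpha> * monomial \<alpha> x)" using Poly_E[OF assms(2)] .
  show ?thesis
    by (rule Poly_I[where a = "\<lambda>\<alpha>. a \<alpha> + b \<alpha>"]) (simp add: a b sum.distrib distrib_right)
qed

lemma Poly_cmult:
  assumes "p \<in> Poly k"
  shows "(\<lambda>x. c * p x) \<in> Poly k"
proof -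
  obtain a where a: "p = (\<lambda>x. \<Sum>\<alpha> | sum \<alpha> UNIV \<le> k. a \<alpha> * monomial \<alpha> x)" using Poly_E[OF assms(1)] .
  show ?thesis
    by (rule Poly_I[where a = "\<lambda>\<alpha>. c * a \<alpha>"]) (simp add: a sum_distrib_left mult.assoc)
qed

lemma Poly_diff: "p \<in> Poly k \<Longrightarrow> q \<in> Poly k \<Longrightarrow> (\<lambda>x. p x - q x) \<in> Poly k"
  using Poly_add[of p k "\<lambda>x. -1 * q x"] Poly_cmult[of q k "-1"] by simp

lemma Poly_0: "(\<lambda>x. 0) \<in> Poly k"
  by (rule Poly_I[where a = "\<lambda>\<alpha>. 0"]) simp

lemma Poly_sum: "(\<And>i. i \<in> I \<Longrightarrow> f i \<in> Poly k) \<Longrightarrow> (\<lambda>x. \<Sum>i\<in>I. f i x) \<in> Poly k"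
  by (induction I rule: infinite_finite_induct) (simp_all add: Poly_0 Poly_add)

lemma monomial_Poly:
  assumes "sum \<alpha> UNIV \<le> k"
  shows "monomial \<alpha> \<in> Poly k"
proof (rule Poly_I[where a = "\<lambda>\<beta>. if \<beta> = \<alpha> then 1 else 0"])
  show "monomial \<alpha> = (\<lambda>x. \<Sum>\<beta> | sum \<beta> UNIV \<le> k. (if \<beta> = \<alpha> then 1 else 0) * monomial \<beta> x)"
    using assms by (simp add: finite_multiindices if_distrib[of "\<lambda>c. c * _"] cong: if_cong)
qed

text \<open>Induction over the monomials and linear combinations.\<close>
lemma Poly_span:
  assumes "p \<in> Poly k" "\<And>\<alpha>. sum \<alpha> UNIV \<le> k \<Longrightarrow> P (monomial \<alpha>)"
    and "\<And>f g. P f \<Longrightarrow> P g \<Longrightarrow> P (\<lambda>x. f x + g x)" "\<And>c f. P f \<Longrightarrow> P (\<lambda>x. c * f x)"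
  shows "P p"
proof -
  obtain a where a: "p = (\<lambda>x. \<Sum>\<alpha> | sum \<alpha> UNIV \<le> k. a \<alpha> * monomial \<alpha> x)" using Poly_E[OF assms(1)] .
  have P0: "P (\<lambda>x. 0)" using assms(4)[OF assms(2)[of "\<lambda>_. 0"], of 0] by simp
  have "P (\<lambda>x. \<Sum>\<alpha>\<in>A. a \<alpha> * monomial \<alpha> x)" if "A \<subseteq> {\<alpha>. sum \<alpha> UNIV \<le> k}" for A
    using finite_subset[OF that finite_multiindices] that
    by (induction A) (simp_all add: P0 assms(2,3,4))
  then show ?thesis unfolding a by simp
qed

lemma prod_3: "(\<Prod>i\<in>(UNIV::3 set). f i) = f 1 * f 2 * (f 3 :: 'a::comm_monoid_mult)"
  unfolding UNIV_3 by (simp add: mult_ac)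

lemma monomial_3: "monomial \<alpha> x = x $ 1 ^ \<alpha> 1 * x $ 2 ^ \<alpha> 2 * x $ 3 ^ \<alpha> 3"
  unfolding monomial_def by (simp only: prod_3)

lemma has_derivative_monomial:
  "(monomial \<alpha> has_derivative (\<lambda>h.
     real (\<alpha> 1) * x $ 1 ^ (\<alpha> 1 - 1) * x $ 2 ^ \<alpha> 2 * x $ 3 ^ \<alpha> 3 * h $ 1 +
     real (\<alpha> 2) * x $ 1 ^ \<alpha> 1 * x $ 2 ^ (\<alpha> 2 - 1) * x $ 3 ^ \<alpha> 3 * h $ 2 +
     real (\<alpha> 3) * x $ 1 ^ \<alpha> 1 * x $ 2 ^ \<alpha> 2 * x $ 3 ^ (\<alpha> 3 - 1) * h $ 3)) (at x)"
proof -
  have nth: "((\<lambda>x. x $ i) has_derivative (\<lambda>h. h $ i)) (at x)" for i and x :: vec3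
    by (rule bounded_linear_imp_has_derivative[OF bounded_linear_vec_nth])
  have pow: "((\<lambda>x. x $ i ^ n) has_derivative (\<lambda>h. real n * h $ i * x $ i ^ (n - 1))) (at x)" for i n
    using has_derivative_power[OF nth[of i x], of n] by (simp add: mult_ac)
  show ?thesis
    unfolding monomial_3 [abs_def]
    by (rule has_derivative_eq_rhs[OF has_derivative_mult[OF has_derivative_mult[OF pow pow] pow]])
       (simp add: fun_eq_iff algebra_simps)
qed

lemma partial_monomial: "partial i (monomial \<alpha>) x = real (\<alpha> i) * monomial (\<alpha>(i := \<alpha> i - 1)) x"
  using exhaust_3[of i] partial_eq[OF has_derivative_monomial, of i \<alpha> x]
  by (auto simp: axis_def monomial_3)

lemma monomial_mult_nth: "x $ i * monomial \<alpha> x = monomial (\<alpha>(i := Suc (\<alpha> i))) x"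
  using exhaust_3[of i] by (auto simp: monomial_3)

lemma sum_multiindex: "sum \<alpha> UNIV = \<alpha> 1 + \<alpha> 2 + (\<alpha> (3::3) :: nat)"
  by (rule sum_3)

lemma Poly_differentiable:
  assumes "p \<in> Poly k"
  shows "p differentiable (at x)"
  by (rule Poly_span[OF assms]) (auto intro: differentiableI[OF has_derivative_monomial])

lemma Poly_continuous: "p \<in> Poly k \<Longrightarrow> continuous_on S p"
  by (rule continuous_on_if_differentiable[OF Poly_differentiable])

lemma partial_cmult:
  assumes "f differentiable (at x)"
  shows "partial i (\<lambda>x. c * f x) x = c * partial i f x"
  using partial_mult[OF _ assms, of "\<lambda>_. c"] by simp

lemma Poly_mult_nth:
  assumes "p \<in> Poly k"
  shows "(\<lambda>x. x $ j * p x) \<in> Poly (Suc k)"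
proof (rule Poly_span[OF assms])
  fix \<alpha> :: "3 \<Rightarrow> nat" assume "sum \<alpha> UNIV \<le> k"
  then show "(\<lambda>x. x $ j * monomial \<alpha> x) \<in> Poly (Suc k)"
    unfolding monomial_mult_nth
    by (intro monomial_Poly) (use exhaust_3[of j] in \<open>auto simp: sum_multiindex\<close>)
next
  fix f g :: "vec3 \<Rightarrow> real" assume "(\<lambda>x. x $ j * f x) \<in> Poly (Suc k)" "(\<lambda>x. x $ j * g x) \<in> Poly (Suc k)"
  from Poly_add[OF this] show "(\<lambda>x. x $ j * (f x + g x)) \<in> Poly (Suc k)" by (simp add: distrib_left)
next
  fix c and f :: "vec3 \<Rightarrow> real" assume "(\<lambda>x. x $ j * f x) \<in> Poly (Suc k)"
  from Poly_cmult[OF this, of c] show "(\<lambda>x. x $ j * (c * f x)) \<in> Poly (Suc k)" by (simp add: mult.left_commute)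
qed

lemma Poly_partial:
  assumes "p \<in> Poly k"
  shows "partial i p \<in> Poly (k - 1)"
proof -
  have "partial i p \<in> Poly (k - 1) \<and> (\<forall>x. p differentiable (at x))"
  proof (rule Poly_span[OF assms])
    fix \<alpha> :: "3 \<Rightarrow> nat" assume \<alpha>: "sum \<alpha> UNIV \<le> k"
    have "partial i (monomial \<alpha>) = (\<lambda>x. real (\<alpha> i) * monomial (\<alpha>(i := \<alpha> i - 1)) x)"
      by (simp add: fun_eq_iff partial_monomial)
    moreover have "(\<lambda>x. real (\<alpha> i) * monomial (\<alpha>(i := \<alpha> i - 1)) x) \<in> Poly (k - 1)"
    proof (cases "\<alpha> i = 0")
      case False
      with \<alpha> show ?thesis
        by (intro Poly_cmult monomial_Poly) (use exhaust_3[of i] in \<open>auto simp: sum_multiindex\<close>)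
    qed (simp add: Poly_0)
    ultimately show "partial i (monomial \<alpha>) \<in> Poly (k - 1) \<and> (\<forall>x. monomial \<alpha> differentiable (at x))"
      by (auto intro: differentiableI[OF has_derivative_monomial])
  next
    fix f g :: "vec3 \<Rightarrow> real"
    assume *: "partial i f \<in> Poly (k - 1) \<and> (\<forall>x. f differentiable (at x))"
      "partial i g \<in> Poly (k - 1) \<and> (\<forall>x. g differentiable (at x))"
    then have "partial i (\<lambda>x. f x + g x) = (\<lambda>x. partial i f x + partial i g x)"
      by (simp add: fun_eq_iff partial_add)
    with * show "partial i (\<lambda>x. f x + g x) \<in> Poly (k - 1) \<and> (\<forall>x. (\<lambda>x. f x + g x) differentiable (at x))"
      by (simp add: Poly_add)
  next
    fix c and f :: "vec3 \<Rightarrow> real"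
    assume *: "partial i f \<in> Poly (k - 1) \<and> (\<forall>x. f differentiable (at x))"
    then have "partial i (\<lambda>x. c * f x) = (\<lambda>x. c * partial i f x)"
      by (simp add: fun_eq_iff partial_cmult)
    with * show "partial i (\<lambda>x. c * f x) \<in> Poly (k - 1) \<and> (\<forall>x. (\<lambda>x. c * f x) differentiable (at x))"
      by (simp add: Poly_cmult)
  qed
  then show ?thesis by simp
qed

lemma Poly_mono:
  assumes "p \<in> Poly k" "k \<le> l"
  shows "p \<in> Poly l"
  by (rule Poly_span[OF assms(1)]) (use assms(2) in \<open>auto intro: monomial_Poly Poly_add Poly_cmult\<close>)

text \<open>For \<open>k = 0\<close>, where \<open>k - 1\<close> is truncated, the degree count fails but the derivative vanishes.\<close>
lemma Poly_nth_mult_partial: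
  assumes "p \<in> Poly k"
  shows "(\<lambda>x. x $ j * partial i p x) \<in> Poly k"
proof (cases k)
  case 0
  then obtain a where a: "p = (\<lambda>x. \<Sum>\<alpha> | sum \<alpha> UNIV \<le> 0. a \<alpha> * monomial \<alpha> x)" using Poly_E[OF assms(1)] by auto
  have "p = (\<lambda>x. \<Sum>\<alpha>\<in>{\<lambda>_. 0}. a \<alpha> * monomial \<alpha> x)"
    unfolding a by (intro ext sum.cong) (auto simp: fun_eq_iff)
  then have "p = (\<lambda>x. a (\<lambda>_. 0))" by (simp add: monomial_def)
  then have "partial i p x = 0" for x by simp
  then show ?thesis by (simp add: Poly_0)
next
  case (Suc l)
  then show ?thesis using Poly_mult_nth[OF Poly_partial[OF assms, of i], of j] by simp
qed

lemma Poly_const: "(\<lambda>x. c) \<in> Poly k"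
  using Poly_cmult[OF monomial_Poly[of "\<lambda>_. 0" k], of c] by (simp add: monomial_def)

lemma partial_nth: "partial i (\<lambda>x. x $ j) x = (if i = j then 1 else 0)"
  using partial_eq[OF bounded_linear_imp_has_derivative[OF bounded_linear_vec_nth[of j]], of i x]
  by (simp add: axis_def)

lemma nth_differentiable: "(\<lambda>x::vec3. x $ j) differentiable (at x)"
  by (rule differentiableI[OF bounded_linear_imp_has_derivative[OF bounded_linear_vec_nth[of j]]])

lemma VPoly_nth: "p \<in> VPoly k \<Longrightarrow> (\<lambda>x. p x $ j) \<in> Poly k"
  by (simp add: VPoly_def)

lemma VPoly_add: "p \<in> VPoly k \<Longrightarrow> q \<in> VPoly k \<Longrightarrow> (\<lambda>x. p x + q x) \<in> VPoly k"
  by (simp add: VPoly_def Poly_add)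

lemma VPoly_scaleR: "p \<in> VPoly k \<Longrightarrow> (\<lambda>x. c *\<^sub>R p x) \<in> VPoly k"
  by (simp add: VPoly_def Poly_cmult)

lemma VPoly_0: "(\<lambda>x. 0) \<in> VPoly k"
  by (simp add: VPoly_def Poly_0)

lemma VPoly_continuous: "p \<in> VPoly k \<Longrightarrow> continuous_on S p"
proof -
  assume "p \<in> VPoly k"
  then have "continuous_on S (\<lambda>x. \<chi> j. p x $ j)"
    by (intro continuous_on_vec_lambda Poly_continuous[OF VPoly_nth])
  then show ?thesis by simp
qed

lemma nedelec_VPoly:
  assumes "p \<in> VPoly k" "q \<in> VPoly k"
  shows "(\<lambda>x. p x + cross3 x (q x)) \<in> VPoly (Suc k)"
  unfolding VPoly_def mem_Collect_eq
proof
  fix j show "(\<lambda>x. (p x + cross3 x (q x)) $ j) \<in> Poly (Suc k)"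
    using exhaust_3[of j] Poly_mono[OF VPoly_nth[OF assms(1)], of "Suc k"] Poly_mult_nth[OF VPoly_nth[OF assms(2)]]
    by (auto simp: cross_components mult.commute[of "q _ $ _"] intro!: Poly_add Poly_diff)
qed

lemma raviart_thomas_VPoly:
  assumes "p \<in> VPoly k" "q \<in> Poly k"
  shows "(\<lambda>x. p x + q x *\<^sub>R x) \<in> VPoly (Suc k)"
  unfolding VPoly_def mem_Collect_eq
proof
  fix j show "(\<lambda>x. (p x + q x *\<^sub>R x) $ j) \<in> Poly (Suc k)"
    using Poly_mono[OF VPoly_nth[OF assms(1)], of "Suc k"] Poly_mult_nth[OF assms(2)]
    by (auto simp: mult.commute[of "q _"] intro!: Poly_add)
qed

lemma classical_grad_VPoly: "p \<in> Poly (Suc k) \<Longrightarrow> classical_grad p \<in> VPoly k"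
  using Poly_partial[of p "Suc k"] by (simp add: VPoly_def classical_grad_def)

text \<open>By the identity \<open>curl (x \<times> q) = (div q) x - 2 q - (x \<bullet> \<nabla>) q\<close>, in which the last term has no
  higher degree than \<open>q\<close>. This is why the curl of a Nedelec field has the Raviart-Thomas form of
  the same order.\<close>
lemma curl_nedelec:
  assumes p: "p \<in> VPoly k" and q: "q \<in> VPoly k"
  obtains p' q' where "p' \<in> VPoly k" "q' \<in> Poly k"
    "\<And>x. classical_curl (\<lambda>x. p x + cross3 x (q x)) x = p' x + q' x *\<^sub>R x"
proof -
  note d = Poly_differentiable[OF VPoly_nth[OF p]] Poly_differentiable[OF VPoly_nth[OF q]] nth_differentiable
  have pp: "partial i (\<lambda>x. p x $ j) \<in> Poly k" "partial i (\<lambda>x. q x $ j) \<in> Poly k" for i j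
    using Poly_mono[OF Poly_partial[OF VPoly_nth[OF p]], of k] Poly_mono[OF Poly_partial[OF VPoly_nth[OF q]], of k]
    by auto
  define q' where "q' x = (\<Sum>j\<in>UNIV. partial j (\<lambda>x. q x $ j) x)" for x
  define p' where "p' x = classical_curl p x - 2 *\<^sub>R q x - (\<chi> i. \<Sum>j\<in>UNIV. x $ j * partial j (\<lambda>x. q x $ i) x)" for x
  have "p' \<in> VPoly k"
    unfolding VPoly_def mem_Collect_eq
  proof
    fix i
    have "(\<lambda>x. classical_curl p x $ i) \<in> Poly k"
      using exhaust_3[of i] pp by (auto simp: classical_curl_def intro!: Poly_diff)
    then show "(\<lambda>x. p' x $ i) \<in> Poly k"
      unfolding p'_def using VPoly_nth[OF q]
      by (auto intro!: Poly_diff Poly_cmult Poly_sum Poly_nth_mult_partial)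
  qed
  moreover have "q' \<in> Poly k" unfolding q'_def[abs_def] by (intro Poly_sum pp)
  moreover have "classical_curl (\<lambda>x. p x + cross3 x (q x)) x = p' x + q' x *\<^sub>R x" for x
    by (simp add: vec_eq_iff forall_3 p'_def q'_def classical_curl_def cross_components
        partial_add partial_diff partial_mult partial_nth d sum_3 algebra_simps)
  ultimately show ?thesis by (rule that)
qed

section \<open>Weak derivatives\<close>

locale bounded_open =
  fixes \<Omega> :: "vec3 set"
  assumes open_domain: "open \<Omega>" and bounded_domain: "bounded \<Omega>"
begin

lemma lmeasurable_domain: "\<Omega> \<in> lmeasurable"
  using bounded_domain open_domain by (rule lmeasurable_open)

lemma sets_domain: "\<Omega> \<in> sets lebesgue"
  using lmeasurable_domain by auto

lemma continuous_L2:
  fixes f :: "vec3 \<Rightarrow> 'a::euclidean_space"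
  assumes "continuous_on UNIV f"
  shows "f \<in> L2 \<Omega>"
proof -
  have "compact (f ` closure \<Omega>)"
    using bounded_domain by (intro compact_continuous_image continuous_on_subset[OF assms]) (auto simp: compact_closure)
  then obtain B where B: "\<forall>y\<in>f ` closure \<Omega>. norm y \<le> B"
    using compact_imp_bounded bounded_iff by metis
  show ?thesis
  proof (rule L2_bounded[OF lmeasurable_domain])
    show "f \<in> borel_measurable (lebesgue_on \<Omega>)"
      by (intro continuous_imp_measurable_on_sets_lebesgue continuous_on_subset[OF assms] sets_domain) simp
    show "norm (f x) \<le> B" if "x \<in> \<Omega>" for x using B that closure_subset[of \<Omega>] by blast
  qed
qed

lemmas VPoly_L2 = continuous_L2[OF VPoly_continuous]

lemma integrable_mult_L2: "f \<in> L2 \<Omega> \<Longrightarrow> g \<in> L2 \<Omega> \<Longrightarrow> (\<lambda>x. f x * g x :: real) integrable_on \<Omega>"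
  by (intro set_lebesgue_integral_eq_integral(1) L2_mult_absolutely_integrable[OF sets_domain])

lemma integrable_inner_L2: "f \<in> L2 \<Omega> \<Longrightarrow> g \<in> L2 \<Omega> \<Longrightarrow> (\<lambda>x. f x \<bullet> g x) integrable_on \<Omega>"
  by (intro set_lebesgue_integral_eq_integral(1) L2_inner_absolutely_integrable[OF sets_domain])

lemmas test_L2 = test_fun_L2[OF _ lmeasurable_domain] test_fun_L2[OF test_fun_partial lmeasurable_domain]

lemma integral_inner_eq_sum:
  fixes f g :: "vec3 \<Rightarrow> vec3"
  assumes "f \<in> L2 \<Omega>" "g \<in> L2 \<Omega>"
  shows "integral \<Omega> (\<lambda>x. f x \<bullet> g x) = (\<Sum>i\<in>UNIV. integral \<Omega> (\<lambda>x. f x $ i * g x $ i))"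
  unfolding inner_vec_def inner_real_def
  by (intro integral_sum integrable_mult_L2 L2_nth[OF sets_domain] assms) simp

lemma has_weak_grad_iff:
  assumes f: "f \<in> L2 \<Omega>"
  shows "has_weak_grad \<Omega> f g \<longleftrightarrow> g \<in> L2 \<Omega> \<and> (\<forall>i \<phi>. test_fun \<Omega> \<phi> \<longrightarrow>
    integral \<Omega> (\<lambda>x. f x * partial i \<phi> x) = - integral \<Omega> (\<lambda>x. \<phi> x * g x $ i))"
proof -
  have "integral \<Omega> (\<lambda>x. f x *\<^sub>R classical_grad \<phi> x) = - integral \<Omega> (\<lambda>x. \<phi> x *\<^sub>R g x) \<longleftrightarrow>
     (\<forall>i. integral \<Omega> (\<lambda>x. f x * partial i \<phi> x) = - integral \<Omega> (\<lambda>x. \<phi> x * g x $ i))"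
    if g: "g \<in> L2 \<Omega>" and \<phi>: "test_fun \<Omega> \<phi>" for \<phi>
  proof -
    have 1: "(\<lambda>x. f x *\<^sub>R classical_grad \<phi> x) integrable_on \<Omega>"
      using f test_L2[OF \<phi>]
      by (intro set_lebesgue_integral_eq_integral(1))
         (simp add: absolutely_integrable_on_iff_component[OF sets_domain] classical_grad_def
           L2_mult_absolutely_integrable[OF sets_domain])
    have 2: "(\<lambda>x. \<phi> x *\<^sub>R g x) integrable_on \<Omega>"
      using test_L2[OF \<phi>] L2_nth[OF sets_domain g]
      by (intro set_lebesgue_integral_eq_integral(1))
         (simp add: absolutely_integrable_on_iff_component[OF sets_domain]
           L2_mult_absolutely_integrable[OF sets_domain])
    have "integral \<Omega> (\<lambda>x. f x *\<^sub>R classical_grad \<phi> x) $ i = integral \<Omega> (\<lambda>x. f x * partial i \<phi> x)" for i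
      using integral_component_eq_cart[OF 1, of i] by (simp add: classical_grad_def)
    moreover have "integral \<Omega> (\<lambda>x. \<phi> x *\<^sub>R g x) $ i = integral \<Omega> (\<lambda>x. \<phi> x * g x $ i)" for i
      using integral_component_eq_cart[OF 2, of i] by simp
    ultimately show ?thesis by (simp add: vec_eq_iff)
  qed
  then show ?thesis unfolding has_weak_grad_def by blast
qed

lemma has_weak_grad_D:
  assumes "f \<in> L2 \<Omega>" "has_weak_grad \<Omega> f g"
  shows "g \<in> L2 \<Omega>" "test_fun \<Omega> \<phi> \<Longrightarrow> integral \<Omega> (\<lambda>x. \<phi> x * g x $ i) = - integral \<Omega> (\<lambda>x. f x * partial i \<phi> x)"
  using assms by (simp_all add: has_weak_grad_iff)

lemma has_weak_grad_unique:
  assumes f: "f \<in> L2 \<Omega>" and g: "has_weak_grad \<Omega> f g" and h: "has_weak_grad \<Omega> f h"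
  shows "negligible {x\<in>\<Omega>. g x \<noteq> h x}"
proof (intro negligible_neq_vec negligible_neq_if_test_fun_integrals_eq[OF lmeasurable_domain] open_domain order_refl L2_nth[OF sets_domain])
  fix i \<phi> assume \<phi>: "test_fun \<Omega> \<phi>"
  show "integral \<Omega> (\<lambda>x. \<phi> x * g x $ i) = integral \<Omega> (\<lambda>x. \<phi> x * h x $ i)"
    using has_weak_grad_D(2)[OF f g \<phi>] has_weak_grad_D(2)[OF f h \<phi>] by simp
qed (use has_weak_grad_D(1)[OF f] g h in auto)

lemma integral_cong_test_fun:
  assumes \<phi>: "test_fun U \<phi>" and eq: "\<And>x. x \<in> U \<Longrightarrow> f x = g x"
  shows "integral \<Omega> (\<lambda>x. f x * \<phi> x) = integral \<Omega> (\<lambda>x. g x * \<phi> x)"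
proof -
  obtain K where K: "compact K" "K \<subseteq> U" "\<And>x. x \<notin> K \<Longrightarrow> \<phi> x = 0" using test_fun_support[OF \<phi>] by metis
  have "f x * \<phi> x = g x * \<phi> x" for x
  proof (cases "x \<in> K")
    case True with K(2) eq[of x] show ?thesis by auto
  qed (simp add: K(3))
  then show ?thesis by (intro arg_cong[where f = "integral \<Omega>"] ext)
qed

text \<open>Against test functions supported in \<open>U\<close> one may integrate by parts classically, so both sides
  have the same integrals.\<close>
lemma has_weak_grad_local:
  assumes f: "f \<in> L2 \<Omega>" and g: "has_weak_grad \<Omega> f g" and U: "open U" "U \<subseteq> \<Omega>"
    and p: "p \<in> Poly k" and eq: "\<And>x. x \<in> U \<Longrightarrow> f x = p x"
  shows "negligible {x\<in>U. g x \<noteq> classical_grad p x}"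
proof (intro negligible_neq_vec negligible_neq_if_test_fun_integrals_eq[OF lmeasurable_domain] U L2_nth[OF sets_domain])
  fix i \<phi> assume \<phi>: "test_fun U \<phi>"
  have "integral \<Omega> (\<lambda>x. \<phi> x * g x $ i) = - integral \<Omega> (\<lambda>x. f x * partial i \<phi> x)"
    by (rule has_weak_grad_D(2)[OF f g test_fun_mono[OF \<phi> U(2)]])
  also have "integral \<Omega> (\<lambda>x. f x * partial i \<phi> x) = integral \<Omega> (\<lambda>x. p x * partial i \<phi> x)"
    by (rule integral_cong_test_fun[OF test_fun_partial[OF \<phi>] eq])
  also have "\<dots> = - integral \<Omega> (\<lambda>x. partial i p x * \<phi> x)"
    by (rule integral_by_parts_test_fun[OF \<phi> U(2) Poly_differentiable[OF p] Poly_continuous[OF Poly_partial[OF p]]])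
  finally show "integral \<Omega> (\<lambda>x. \<phi> x * g x $ i) = integral \<Omega> (\<lambda>x. \<phi> x * classical_grad p x $ i)"
    by (simp add: classical_grad_def mult.commute)
next
  show "g \<in> L2 \<Omega>" using has_weak_grad_D(1)[OF f g] .
  have "classical_grad p \<in> VPoly (k - 1)"
    using Poly_partial[OF p] by (simp add: VPoly_def classical_grad_def)
  then show "classical_grad p \<in> L2 \<Omega>" by (rule VPoly_L2)
qed

lemma has_weak_grad_add:
  assumes f: "f \<in> L2 \<Omega>" "has_weak_grad \<Omega> f g" and f': "f' \<in> L2 \<Omega>" "has_weak_grad \<Omega> f' g'"
  shows "has_weak_grad \<Omega> (\<lambda>x. f x + f' x) (\<lambda>x. g x + g' x)"
  unfolding has_weak_grad_iff[OF L2_add[OF sets_domain f(1) f'(1)]]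
proof (intro conjI allI impI)
  show "(\<lambda>x. g x + g' x) \<in> L2 \<Omega>"
    by (intro L2_add[OF sets_domain] has_weak_grad_D(1)[OF f] has_weak_grad_D(1)[OF f'])
  fix i \<phi> assume \<phi>: "test_fun \<Omega> \<phi>"
  have "integral \<Omega> (\<lambda>x. (f x + f' x) * partial i \<phi> x) = integral \<Omega> (\<lambda>x. f x * partial i \<phi> x) + integral \<Omega> (\<lambda>x. f' x * partial i \<phi> x)"
    unfolding distrib_right by (intro integral_add integrable_mult_L2 f f' test_L2[OF \<phi>])
  moreover have "integral \<Omega> (\<lambda>x. \<phi> x * (g x + g' x) $ i) = integral \<Omega> (\<lambda>x. \<phi> x * g x $ i) + integral \<Omega> (\<lambda>x. \<phi> x * g' x $ i)"
    unfolding distrib_left vector_add_component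
    by (intro integral_add integrable_mult_L2 test_L2[OF \<phi>] L2_nth[OF sets_domain] has_weak_grad_D(1)[OF f] has_weak_grad_D(1)[OF f'])
  ultimately show "integral \<Omega> (\<lambda>x. (f x + f' x) * partial i \<phi> x) = - integral \<Omega> (\<lambda>x. \<phi> x * (g x + g' x) $ i)"
    using has_weak_grad_D(2)[OF f \<phi>, of i] has_weak_grad_D(2)[OF f' \<phi>, of i] by simp
qed

lemma has_weak_grad_cmult:
  assumes f: "f \<in> L2 \<Omega>" "has_weak_grad \<Omega> f g"
  shows "has_weak_grad \<Omega> (\<lambda>x. c * f x) (\<lambda>x. c *\<^sub>R g x)"
proof -
  have cf: "(\<lambda>x. c * f x) \<in> L2 \<Omega>" using L2_scaleR[OF f(1), of c] by simp
  show ?thesis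
    unfolding has_weak_grad_iff[OF cf]
  proof (intro conjI allI impI)
    show "(\<lambda>x. c *\<^sub>R g x) \<in> L2 \<Omega>" by (intro L2_scaleR has_weak_grad_D(1)[OF f])
    fix i \<phi> assume \<phi>: "test_fun \<Omega> \<phi>"
    show "integral \<Omega> (\<lambda>x. c * f x * partial i \<phi> x) = - integral \<Omega> (\<lambda>x. \<phi> x * (c *\<^sub>R g x) $ i)"
      using has_weak_grad_D(2)[OF f \<phi>, of i] by (simp add: mult.assoc mult.left_commute[of _ c])
  qed
qed

lemma has_weak_grad_0:
  assumes "f \<in> L2 \<Omega>" "negligible {x\<in>\<Omega>. f x \<noteq> 0}"
  shows "has_weak_grad \<Omega> f (\<lambda>x. 0)"
  unfolding has_weak_grad_iff[OF assms(1)]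
proof (intro conjI allI impI L2_0)
  fix i \<phi> assume \<phi>: "test_fun \<Omega> \<phi>"
  have "integral \<Omega> (\<lambda>x. f x * partial i \<phi> x) = integral \<Omega> (\<lambda>x. 0)"
    by (rule integral_spike_on) (rule negligible_subset[OF assms(2)], auto)
  then show "integral \<Omega> (\<lambda>x. f x * partial i \<phi> x) = - integral \<Omega> (\<lambda>x. \<phi> x * 0 $ i)" by simp
qed

lemma has_weak_grad_const: "has_weak_grad \<Omega> (\<lambda>x. c) (\<lambda>x. 0)"
proof -
  have c: "(\<lambda>x::vec3. c) \<in> L2 \<Omega>" by (intro continuous_L2) auto
  show ?thesis
    unfolding has_weak_grad_iff[OF c]
  proof (intro conjI allI impI L2_0)
    fix i \<phi> assume \<phi>: "test_fun \<Omega> \<phi>"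
    have "integral \<Omega> (\<lambda>x. c * partial i \<phi> x) = - integral \<Omega> (\<lambda>x. partial i (\<lambda>x. c) x * \<phi> x)"
      by (rule integral_by_parts_test_fun[OF \<phi>]) auto
    then show "integral \<Omega> (\<lambda>x. c * partial i \<phi> x) = - integral \<Omega> (\<lambda>x. \<phi> x * 0 $ i)" by simp
  qed
qed

lemma H1_L2: "f \<in> H1 \<Omega> \<Longrightarrow> f \<in> L2 \<Omega>"
  by (simp add: H1_def)

lemma has_weak_grad_grad: "f \<in> H1 \<Omega> \<Longrightarrow> has_weak_grad \<Omega> f (grad \<Omega> f)"
  using someI_ex[of "has_weak_grad \<Omega> f"] by (auto simp: grad_def H1_def)

lemma has_weak_curl_curl: "f \<in> Hcurl \<Omega> \<Longrightarrow> has_weak_curl \<Omega> f (curl \<Omega> f)"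
  using someI_ex[of "has_weak_curl \<Omega> f"] by (auto simp: curl_def Hcurl_def)

lemmas test_field_curl_L2 = classical_curl_L2[OF _ lmeasurable_domain]
lemmas test_field_L2' = test_field_L2[OF _ lmeasurable_domain]

lemma has_weak_curl_test_fun:
  assumes "has_weak_curl \<Omega> f g" "test_fun \<Omega> \<phi>"
  shows "integral \<Omega> (\<lambda>x. \<phi> x * g x $ i) = integral \<Omega> (\<lambda>x. f x \<bullet> classical_curl (\<lambda>x. \<phi> x *\<^sub>R axis i 1) x)"
  using assms(1) test_field_axis[OF assms(2), of i]
  by (simp add: has_weak_curl_def inner_axis)

lemma has_weak_curl_unique:
  assumes g: "has_weak_curl \<Omega> f g" and h: "has_weak_curl \<Omega> f h"
  shows "negligible {x\<in>\<Omega>. g x \<noteq> h x}"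
proof (intro negligible_neq_vec negligible_neq_if_test_fun_integrals_eq[OF lmeasurable_domain] open_domain order_refl L2_nth[OF sets_domain])
  fix i \<phi> assume \<phi>: "test_fun \<Omega> \<phi>"
  show "integral \<Omega> (\<lambda>x. \<phi> x * g x $ i) = integral \<Omega> (\<lambda>x. \<phi> x * h x $ i)"
    using has_weak_curl_test_fun[OF g \<phi>] has_weak_curl_test_fun[OF h \<phi>] by simp
qed (use g h in \<open>auto simp: has_weak_curl_def\<close>)

lemma integral_by_parts_curl:
  assumes \<psi>: "test_field U \<psi>" and U: "U \<subseteq> \<Omega>" and P: "P \<in> VPoly k"
  shows "integral \<Omega> (\<lambda>x. P x \<bullet> classical_curl \<psi> x) = integral \<Omega> (\<lambda>x. classical_curl P x \<bullet> \<psi> x)"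
proof -
  let ?D = "\<lambda>a b c x. P x $ a * partial b (\<lambda>x. \<psi> x $ c) x"
  let ?E = "\<lambda>a b c x. partial b (\<lambda>x. P x $ a) x * \<psi> x $ c"
  note Pn = VPoly_nth[OF P] and tn = test_fieldD[OF \<psi>]
  have D: "?D a b c integrable_on \<Omega>" and E: "?E a b c integrable_on \<Omega>" for a b c
    by (intro set_lebesgue_integral_eq_integral(1) test_fun_absolutely_integrable[OF _ U] test_fun_partial tn
          Poly_continuous[OF Pn] Poly_continuous[OF Poly_partial[OF Pn]])+
  have DE: "integral \<Omega> (?D a b c) = - integral \<Omega> (?E a b c)" for a b c
    by (rule integral_by_parts_test_fun[OF tn U Poly_differentiable[OF Pn] Poly_continuous[OF Poly_partial[OF Pn]]])
  have "integral \<Omega> (\<lambda>x. P x \<bullet> classical_curl \<psi> x) =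
    integral \<Omega> (\<lambda>x. (?D 1 2 3 x - ?D 1 3 2 x) + (?D 2 3 1 x - ?D 2 1 3 x) + (?D 3 1 2 x - ?D 3 2 1 x))"
    by (simp add: inner_vec_def sum_3 classical_curl_nth algebra_simps)
  also have "\<dots> = (integral \<Omega> (?D 1 2 3) - integral \<Omega> (?D 1 3 2)) + (integral \<Omega> (?D 2 3 1) - integral \<Omega> (?D 2 1 3))
      + (integral \<Omega> (?D 3 1 2) - integral \<Omega> (?D 3 2 1))"
    by (simp add: integral_add integral_diff integrable_add integrable_diff D)
  also have "\<dots> = (integral \<Omega> (?E 3 2 1) - integral \<Omega> (?E 2 3 1)) + (integral \<Omega> (?E 1 3 2) - integral \<Omega> (?E 3 1 2))
      + (integral \<Omega> (?E 2 1 3) - integral \<Omega> (?E 1 2 3))"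
    unfolding DE by simp
  also have "\<dots> = integral \<Omega> (\<lambda>x. (?E 3 2 1 x - ?E 2 3 1 x) + (?E 1 3 2 x - ?E 3 1 2 x) + (?E 2 1 3 x - ?E 1 2 3 x))"
    by (simp add: integral_add integral_diff integrable_add integrable_diff E)
  also have "\<dots> = integral \<Omega> (\<lambda>x. classical_curl P x \<bullet> \<psi> x)"
    by (simp add: inner_vec_def sum_3 classical_curl_nth algebra_simps)
  finally show ?thesis .
qed

lemma classical_curl_VPoly: "P \<in> VPoly k \<Longrightarrow> classical_curl P \<in> VPoly (k - 1)"
  unfolding VPoly_def mem_Collect_eq
proof
  fix i assume "\<forall>j. (\<lambda>x. P x $ j) \<in> Poly k"
  then show "(\<lambda>x. classical_curl P x $ i) \<in> Poly (k - 1)"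
    using exhaust_3[of i] by (auto simp: classical_curl_nth simp del: One_nat_def intro!: Poly_diff Poly_partial)
qed

text \<open>The curl analogue of \<open>has_weak_grad_local\<close>, tested with fields that have a single non-zero
  component.\<close>
lemma has_weak_curl_local:
  assumes g: "has_weak_curl \<Omega> f g" and U: "open U" "U \<subseteq> \<Omega>"
    and P: "P \<in> VPoly k" and eq: "\<And>x. x \<in> U \<Longrightarrow> f x = P x"
  shows "negligible {x\<in>U. g x \<noteq> classical_curl P x}"
proof (intro negligible_neq_vec negligible_neq_if_test_fun_integrals_eq[OF lmeasurable_domain] U L2_nth[OF sets_domain])
  fix i \<phi> assume \<phi>: "test_fun U \<phi>"
  let ?\<psi> = "\<lambda>x. \<phi> x *\<^sub>R (axis i 1 :: vec3)"
  have \<psi>: "test_field U ?\<psi>" using \<phi> by (rule test_field_axis)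
  have "integral \<Omega> (\<lambda>x. \<phi> x * g x $ i) = integral \<Omega> (\<lambda>x. f x \<bullet> classical_curl ?\<psi> x)"
    by (rule has_weak_curl_test_fun[OF g test_fun_mono[OF \<phi> U(2)]])
  also have "\<dots> = integral \<Omega> (\<lambda>x. P x \<bullet> classical_curl ?\<psi> x)"
  proof -
    obtain K where K: "compact K" "K \<subseteq> U" "\<And>x. x \<notin> K \<Longrightarrow> \<phi> x = 0" using test_fun_support[OF \<phi>] by metis
    have "partial j (\<lambda>x. ?\<psi> x $ l) x = 0" if "x \<notin> K" for x j l
      by (rule partial_eq_0_outside[OF compact_imp_closed[OF K(1)] _ that]) (simp add: K(3))
    then have 0: "classical_curl ?\<psi> x = 0" if "x \<notin> K" for x
      using that by (simp add: vec_eq_iff forall_3 classical_curl_nth)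
    have "f x \<bullet> classical_curl ?\<psi> x = P x \<bullet> classical_curl ?\<psi> x" for x
    proof (cases "x \<in> K")
      case True with K(2) eq[of x] show ?thesis by auto
    qed (simp add: 0)
    then show ?thesis by (intro arg_cong[where f = "integral \<Omega>"] ext)
  qed
  also have "\<dots> = integral \<Omega> (\<lambda>x. classical_curl P x \<bullet> ?\<psi> x)"
    by (rule integral_by_parts_curl[OF \<psi> U(2) P])
  finally show "integral \<Omega> (\<lambda>x. \<phi> x * g x $ i) = integral \<Omega> (\<lambda>x. \<phi> x * classical_curl P x $ i)"
    by (simp add: inner_axis)
next
  show "g \<in> L2 \<Omega>" using g by (simp add: has_weak_curl_def)
  show "classical_curl P \<in> L2 \<Omega>" by (rule VPoly_L2[OF classical_curl_VPoly[OF P]])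
qed

lemma has_weak_curl_add:
  assumes f: "f \<in> L2 \<Omega>" "has_weak_curl \<Omega> f g" and f': "f' \<in> L2 \<Omega>" "has_weak_curl \<Omega> f' g'"
  shows "has_weak_curl \<Omega> (\<lambda>x. f x + f' x) (\<lambda>x. g x + g' x)"
  unfolding has_weak_curl_def
proof (intro conjI allI impI)
  have g: "g \<in> L2 \<Omega>" "g' \<in> L2 \<Omega>" using f f' by (auto simp: has_weak_curl_def)
  show "(\<lambda>x. g x + g' x) \<in> L2 \<Omega>" by (intro L2_add[OF sets_domain] g)
  fix \<psi> assume \<psi>: "test_field \<Omega> \<psi>"
  have "integral \<Omega> (\<lambda>x. (f x + f' x) \<bullet> classical_curl \<psi> x) =
     integral \<Omega> (\<lambda>x. f x \<bullet> classical_curl \<psi> x) + integral \<Omega> (\<lambda>x. f' x \<bullet> classical_curl \<psi> x)"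
    unfolding inner_add_left by (intro integral_add integrable_inner_L2 f f' test_field_curl_L2[OF \<psi>])
  moreover have "integral \<Omega> (\<lambda>x. (g x + g' x) \<bullet> \<psi> x) = integral \<Omega> (\<lambda>x. g x \<bullet> \<psi> x) + integral \<Omega> (\<lambda>x. g' x \<bullet> \<psi> x)"
    unfolding inner_add_left by (intro integral_add integrable_inner_L2 g test_field_L2'[OF \<psi>])
  ultimately show "integral \<Omega> (\<lambda>x. (f x + f' x) \<bullet> classical_curl \<psi> x) = integral \<Omega> (\<lambda>x. (g x + g' x) \<bullet> \<psi> x)"
    using f f' \<psi> by (simp add: has_weak_curl_def)
qed

lemma has_weak_curl_scaleR:
  assumes "has_weak_curl \<Omega> f g"
  shows "has_weak_curl \<Omega> (\<lambda>x. c *\<^sub>R f x) (\<lambda>x. c *\<^sub>R g x)"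
  using assms by (simp add: has_weak_curl_def L2_scaleR)

lemma div_classical_curl:
  assumes "test_field U \<psi>"
  shows "(\<Sum>i\<in>UNIV. partial i (\<lambda>x. classical_curl \<psi> x $ i) x) = 0"
proof -
  have d: "partial i (\<lambda>x. \<psi> x $ j) differentiable (at x)" for i j x
    by (rule test_fun_differentiable[OF test_fun_partial[OF test_fieldD[OF assms]]])
  have c: "partial i (partial l (\<lambda>x. \<psi> x $ j)) x = partial l (partial i (\<lambda>x. \<psi> x $ j)) x" for i j l
    by (rule partial_commute[OF test_fun_C_diff[OF test_fieldD[OF assms]]])
  show ?thesis
    using c[of 1 2 3] c[of 1 3 2] c[of 2 3 1]
    by (simp add: sum_3 classical_curl_nth partial_diff[OF d d])
qed

text \<open>A gradient has no curl, because the classical curl of a test field has no divergence.\<close>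
lemma has_weak_curl_grad:
  assumes f: "f \<in> L2 \<Omega>" "has_weak_grad \<Omega> f g"
  shows "has_weak_curl \<Omega> g (\<lambda>x. 0)"
  unfolding has_weak_curl_def
proof (intro conjI allI impI L2_0)
  fix \<psi> assume \<psi>: "test_field \<Omega> \<psi>"
  have t: "test_fun \<Omega> (\<lambda>x. classical_curl \<psi> x $ i)" for i
  proof -
    have d: "test_fun \<Omega> (\<lambda>x. partial a (\<lambda>y. \<psi> y $ b) x - partial c (\<lambda>y. \<psi> y $ d) x)" for a b c d
    proof -
      note t1 = test_fun_partial[OF test_fieldD[OF \<psi>]]
      obtain K where K: "compact K" "K \<subseteq> \<Omega>" "\<And>x. x \<notin> K \<Longrightarrow> partial a (\<lambda>y. \<psi> y $ b) x = 0"
        using test_fun_support[OF t1] by metis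
      obtain L where L: "compact L" "L \<subseteq> \<Omega>" "\<And>x. x \<notin> L \<Longrightarrow> partial c (\<lambda>y. \<psi> y $ d) x = 0"
        using test_fun_support[OF t1] by metis
      show ?thesis
        by (rule test_funI[of _ "K \<union> L"]) (use K L C_diff_diff[OF test_fun_C_diff[OF t1] test_fun_C_diff[OF t1]] in auto)
    qed
    show ?thesis using exhaust_3[of i] d by (auto simp: classical_curl_nth)
  qed
  have "integral \<Omega> (\<lambda>x. g x \<bullet> classical_curl \<psi> x) = (\<Sum>i\<in>UNIV. integral \<Omega> (\<lambda>x. g x $ i * classical_curl \<psi> x $ i))"
    by (rule integral_inner_eq_sum[OF has_weak_grad_D(1)[OF f] test_field_curl_L2[OF \<psi>]])
  also have "\<dots> = (\<Sum>i\<in>UNIV. - integral \<Omega> (\<lambda>x. f x * partial i (\<lambda>x. classical_curl \<psi> x $ i) x))"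
    using has_weak_grad_D(2)[OF f t] by (simp add: mult.commute)
  also have "\<dots> = - integral \<Omega> (\<lambda>x. \<Sum>i\<in>UNIV. f x * partial i (\<lambda>x. classical_curl \<psi> x $ i) x)"
    unfolding sum_negf by (subst integral_sum) (auto intro!: integrable_mult_L2 f test_L2 t)
  also have "\<dots> = 0"
    by (simp add: div_classical_curl[OF \<psi>] flip: sum_distrib_left)
  finally show "integral \<Omega> (\<lambda>x. g x \<bullet> classical_curl \<psi> x) = integral \<Omega> (\<lambda>x. 0 \<bullet> \<psi> x)" by simp
qed

lemma classical_curl_classical_grad:
  assumes "test_fun U \<phi>"
  shows "classical_curl (classical_grad \<phi>) x = 0"
proof -
  have c: "partial i (partial l \<phi>) x = partial l (partial i \<phi>) x" for i l
    by (rule partial_commute[OF test_fun_C_diff[OF assms]])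
  show ?thesis using c[of 1 2] c[of 1 3] c[of 2 3]
    by (simp add: vec_eq_iff forall_3 classical_curl_nth classical_grad_def cong: if_cong)
qed

text \<open>The definition of the weak curl is applied to the test field \<open>classical_grad \<phi>\<close>, whose curl
  vanishes. It says that a weak curl has weak divergence 0.\<close>
lemma has_weak_curl_orthogonal_grad:
  assumes "has_weak_curl \<Omega> f g" and \<phi>: "test_fun \<Omega> \<phi>"
  shows "integral \<Omega> (\<lambda>x. g x \<bullet> classical_grad \<phi> x) = 0"
proof -
  have "test_field \<Omega> (classical_grad \<phi>)"
    using test_fun_partial[OF \<phi>] by (simp add: test_field_def classical_grad_def)
  with assms(1) have "integral \<Omega> (\<lambda>x. f x \<bullet> classical_curl (classical_grad \<phi>) x) = integral \<Omega> (\<lambda>x. g x \<bullet> classical_grad \<phi> x)"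
    by (simp add: has_weak_curl_def)
  then show ?thesis by (simp add: classical_curl_classical_grad[OF \<phi>])
qed

lemma has_weak_curl_spike:
  assumes g: "has_weak_curl \<Omega> f g" and f': "negligible {x\<in>\<Omega>. f' x \<noteq> f x}" and g': "negligible {x\<in>\<Omega>. g' x \<noteq> g x}"
  shows "has_weak_curl \<Omega> f' g'"
  unfolding has_weak_curl_def
proof (intro conjI allI impI)
  show "g' \<in> L2 \<Omega>"
    by (rule L2_spike[OF sets_domain _ g', of g]) (use g in \<open>auto simp: has_weak_curl_def\<close>)
  fix \<psi> assume \<psi>: "test_field \<Omega> \<psi>"
  have "integral \<Omega> (\<lambda>x. f' x \<bullet> classical_curl \<psi> x) = integral \<Omega> (\<lambda>x. f x \<bullet> classical_curl \<psi> x)"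
    by (rule integral_spike_on, rule negligible_subset[OF f']) auto
  moreover have "integral \<Omega> (\<lambda>x. g' x \<bullet> \<psi> x) = integral \<Omega> (\<lambda>x. g x \<bullet> \<psi> x)"
    by (rule integral_spike_on, rule negligible_subset[OF g']) auto
  ultimately show "integral \<Omega> (\<lambda>x. f' x \<bullet> classical_curl \<psi> x) = integral \<Omega> (\<lambda>x. g' x \<bullet> \<psi> x)"
    using g \<psi> by (simp add: has_weak_curl_def)
qed

end

section \<open>Cells, facets and boundary traces\<close>

lemma islimpt_open_closure:
  fixes x :: "'a::perfect_space"
  assumes "open U" "x \<in> closure U"
  shows "x islimpt U"
proof (cases "x \<in> U")
  case True
  then show ?thesis using assms(1) by (metis interior_limit_point interior_open)
next
  case False
  then show ?thesis using assms(2) by (simp add: closure_def)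
qed

lemma trace_eq:
  fixes p :: "vec3 \<Rightarrow> 'a::t2_space"
  assumes "open U" "x \<in> closure U" "continuous_on UNIV p" "\<And>y. y \<in> U \<Longrightarrow> f y = p y"
  shows "trace U f x = p x"
  unfolding trace_def
proof (rule tendsto_Lim)
  show "at x within U \<noteq> bot" using islimpt_open_closure[OF assms(1,2)] by (simp add: trivial_limit_within)
  have "(p \<longlongrightarrow> p x) (at x within U)"
    using assms(3) by (simp add: continuous_on_def tendsto_within_subset[of _ _ _ UNIV])
  then show "(f \<longlongrightarrow> p x) (at x within U)"
    by (rule Lim_transform_eventually) (simp add: eventually_at_filter assms(4))
qed

lemma partial_local:
  assumes "open U" "x \<in> U" "\<And>y. y \<in> U \<Longrightarrow> f y = p y" "p differentiable (at x)"
  shows "partial i f x = partial i p x"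
proof -
  have "(f has_derivative (\<lambda>v. \<Sum>i\<in>UNIV. v $ i * partial i p x)) (at x)"
    by (rule has_derivative_transform_within_open[OF has_derivative_partial[OF assms(4)] assms(1,2)]) (simp add: assms(3))
  then show ?thesis by (simp add: partial_eq sum_axis_mult)
qed

lemma classical_grad_local:
  assumes "open U" "x \<in> U" "\<And>y. y \<in> U \<Longrightarrow> f y = p y" "p \<in> Poly k"
  shows "classical_grad f x = classical_grad p x"
  unfolding classical_grad_def vec_eq_iff
  using partial_local[OF assms(1-3) Poly_differentiable[OF assms(4)]] by simp

lemma classical_curl_local:
  assumes "open U" "x \<in> U" "\<And>y. y \<in> U \<Longrightarrow> f y = p y" "p \<in> VPoly k"
  shows "classical_curl f x = classical_curl p x"
proof -
  have "partial i (\<lambda>x. f x $ j) x = partial i (\<lambda>x. p x $ j) x" for i j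
    by (rule partial_local[OF assms(1,2) _ Poly_differentiable[OF VPoly_nth[OF assms(4)]]]) (simp add: assms(3))
  then show ?thesis by (simp add: vec_eq_iff forall_3 classical_curl_nth)
qed

lemma polyhedral_cell_closed:
  assumes "polyhedral_cell K"
  shows "closed K" "closure (interior K) = K" "negligible (frontier K)" "compact K"
proof -
  obtain P where P: "finite P" "\<forall>C\<in>P. polytope C \<and> interior C \<noteq> {}" "K = \<Union>P"
    using assms unfolding polyhedral_cell_def by blast
  show "compact K" using P by (auto intro: compact_Union polytope_imp_compact)
  then show cl: "closed K" by (rule compact_imp_closed)
  show "closure (interior K) = K"
  proof
    show "closure (interior K) \<subseteq> K" using cl by (simp add: closure_minimal interior_subset)
    show "K \<subseteq> closure (interior K)"
    proof
      fix x assume "x \<in> K"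
      then obtain C where C: "C \<in> P" "x \<in> C" using P(3) by auto
      have "closure (interior C) = closure C"
        using P(2) C(1) by (intro convex_closure_interior polytope_imp_convex) auto
      then have "x \<in> closure (interior C)" using C(2) closure_subset by auto
      moreover have "interior C \<subseteq> interior K" using C(1) P(3) by (intro interior_mono) auto
      ultimately show "x \<in> closure (interior K)" using closure_mono by blast
    qed
  qed
  have "frontier K \<subseteq> \<Union>(frontier ` P)"
    unfolding P(3) by (rule frontier_Union_subset[OF P(1)])
  moreover have "negligible (\<Union>(frontier ` P))"
    using P by (intro negligible_Union) (auto intro!: negligible_convex_frontier polytope_imp_convex)
  ultimately show "negligible (frontier K)" by (rule negligible_subset[rotated])
qed

lemma outer_normal_in: "outer_normal K x n \<Longrightarrow> x \<in> K"
proof -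
  assume "outer_normal K x n"
  then obtain r where "r > 0" "K \<inter> ball x r = {y \<in> ball x r. n \<bullet> (y - x) \<le> 0}"
    unfolding outer_normal_def by blast
  then have "x \<in> K \<inter> ball x r" by simp
  then show ?thesis by simp
qed

lemma outer_normal_not_interior:
  assumes "outer_normal K x n"
  shows "x \<notin> interior K"
proof
  assume "x \<in> interior K"
  then obtain s where s: "s > 0" "ball x s \<subseteq> K" by (auto simp: mem_interior)
  obtain r where r: "r > 0" "K \<inter> ball x r = {y \<in> ball x r. n \<bullet> (y - x) \<le> 0}" and n: "norm n = 1"
    using assms unfolding outer_normal_def by blast
  define t where "t = min s r / 2"
  have t: "t > 0" "t < s" "t < r" using s r by (auto simp: t_def)
  have "x + t *\<^sub>R n \<in> ball x s" "x + t *\<^sub>R n \<in> ball x r" using t n by (auto simp: dist_norm)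
  then have "n \<bullet> ((x + t *\<^sub>R n) - x) \<le> 0" using r(2) s(2) by blast
  moreover have "n \<bullet> ((x + t *\<^sub>R n) - x) = t" using n by (simp add: dot_square_norm)
  ultimately show False using t by simp
qed

text \<open>Near \<open>x\<close> the boundary of \<open>K\<close> is a flat disc with the constant normal \<open>n\<close>. The disc is connected
  and meets the component of which \<open>F\<close> is the closure, so it is contained in \<open>F\<close>. Boundary
  conditions imposed on \<open>F\<close> thus hold on a whole disc and may be differentiated tangentially.\<close>
lemma facet_contains_disc:
  assumes F: "F \<in> facets K" "x \<in> F" and n: "outer_normal K x n"
  obtains r where "r > 0" "\<And>y. y \<in> ball x r \<Longrightarrow> n \<bullet> (y - x) = 0 \<Longrightarrow> y \<in> F \<and> outer_normal K y n"
proof -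
  obtain r where r: "r > 0" "K \<inter> ball x r = {y \<in> ball x r. n \<bullet> (y - x) \<le> 0}" and n1: "norm n = 1"
    using n unfolding outer_normal_def by blast
  let ?Z = "{x. \<exists>n. outer_normal K x n}"
  obtain C where C: "C \<in> components ?Z" "F = closure C" using F(1) by (auto simp: facets_def)
  define D where "D = ball x r \<inter> {y. n \<bullet> (y - x) = 0}"
  have "{y. n \<bullet> (y - x) = 0} = {y. n \<bullet> y = n \<bullet> x}" by (auto simp: inner_diff_right)
  then have "convex D" unfolding D_def by (simp add: convex_Int convex_hyperplane)
  then have conn: "connected D" by (rule convex_connected)
  have on: "outer_normal K y n" if "y \<in> D" for y
    unfolding outer_normal_def
  proof (intro conjI n1 exI[of _ "r - dist x y"])
    show "r - dist x y > 0" using that by (simp add: D_def)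
    have sub: "z \<in> ball x r" if "z \<in> ball y (r - dist x y)" for z
      using that dist_triangle[of x z y] by (simp add: dist_commute)
    have eq: "n \<bullet> (z - y) = n \<bullet> (z - x)" for z
      using that by (simp add: D_def inner_diff_right)
    show "K \<inter> ball y (r - dist x y) = {z \<in> ball y (r - dist x y). n \<bullet> (z - y) \<le> 0}"
      unfolding eq using r(2) sub by blast
  qed
  then have DZ: "D \<subseteq> ?Z" by blast
  have "x \<in> closure C" using F(2) C(2) by simp
  then obtain y where y: "y \<in> C" "dist y x < r" using r(1) closure_approachable by blast
  then have yZ: "y \<in> ?Z" using C(1) in_components_subset by blast
  then obtain n' where n': "outer_normal K y n'" by blast
  have yb: "y \<in> ball x r" using y(2) by (simp add: dist_commute)
  have "n \<bullet> (y - x) \<le> 0" using r(2) yb outer_normal_in[OF n'] by blast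
  moreover have "\<not> n \<bullet> (y - x) < 0"
  proof
    assume "n \<bullet> (y - x) < 0"
    have "open (ball x r \<inter> {z. n \<bullet> z < n \<bullet> x})" by (intro open_Int open_ball open_halfspace_lt)
    moreover have "ball x r \<inter> {z. n \<bullet> z < n \<bullet> x} \<subseteq> K"
    proof
      fix z assume "z \<in> ball x r \<inter> {z. n \<bullet> z < n \<bullet> x}"
      then have "z \<in> {y \<in> ball x r. n \<bullet> (y - x) \<le> 0}" by (auto simp: inner_diff_right)
      then show "z \<in> K" using r(2) by blast
    qed
    moreover have "y \<in> ball x r \<inter> {z. n \<bullet> z < n \<bullet> x}"
      using yb \<open>n \<bullet> (y - x) < 0\<close> by (simp add: inner_diff_right)
    ultimately have "y \<in> interior K" by (meson interior_maximal subsetD)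
    then show False using outer_normal_not_interior[OF n'] by simp
  qed
  ultimately have "y \<in> D" using yb by (simp add: D_def)
  with y(1) have "C \<inter> D \<noteq> {}" by auto
  then have "D \<subseteq> C" by (rule components_maximal[OF C(1) conn DZ])
  then have DF: "D \<subseteq> F" using C(2) closure_subset by (metis order_trans)
  show ?thesis
  proof (rule that[OF r(1)])
    fix y assume "y \<in> ball x r" "n \<bullet> (y - x) = 0"
    then have "y \<in> D" by (simp add: D_def)
    then show "y \<in> F \<and> outer_normal K y n" using DF on by auto
  qed
qed

lemma facet_subset:
  assumes "closed K" "F \<in> facets K"
  shows "F \<subseteq> K"
proof -
  obtain C where C: "C \<in> components {x. \<exists>n. outer_normal K x n}" "F = closure C"
    using assms(2) by (auto simp: facets_def)
  have "C \<subseteq> K" using in_components_subset[OF C(1)] outer_normal_in by blast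
  then show ?thesis using C(2) assms(1) by (simp add: closure_minimal)
qed

lemma tangential_derivative_0:
  assumes p: "\<And>x. p differentiable (at x)" and r: "r > 0" and n: "norm n = 1"
    and 0: "\<And>y. y \<in> ball x r \<Longrightarrow> n \<bullet> (y - x) = 0 \<Longrightarrow> p y = (0::real)" and v: "n \<bullet> v = 0"
  shows "(\<Sum>i\<in>UNIV. v $ i * partial i p x) = 0"
proof -
  have 1: "((\<lambda>t. x + t *\<^sub>R v) has_derivative (\<lambda>s. s *\<^sub>R v)) (at 0)"
    by (auto intro!: derivative_eq_intros)
  have "((\<lambda>t. p (x + t *\<^sub>R v)) has_derivative (\<lambda>s. \<Sum>i\<in>UNIV. (s *\<^sub>R v) $ i * partial i p (x + 0 *\<^sub>R v))) (at 0)"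
    using has_derivative_compose[OF 1 has_derivative_partial[OF p]] .
  moreover have "(\<lambda>s. \<Sum>i\<in>UNIV. (s *\<^sub>R v) $ i * partial i p (x + 0 *\<^sub>R v)) = (*) (\<Sum>i\<in>UNIV. v $ i * partial i p x)"
    by (rule ext) (simp add: sum_distrib_left sum_distrib_right mult_ac)
  ultimately have d: "((\<lambda>t. p (x + t *\<^sub>R v)) has_real_derivative (\<Sum>i\<in>UNIV. v $ i * partial i p x)) (at 0)"
    by (simp add: has_field_derivative_def)
  \<comment> \<open>adding 1 covers the case \<open>v = 0\<close>\<close>
  define s where "s = r / (norm v + 1)"
  have s: "s > 0" using r by (simp add: s_def add_nonneg_pos)
  have z: "p (x + t *\<^sub>R v) = 0" if "\<bar>t\<bar> < s" for t
  proof (rule 0)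
    have "\<bar>t\<bar> * norm v \<le> \<bar>t\<bar> * (norm v + 1)" by (intro mult_left_mono) auto
    also have "\<dots> < s * (norm v + 1)" using that by (intro mult_strict_right_mono) (auto simp: add_nonneg_pos)
    also have "\<dots> = r" unfolding s_def using norm_ge_zero[of v] by (simp add: add_nonneg_eq_0_iff)
    finally show "x + t *\<^sub>R v \<in> ball x r" by (simp add: dist_norm)
    show "n \<bullet> (x + t *\<^sub>R v - x) = 0" using v by simp
  qed
  have "((\<lambda>t::real. 0) has_real_derivative 0) (at 0)" by simp
  then have "((\<lambda>t. p (x + t *\<^sub>R v)) has_real_derivative 0) (at 0)"
    by (rule has_field_derivative_transform_within_open[where S = "{-s<..<s}"])
       (use s in \<open>simp, simp, simp add: z abs_less_iff\<close>)
  then show ?thesis using d DERIV_unique by blast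
qed

lemma classical_grad_nth: "classical_grad f x $ i = partial i f x"
  by (simp add: classical_grad_def)

text \<open>The derivatives in all directions orthogonal to \<open>n\<close> vanish. The direction \<open>(n \<times> g) \<times> n\<close> is
  one of them, and its inner product with \<open>g\<close> is the square of \<open>norm (n \<times> g)\<close>.\<close>
lemma cross_grad_0:
  assumes p: "\<And>x. p differentiable (at x)" and r: "r > 0" and n: "norm n = 1"
    and 0: "\<And>y. y \<in> ball x r \<Longrightarrow> n \<bullet> (y - x) = 0 \<Longrightarrow> p y = (0::real)"
  shows "cross3 n (classical_grad p x) = 0"
proof -
  let ?g = "classical_grad p x"
  let ?v = "cross3 (cross3 n ?g) n"
  have nv: "n \<bullet> ?v = 0" by (rule dot_cross_self)
  have "?g \<bullet> ?v = (\<Sum>i\<in>UNIV. ?v $ i * partial i p x)"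
    by (simp add: inner_vec_def classical_grad_nth mult.commute)
  also have "\<dots> = 0" by (rule tangential_derivative_0[OF p r n 0 nv])
  finally have "?g \<bullet> ?v = 0" .
  moreover have "?g \<bullet> ?v = cross3 n ?g \<bullet> cross3 n ?g"
    by (simp add: cross3_simps)
  ultimately show ?thesis by simp
qed

text \<open>Since \<open>n\<close> is constant, \<open>n \<bullet> curl P\<close> is the divergence of \<open>W = P \<times> n\<close>. The tangential
  derivatives of \<open>W\<close> vanish because \<open>W\<close> vanishes on the disc, and the normal derivative does not
  contribute because \<open>W\<close> is everywhere orthogonal to \<open>n\<close>.\<close>
lemma normal_curl_0:
  assumes P: "\<And>x j. (\<lambda>x. P x $ j) differentiable (at x)" and r: "r > 0" and n: "norm n = 1"
    and 0: "\<And>y. y \<in> ball x r \<Longrightarrow> n \<bullet> (y - x) = 0 \<Longrightarrow> cross3 n (P y) = 0"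
  shows "n \<bullet> classical_curl P x = 0"
proof -
  define W where "W i y = cross3 (P y) n $ i" for i y
  have dW: "W i differentiable (at y)" for i y
    unfolding W_def[abs_def] using exhaust_3[of i] P by (auto simp: cross_components)
  have W0: "W i y = 0" if "y \<in> ball x r" "n \<bullet> (y - x) = 0" for i y
    using 0[OF that] cross_skew[of "P y" n] by (simp add: W_def)
  have nn: "(\<Sum>j\<in>UNIV. n $ j * n $ j) = 1"
    using n by (simp add: norm_eq_1 inner_vec_def)
  have diag: "partial i (W i) x = n $ i * (\<Sum>j\<in>UNIV. n $ j * partial j (W i) x)" for i
  proof -
    have "n \<bullet> (axis i 1 - n $ i *\<^sub>R n) = 0"
      using n by (simp add: inner_diff_right inner_axis dot_square_norm)
    from tangential_derivative_0[OF dW r n W0 this]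
    have "(\<Sum>j\<in>UNIV. axis i 1 $ j * partial j (W i) x) = (\<Sum>j\<in>UNIV. n $ i * (n $ j * partial j (W i) x))"
      by (simp add: left_diff_distrib sum_subtractf mult.assoc)
    then show ?thesis by (simp add: sum_axis_mult sum_distrib_left)
  qed
  have "n \<bullet> classical_curl P x = (\<Sum>i\<in>UNIV. partial i (W i) x)"
    unfolding W_def[abs_def]
    by (simp add: sum_3 cross_components inner_vec_def classical_curl_nth partial_diff partial_mult P algebra_simps)
  also have "\<dots> = (\<Sum>i\<in>UNIV. \<Sum>j\<in>UNIV. n $ i * (n $ j * partial j (W i) x))"
    by (subst diag) (simp add: sum_distrib_left)
  also have "\<dots> = (\<Sum>j\<in>UNIV. n $ j * (\<Sum>i\<in>UNIV. n $ i * partial j (W i) x))"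
    by (subst sum.swap) (simp add: sum_distrib_left mult.left_commute)
  also have "\<dots> = 0"
  proof -
    have "(\<Sum>i\<in>UNIV. n $ i * partial j (W i) x) = 0" for j
    proof -
      have 0: "(\<lambda>y. n $ 1 * W 1 y + n $ 2 * W 2 y + n $ 3 * W 3 y) = (\<lambda>y. 0)"
        by (rule ext) (simp add: W_def cross_components algebra_simps)
      have "partial j (\<lambda>y. n $ 1 * W 1 y + n $ 2 * W 2 y + n $ 3 * W 3 y) x = 0"
        unfolding 0 by simp
      then show ?thesis
        by (simp add: sum_3 partial_add partial_cmult dW)
    qed
    then show ?thesis by simp
  qed
  finally show ?thesis .
qed

section \<open>Finite element spaces\<close>

context bounded_open begin

lemma Hcurl_L2: "f \<in> Hcurl \<Omega> \<Longrightarrow> f \<in> L2 \<Omega>"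
  by (simp add: Hcurl_def)

lemma Hdiv_L2: "f \<in> Hdiv \<Omega> \<Longrightarrow> f \<in> L2 \<Omega>"
  by (simp add: Hdiv_def)

lemma has_weak_div_add:
  assumes f: "f \<in> L2 \<Omega>" "has_weak_div \<Omega> f g" and f': "f' \<in> L2 \<Omega>" "has_weak_div \<Omega> f' g'"
  shows "has_weak_div \<Omega> (\<lambda>x. f x + f' x) (\<lambda>x. g x + g' x)"
  unfolding has_weak_div_def
proof (intro conjI allI impI)
  have g: "g \<in> L2 \<Omega>" "g' \<in> L2 \<Omega>" using f f' by (auto simp: has_weak_div_def)
  show "(\<lambda>x. g x + g' x) \<in> L2 \<Omega>" by (intro L2_add[OF sets_domain] g)
  fix \<phi> assume \<phi>: "test_fun \<Omega> \<phi>"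
  have "integral \<Omega> (\<lambda>x. (f x + f' x) \<bullet> classical_grad \<phi> x) =
     integral \<Omega> (\<lambda>x. f x \<bullet> classical_grad \<phi> x) + integral \<Omega> (\<lambda>x. f' x \<bullet> classical_grad \<phi> x)"
    unfolding inner_add_left by (intro integral_add integrable_inner_L2 f f' classical_grad_L2[OF \<phi> lmeasurable_domain])
  moreover have "integral \<Omega> (\<lambda>x. (g x + g' x) * \<phi> x) = integral \<Omega> (\<lambda>x. g x * \<phi> x) + integral \<Omega> (\<lambda>x. g' x * \<phi> x)"
    unfolding distrib_right by (intro integral_add integrable_mult_L2 g test_L2[OF \<phi>])
  ultimately show "integral \<Omega> (\<lambda>x. (f x + f' x) \<bullet> classical_grad \<phi> x) = - integral \<Omega> (\<lambda>x. (g x + g' x) * \<phi> x)"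
    using f f' \<phi> by (simp add: has_weak_div_def)
qed

lemma has_weak_div_scaleR:
  assumes "has_weak_div \<Omega> f g"
  shows "has_weak_div \<Omega> (\<lambda>x. c *\<^sub>R f x) (\<lambda>x. c * g x)"
  using assms L2_scaleR[of g \<Omega> c] by (auto simp: has_weak_div_def mult.assoc)

lemma H1_add: "f \<in> H1 \<Omega> \<Longrightarrow> g \<in> H1 \<Omega> \<Longrightarrow> (\<lambda>x. f x + g x) \<in> H1 \<Omega>"
  unfolding H1_def using has_weak_grad_add[of f _ g] L2_add[OF sets_domain, of f g] by auto

lemma H1_cmult: "f \<in> H1 \<Omega> \<Longrightarrow> (\<lambda>x. c * f x) \<in> H1 \<Omega>"
  unfolding H1_def using has_weak_grad_cmult[of f _ c] L2_scaleR[of f \<Omega> c] by auto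

lemma Hcurl_add: "f \<in> Hcurl \<Omega> \<Longrightarrow> g \<in> Hcurl \<Omega> \<Longrightarrow> (\<lambda>x. f x + g x) \<in> Hcurl \<Omega>"
  unfolding Hcurl_def using has_weak_curl_add[of f _ g] L2_add[OF sets_domain, of f g] by auto

lemma Hcurl_scaleR: "f \<in> Hcurl \<Omega> \<Longrightarrow> (\<lambda>x. c *\<^sub>R f x) \<in> Hcurl \<Omega>"
  unfolding Hcurl_def using has_weak_curl_scaleR[of f _ c] L2_scaleR[of f \<Omega> c] by auto

lemma Hdiv_add: "f \<in> Hdiv \<Omega> \<Longrightarrow> g \<in> Hdiv \<Omega> \<Longrightarrow> (\<lambda>x. f x + g x) \<in> Hdiv \<Omega>"
  unfolding Hdiv_def using has_weak_div_add[of f _ g] L2_add[OF sets_domain, of f g] by auto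

lemma Hdiv_scaleR: "f \<in> Hdiv \<Omega> \<Longrightarrow> (\<lambda>x. c *\<^sub>R f x) \<in> Hdiv \<Omega>"
  unfolding Hdiv_def using has_weak_div_scaleR[of f _ c] L2_scaleR[of f \<Omega> c] by auto

end

locale mesh = bounded_open +
  fixes \<T> :: "vec3 set set"
  assumes conforming: "conforming_mesh \<Omega> \<T>"
begin

lemma finite_mesh: "finite \<T>"
  and Union_mesh: "\<Union>\<T> = closure \<Omega>"
  and cell_interior: "K \<in> \<T> \<Longrightarrow> interior K \<subseteq> \<Omega>"
  and mesh_cell: "K \<in> \<T> \<Longrightarrow> polyhedral_cell K"
  using conforming by (auto simp: conforming_mesh_def)

lemmas cell_closed = polyhedral_cell_closed(1)[OF mesh_cell]
  and closure_interior_cell = polyhedral_cell_closed(2)[OF mesh_cell]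
  and negligible_frontier_cell = polyhedral_cell_closed(3)[OF mesh_cell]

definition skeleton :: "vec3 set" where "skeleton = (\<Union>K\<in>\<T>. frontier K)"

lemma negligible_skeleton: "negligible skeleton"
  unfolding skeleton_def using finite_mesh negligible_frontier_cell by (intro negligible_Union) auto

lemma in_cell_interior:
  assumes "x \<in> \<Union>\<T>" "x \<notin> skeleton"
  obtains K where "K \<in> \<T>" "x \<in> interior K"
proof -
  obtain K where K: "K \<in> \<T>" "x \<in> K" using assms(1) by auto
  have "x \<notin> frontier K" using assms(2) K by (auto simp: skeleton_def)
  then have "x \<in> interior K" using K(2) closure_subset by (auto simp: frontier_def)
  with K show ?thesis using that by simp
qed

lemma integral_Union_mesh:
  fixes f :: "vec3 \<Rightarrow> real"
  shows "integral (\<Union>\<T>) f = integral \<Omega> f"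
proof (rule integral_spike_set)
  have "\<Union>\<T> - \<Omega> \<subseteq> skeleton"
    using in_cell_interior cell_interior by blast
  then show "negligible {x \<in> \<Union>\<T> - \<Omega>. f x \<noteq> 0}"
    by (intro negligible_subset[OF negligible_skeleton]) auto
  have "\<Omega> - \<Union>\<T> = {}" using Union_mesh closure_subset by auto
  then have "{x \<in> \<Omega> - \<Union>\<T>. f x \<noteq> 0} = {}" by auto
  then show "negligible {x \<in> \<Omega> - \<Union>\<T>. f x \<noteq> 0}" by (simp only: negligible_empty)
qed

lemma negligible_cells:
  assumes "\<And>K. K \<in> \<T> \<Longrightarrow> negligible {x\<in>interior K. P x}"
  shows "negligible {x\<in>\<Omega>. P x}"
proof (rule negligible_subset)
  show "negligible (skeleton \<union> (\<Union>K\<in>\<T>. {x\<in>interior K. P x}))"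
    using assms finite_mesh by (intro negligible_Un negligible_skeleton negligible_Union) auto
  show "{x\<in>\<Omega>. P x} \<subseteq> skeleton \<union> (\<Union>K\<in>\<T>. {x\<in>interior K. P x})"
  proof
    fix x assume x: "x \<in> {x\<in>\<Omega>. P x}"
    show "x \<in> skeleton \<union> (\<Union>K\<in>\<T>. {x\<in>interior K. P x})"
    proof (cases "x \<in> skeleton")
      case False
      have "x \<in> \<Union>\<T>" using x Union_mesh closure_subset by auto
      then obtain K where "K \<in> \<T>" "x \<in> interior K" using in_cell_interior[OF _ False] by metis
      then show ?thesis using x by auto
    qed simp
  qed
qed

lemma trace_cell:
  fixes p :: "vec3 \<Rightarrow> 'a::t2_space"
  assumes "K \<in> \<T>" "x \<in> K" "continuous_on UNIV p" "\<And>y. y \<in> interior K \<Longrightarrow> f y = p y"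
  shows "trace (interior K) f x = p x"
  using assms by (intro trace_eq) (simp_all add: closure_interior_cell)

lemma Q_H1: "f \<in> Q \<Omega> \<T> k \<Longrightarrow> f \<in> H1 \<Omega>" by (simp add: Q_def)

lemma Q_E:
  assumes "f \<in> Q \<Omega> \<T> k" "K \<in> \<T>"
  obtains p where "p \<in> Poly k" "\<And>x. x \<in> interior K \<Longrightarrow> f x = p x"
proof -
  have "\<exists>p\<in>Poly k. \<forall>x\<in>interior K. f x = p x" using assms by (simp add: Q_def)
  then show ?thesis using that by auto
qed

lemma Ned_E:
  assumes "f \<in> Ned \<Omega> \<T> k" "K \<in> \<T>"
  obtains p q where "p \<in> VPoly k" "q \<in> VPoly k" "\<And>x. x \<in> interior K \<Longrightarrow> f x = p x + cross3 x (q x)"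
proof -
  have "\<exists>p\<in>VPoly k. \<exists>q\<in>VPoly k. \<forall>x\<in>interior K. f x = p x + cross3 x (q x)" using assms by (simp add: Ned_def)
  then show ?thesis using that by auto
qed

lemma Ned_VPoly_E:
  assumes "f \<in> Ned \<Omega> \<T> k" "K \<in> \<T>"
  obtains p where "p \<in> VPoly (Suc k)" "\<And>x. x \<in> interior K \<Longrightarrow> f x = p x"
proof -
  obtain p q where "p \<in> VPoly k" "q \<in> VPoly k" "\<And>x. x \<in> interior K \<Longrightarrow> f x = p x + cross3 x (q x)"
    using Ned_E[OF assms] by metis
  then show ?thesis using nedelec_VPoly that[of "\<lambda>x. p x + cross3 x (q x)"] by simp
qed

lemma RT_E:
  assumes "f \<in> RT \<Omega> \<T> k" "K \<in> \<T>"
  obtains p q where "p \<in> VPoly k" "q \<in> Poly k" "\<And>x. x \<in> interior K \<Longrightarrow> f x = p x + q x *\<^sub>R x"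
proof -
  have "\<exists>p\<in>VPoly k. \<exists>q\<in>Poly k. \<forall>x\<in>interior K. f x = p x + q x *\<^sub>R x" using assms by (simp add: RT_def)
  then show ?thesis using that by auto
qed

lemma RT_VPoly_E:
  assumes "f \<in> RT \<Omega> \<T> k" "K \<in> \<T>"
  obtains p where "p \<in> VPoly (Suc k)" "\<And>x. x \<in> interior K \<Longrightarrow> f x = p x"
proof -
  obtain p q where "p \<in> VPoly k" "q \<in> Poly k" "\<And>x. x \<in> interior K \<Longrightarrow> f x = p x + q x *\<^sub>R x"
    using RT_E[OF assms] by metis
  then show ?thesis using raviart_thomas_VPoly that[of "\<lambda>x. p x + q x *\<^sub>R x"] by simp
qed

lemma Q_add:
  assumes "f \<in> Q \<Omega> \<T> k" "g \<in> Q \<Omega> \<T> k"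
  shows "(\<lambda>x. f x + g x) \<in> Q \<Omega> \<T> k"
  unfolding Q_def
proof (intro CollectI conjI ballI)
  show "(\<lambda>x. f x + g x) \<in> H1 \<Omega>" using assms by (intro H1_add) (auto simp: Q_def)
  fix K assume K: "K \<in> \<T>"
  obtain p where p: "p \<in> Poly k" "\<And>x. x \<in> interior K \<Longrightarrow> f x = p x" using Q_E[OF assms(1) K] by metis
  obtain q where q: "q \<in> Poly k" "\<And>x. x \<in> interior K \<Longrightarrow> g x = q x" using Q_E[OF assms(2) K] by metis
  show "\<exists>p\<in>Poly k. \<forall>x\<in>interior K. f x + g x = p x"
    by (rule bexI[OF _ Poly_add[OF p(1) q(1)]]) (simp add: p q)
qed

lemma Q_cmult:
  assumes "f \<in> Q \<Omega> \<T> k"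
  shows "(\<lambda>x. c * f x) \<in> Q \<Omega> \<T> k"
  unfolding Q_def
proof (intro CollectI conjI ballI)
  show "(\<lambda>x. c * f x) \<in> H1 \<Omega>" using assms by (intro H1_cmult) (auto simp: Q_def)
  fix K assume K: "K \<in> \<T>"
  obtain p where p: "p \<in> Poly k" "\<And>x. x \<in> interior K \<Longrightarrow> f x = p x" using Q_E[OF assms(1) K] by metis
  show "\<exists>p\<in>Poly k. \<forall>x\<in>interior K. c * f x = p x"
    by (rule bexI[OF _ Poly_cmult[OF p(1), of c]]) (simp add: p)
qed

lemma Q_diff: "f \<in> Q \<Omega> \<T> k \<Longrightarrow> g \<in> Q \<Omega> \<T> k \<Longrightarrow> (\<lambda>x. f x - g x) \<in> Q \<Omega> \<T> k"
  using Q_add[of f k "\<lambda>x. -1 * g x"] Q_cmult[of g k "-1"] by simp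

lemma Q_const: "(\<lambda>x. c) \<in> Q \<Omega> \<T> k"
proof -
  have "(\<lambda>x::vec3. c) \<in> L2 \<Omega>" by (intro continuous_L2) auto
  then have "(\<lambda>x. c) \<in> H1 \<Omega>" using has_weak_grad_const by (auto simp: H1_def)
  then show ?thesis using Poly_const[of c k] by (auto simp: Q_def)
qed

lemma VQ_diff: "f \<in> VQ \<Omega> \<T> k \<Longrightarrow> g \<in> VQ \<Omega> \<T> k \<Longrightarrow> (\<lambda>x. f x - g x) \<in> VQ \<Omega> \<T> k"
  by (simp add: VQ_def Q_diff)

lemma Q_L2: "f \<in> Q \<Omega> \<T> k \<Longrightarrow> f \<in> L2 \<Omega>"
  by (intro H1_L2 Q_H1)

lemma VQ_L2: "f \<in> VQ \<Omega> \<T> k \<Longrightarrow> f \<in> L2 \<Omega>"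
  by (intro L2_vec sets_domain Q_L2[of _ k]) (simp add: VQ_def)

lemma Q0_Q: "f \<in> Q0 \<Omega> \<T> k \<Longrightarrow> f \<in> Q \<Omega> \<T> k"
  by (simp add: Q0_def)

lemma Q0_trace: "f \<in> Q0 \<Omega> \<T> k \<Longrightarrow> K \<in> \<T> \<Longrightarrow> x \<in> K \<Longrightarrow> x \<in> frontier \<Omega> \<Longrightarrow> trace (interior K) f x = 0"
  by (simp add: Q0_def)

lemma Q0_add:
  assumes "f \<in> Q0 \<Omega> \<T> k" "g \<in> Q0 \<Omega> \<T> k"
  shows "(\<lambda>x. f x + g x) \<in> Q0 \<Omega> \<T> k"
  unfolding Q0_def
proof (intro CollectI conjI ballI)
  show "(\<lambda>x. f x + g x) \<in> Q \<Omega> \<T> k" by (intro Q_add Q0_Q assms)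
  fix K x assume K: "K \<in> \<T>" and x: "x \<in> K \<inter> frontier \<Omega>"
  obtain p where p: "p \<in> Poly k" "\<And>x. x \<in> interior K \<Longrightarrow> f x = p x" using Q_E[OF Q0_Q[OF assms(1)] K] by metis
  obtain q where q: "q \<in> Poly k" "\<And>x. x \<in> interior K \<Longrightarrow> g x = q x" using Q_E[OF Q0_Q[OF assms(2)] K] by metis
  have xK: "x \<in> K" "x \<in> frontier \<Omega>" using x by simp_all
  have "p x = 0" "q x = 0"
    using trace_cell[OF K xK(1) Poly_continuous[OF p(1)] p(2)] trace_cell[OF K xK(1) Poly_continuous[OF q(1)] q(2)]
      Q0_trace[OF assms(1) K xK] Q0_trace[OF assms(2) K xK] by simp_all
  moreover have "trace (interior K) (\<lambda>x. f x + g x) x = p x + q x"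
    using x by (intro trace_cell[OF K] continuous_intros Poly_continuous[OF p(1)] Poly_continuous[OF q(1)]) (auto simp: p q)
  ultimately show "trace (interior K) (\<lambda>x. f x + g x) x = 0" by simp
qed

lemma Q0_cmult:
  assumes "f \<in> Q0 \<Omega> \<T> k"
  shows "(\<lambda>x. c * f x) \<in> Q0 \<Omega> \<T> k"
  unfolding Q0_def
proof (intro CollectI conjI ballI)
  show "(\<lambda>x. c * f x) \<in> Q \<Omega> \<T> k" by (intro Q_cmult Q0_Q assms)
  fix K x assume K: "K \<in> \<T>" and x: "x \<in> K \<inter> frontier \<Omega>"
  obtain p where p: "p \<in> Poly k" "\<And>x. x \<in> interior K \<Longrightarrow> f x = p x" using Q_E[OF Q0_Q[OF assms(1)] K] by metis
  have xK: "x \<in> K" "x \<in> frontier \<Omega>" using x by simp_all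
  have "p x = 0"
    using trace_cell[OF K xK(1) Poly_continuous[OF p(1)] p(2)] Q0_trace[OF assms(1) K xK] by simp
  moreover have "trace (interior K) (\<lambda>x. c * f x) x = c * p x"
    using x by (intro trace_cell[OF K] continuous_intros Poly_continuous[OF p(1)]) (auto simp: p)
  ultimately show "trace (interior K) (\<lambda>x. c * f x) x = 0" by simp
qed

lemma Ned_L2: "f \<in> Ned \<Omega> \<T> k \<Longrightarrow> f \<in> L2 \<Omega>"
  by (intro Hcurl_L2) (simp add: Ned_def)

lemma RT_L2: "f \<in> RT \<Omega> \<T> k \<Longrightarrow> f \<in> L2 \<Omega>"
  by (intro Hdiv_L2) (simp add: RT_def)

lemma Ned_lincomb:
  assumes "f \<in> Ned \<Omega> \<T> k" "g \<in> Ned \<Omega> \<T> k"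
  shows "(\<lambda>x. a *\<^sub>R f x + b *\<^sub>R g x) \<in> Ned \<Omega> \<T> k"
  unfolding Ned_def
proof (intro CollectI conjI ballI)
  show "(\<lambda>x. a *\<^sub>R f x + b *\<^sub>R g x) \<in> Hcurl \<Omega>" using assms by (intro Hcurl_add Hcurl_scaleR) (auto simp: Ned_def)
  fix K assume K: "K \<in> \<T>"
  obtain p q where p: "p \<in> VPoly k" "q \<in> VPoly k" "\<And>x. x \<in> interior K \<Longrightarrow> f x = p x + cross3 x (q x)" using Ned_E[OF assms(1) K] by metis
  obtain p' q' where p': "p' \<in> VPoly k" "q' \<in> VPoly k" "\<And>x. x \<in> interior K \<Longrightarrow> g x = p' x + cross3 x (q' x)" using Ned_E[OF assms(2) K] by metis
  show "\<exists>p\<in>VPoly k. \<exists>q\<in>VPoly k. \<forall>x\<in>interior K. a *\<^sub>R f x + b *\<^sub>R g x = p x + cross3 x (q x)"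
    by (rule bexI[OF bexI[OF _ VPoly_add[OF VPoly_scaleR[OF p(2), of a] VPoly_scaleR[OF p'(2), of b]]]
       VPoly_add[OF VPoly_scaleR[OF p(1), of a] VPoly_scaleR[OF p'(1), of b]]])
     (simp add: p p' cross_add_right cross_mult_right scaleR_add_right)
qed

lemma RT_lincomb:
  assumes "f \<in> RT \<Omega> \<T> k" "g \<in> RT \<Omega> \<T> k"
  shows "(\<lambda>x. a *\<^sub>R f x + b *\<^sub>R g x) \<in> RT \<Omega> \<T> k"
  unfolding RT_def
proof (intro CollectI conjI ballI)
  show "(\<lambda>x. a *\<^sub>R f x + b *\<^sub>R g x) \<in> Hdiv \<Omega>" using assms by (intro Hdiv_add Hdiv_scaleR) (auto simp: RT_def)
  fix K assume K: "K \<in> \<T>"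
  obtain p q where p: "p \<in> VPoly k" "q \<in> Poly k" "\<And>x. x \<in> interior K \<Longrightarrow> f x = p x + q x *\<^sub>R x" using RT_E[OF assms(1) K] by metis
  obtain p' q' where p': "p' \<in> VPoly k" "q' \<in> Poly k" "\<And>x. x \<in> interior K \<Longrightarrow> g x = p' x + q' x *\<^sub>R x" using RT_E[OF assms(2) K] by metis
  show "\<exists>p\<in>VPoly k. \<exists>q\<in>Poly k. \<forall>x\<in>interior K. a *\<^sub>R f x + b *\<^sub>R g x = p x + q x *\<^sub>R x"
    by (rule bexI[OF bexI[OF _ Poly_add[OF Poly_cmult[OF p(2), of a] Poly_cmult[OF p'(2), of b]]]
       VPoly_add[OF VPoly_scaleR[OF p(1), of a] VPoly_scaleR[OF p'(1), of b]]])
     (simp add: p p' scaleR_add_right scaleR_add_left)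
qed

lemma Ned0_Ned: "f \<in> Ned0 \<Omega> \<T> k \<Longrightarrow> f \<in> Ned \<Omega> \<T> k"
  by (simp add: Ned0_def)

lemma RT0_RT: "f \<in> RT0 \<Omega> \<T> k \<Longrightarrow> f \<in> RT \<Omega> \<T> k"
  by (simp add: RT0_def)

lemma facet_in_cell: "K \<in> \<T> \<Longrightarrow> F \<in> facets K \<Longrightarrow> x \<in> F \<Longrightarrow> x \<in> K"
  using facet_subset[OF cell_closed] by blast

lemma Ned0_trace:
  assumes "f \<in> Ned0 \<Omega> \<T> k" "K \<in> \<T>" "F \<in> facets K" "F \<subseteq> frontier \<Omega>" "x \<in> F" "outer_normal K x n"
  shows "cross3 n (trace (interior K) f x) = 0"
  using assms unfolding Ned0_def by blast

lemma RT0_trace: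
  assumes "f \<in> RT0 \<Omega> \<T> k" "K \<in> \<T>" "F \<in> facets K" "F \<subseteq> frontier \<Omega>" "x \<in> F" "outer_normal K x n"
  shows "n \<bullet> trace (interior K) f x = 0"
  using assms unfolding RT0_def by blast

lemma Ned0_lincomb:
  assumes "f \<in> Ned0 \<Omega> \<T> k" "g \<in> Ned0 \<Omega> \<T> k"
  shows "(\<lambda>x. a *\<^sub>R f x + b *\<^sub>R g x) \<in> Ned0 \<Omega> \<T> k"
  unfolding Ned0_def
proof (intro CollectI conjI ballI impI allI)
  show "(\<lambda>x. a *\<^sub>R f x + b *\<^sub>R g x) \<in> Ned \<Omega> \<T> k" by (intro Ned_lincomb Ned0_Ned assms)
  fix K F x n assume K: "K \<in> \<T>" and F: "F \<in> facets K" "F \<subseteq> frontier \<Omega>" "x \<in> F" and n: "outer_normal K x n"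
  have x: "x \<in> K" using facet_in_cell[OF K F(1,3)] .
  obtain p where p: "p \<in> VPoly (Suc k)" "\<And>x. x \<in> interior K \<Longrightarrow> f x = p x" using Ned_VPoly_E[OF Ned0_Ned[OF assms(1)] K] by metis
  obtain q where q: "q \<in> VPoly (Suc k)" "\<And>x. x \<in> interior K \<Longrightarrow> g x = q x" using Ned_VPoly_E[OF Ned0_Ned[OF assms(2)] K] by metis
  have "cross3 n (p x) = 0" "cross3 n (q x) = 0"
    using trace_cell[OF K x VPoly_continuous[OF p(1)] p(2)] trace_cell[OF K x VPoly_continuous[OF q(1)] q(2)]
      Ned0_trace[OF assms(1) K F n] Ned0_trace[OF assms(2) K F n] by simp_all
  moreover have "trace (interior K) (\<lambda>x. a *\<^sub>R f x + b *\<^sub>R g x) x = a *\<^sub>R p x + b *\<^sub>R q x"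
    by (intro trace_cell[OF K x] continuous_intros VPoly_continuous[OF p(1)] VPoly_continuous[OF q(1)]) (simp add: p q)
  ultimately show "cross3 n (trace (interior K) (\<lambda>x. a *\<^sub>R f x + b *\<^sub>R g x) x) = 0"
    by (simp add: cross_add_right cross_mult_right)
qed

lemma RT0_lincomb:
  assumes "f \<in> RT0 \<Omega> \<T> k" "g \<in> RT0 \<Omega> \<T> k"
  shows "(\<lambda>x. a *\<^sub>R f x + b *\<^sub>R g x) \<in> RT0 \<Omega> \<T> k"
  unfolding RT0_def
proof (intro CollectI conjI ballI impI allI)
  show "(\<lambda>x. a *\<^sub>R f x + b *\<^sub>R g x) \<in> RT \<Omega> \<T> k" by (intro RT_lincomb RT0_RT assms)
  fix K F x n assume K: "K \<in> \<T>" and F: "F \<in> facets K" "F \<subseteq> frontier \<Omega>" "x \<in> F" and n: "outer_normal K x n"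
  have x: "x \<in> K" using facet_in_cell[OF K F(1,3)] .
  obtain p where p: "p \<in> VPoly (Suc k)" "\<And>x. x \<in> interior K \<Longrightarrow> f x = p x" using RT_VPoly_E[OF RT0_RT[OF assms(1)] K] by metis
  obtain q where q: "q \<in> VPoly (Suc k)" "\<And>x. x \<in> interior K \<Longrightarrow> g x = q x" using RT_VPoly_E[OF RT0_RT[OF assms(2)] K] by metis
  have "n \<bullet> p x = 0" "n \<bullet> q x = 0"
    using trace_cell[OF K x VPoly_continuous[OF p(1)] p(2)] trace_cell[OF K x VPoly_continuous[OF q(1)] q(2)]
      RT0_trace[OF assms(1) K F n] RT0_trace[OF assms(2) K F n] by simp_all
  moreover have "trace (interior K) (\<lambda>x. a *\<^sub>R f x + b *\<^sub>R g x) x = a *\<^sub>R p x + b *\<^sub>R q x"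
    by (intro trace_cell[OF K x] continuous_intros VPoly_continuous[OF p(1)] VPoly_continuous[OF q(1)]) (simp add: p q)
  ultimately show "n \<bullet> trace (interior K) (\<lambda>x. a *\<^sub>R f x + b *\<^sub>R g x) x = 0"
    by (simp add: inner_add_right)
qed

text \<open>The polynomial representative of the weak gradient is simply the classical gradient of \<open>f\<close>, which
  in a cell interior is the one of the polynomial that \<open>f\<close> is there.\<close>
lemma grad_ae:
  assumes f: "f \<in> Q \<Omega> \<T> k"
  shows "negligible {x\<in>\<Omega>. grad \<Omega> f x \<noteq> classical_grad f x}"
proof (rule negligible_cells)
  fix K assume K: "K \<in> \<T>"
  obtain p where p: "p \<in> Poly k" "\<And>x. x \<in> interior K \<Longrightarrow> f x = p x" using Q_E[OF f K] by metis
  have "negligible {x\<in>interior K. grad \<Omega> f x \<noteq> classical_grad p x}"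
    by (rule has_weak_grad_local[OF Q_L2[OF f] has_weak_grad_grad[OF Q_H1[OF f]] _ cell_interior[OF K] p]) simp
  then show "negligible {x\<in>interior K. grad \<Omega> f x \<noteq> classical_grad f x}"
    by (rule negligible_subset) (auto simp: classical_grad_local[OF open_interior _ p(2,1)])
qed

lemma curl_ae:
  assumes f: "f \<in> Ned \<Omega> \<T> k"
  shows "negligible {x\<in>\<Omega>. curl \<Omega> f x \<noteq> classical_curl f x}"
proof (rule negligible_cells)
  fix K assume K: "K \<in> \<T>"
  obtain p where p: "p \<in> VPoly (Suc k)" "\<And>x. x \<in> interior K \<Longrightarrow> f x = p x" using Ned_VPoly_E[OF f K] by metis
  have "f \<in> Hcurl \<Omega>" using f by (simp add: Ned_def)
  then have "negligible {x\<in>interior K. curl \<Omega> f x \<noteq> classical_curl p x}"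
    by (intro has_weak_curl_local[OF has_weak_curl_curl _ cell_interior[OF K] p]) simp_all
  then show "negligible {x\<in>interior K. curl \<Omega> f x \<noteq> classical_curl f x}"
    by (rule negligible_subset) (auto simp: classical_curl_local[OF open_interior _ p(2,1)])
qed

lemma classical_grad_L2_Q:
  assumes "f \<in> Q \<Omega> \<T> k"
  shows "classical_grad f \<in> L2 \<Omega>"
  by (rule L2_spike[OF sets_domain has_weak_grad_D(1)[OF Q_L2[OF assms] has_weak_grad_grad[OF Q_H1[OF assms]]] grad_ae[OF assms]]) auto

lemma grad_L2: "f \<in> Q \<Omega> \<T> k \<Longrightarrow> grad \<Omega> f \<in> L2 \<Omega>"
  using has_weak_grad_D(1)[OF Q_L2 has_weak_grad_grad[OF Q_H1]] .

lemma negligible_neq_sym: "negligible {x\<in>\<Omega>. f x \<noteq> g x} \<Longrightarrow> negligible {x\<in>\<Omega>. g x \<noteq> f x}"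
  by (erule negligible_subset) auto

lemma has_weak_curl_classical_grad:
  assumes f: "f \<in> Q \<Omega> \<T> k"
  shows "has_weak_curl \<Omega> (classical_grad f) (\<lambda>x. 0)"
  by (rule has_weak_curl_spike[OF has_weak_curl_grad[OF Q_L2[OF f] has_weak_grad_grad[OF Q_H1[OF f]]]])
     (use grad_ae[OF f, THEN negligible_neq_sym] in simp_all)

text \<open>The tangential trace vanishes because \<open>f\<close> vanishes on the flat disc around a boundary point of the
  facet, so that only the normal component of its gradient is left.\<close>
lemma classical_grad_Ned0:
  assumes f: "f \<in> Q0 \<Omega> \<T> (Suc k)"
  shows "classical_grad f \<in> Ned0 \<Omega> \<T> k"
  unfolding Ned0_def Ned_def
proof (intro CollectI conjI ballI impI allI)
  note fQ = Q0_Q[OF f]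
  show "classical_grad f \<in> Hcurl \<Omega>"
    using classical_grad_L2_Q[OF fQ] has_weak_curl_classical_grad[OF fQ] by (auto simp: Hcurl_def)
  fix K assume K: "K \<in> \<T>"
  obtain p where p: "p \<in> Poly (Suc k)" "\<And>x. x \<in> interior K \<Longrightarrow> f x = p x" using Q_E[OF fQ K] by metis
  note loc = classical_grad_local[OF open_interior _ p(2,1)]
  have gV: "classical_grad p \<in> VPoly k" by (rule classical_grad_VPoly[OF p(1)])
  show "\<exists>p\<in>VPoly k. \<exists>q\<in>VPoly k. \<forall>x\<in>interior K. classical_grad f x = p x + cross3 x (q x)"
    by (rule bexI[OF bexI[OF _ VPoly_0] gV]) (simp add: loc)
  fix F x n assume F: "F \<in> facets K" "F \<subseteq> frontier \<Omega>" "x \<in> F" and n: "outer_normal K x n"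
  have x: "x \<in> K" using facet_in_cell[OF K F(1,3)] .
  obtain r where r: "r > 0" "\<And>y. y \<in> ball x r \<Longrightarrow> n \<bullet> (y - x) = 0 \<Longrightarrow> y \<in> F \<and> outer_normal K y n"
    using facet_contains_disc[OF F(1,3) n] by metis
  have n1: "norm n = 1" using n by (simp add: outer_normal_def)
  have "trace (interior K) (classical_grad f) x = classical_grad p x"
    by (rule trace_cell[OF K x VPoly_continuous[OF gV]]) (simp add: loc)
  moreover have "cross3 n (classical_grad p x) = 0"
  proof (rule cross_grad_0[OF Poly_differentiable[OF p(1)] r(1) n1])
    fix y assume "y \<in> ball x r" "n \<bullet> (y - x) = 0"
    then have "y \<in> F" using r(2) by simp
    then have y: "y \<in> K" "y \<in> frontier \<Omega>" using facet_in_cell[OF K F(1)] F(2) by auto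
    show "p y = 0"
      using trace_cell[OF K y(1) Poly_continuous[OF p(1)] p(2)] Q0_trace[OF f K y] by simp
  qed
  ultimately show "cross3 n (trace (interior K) (classical_grad f) x) = 0" by simp
qed

lemma curl_classical_grad_ae:
  assumes f: "f \<in> Q0 \<Omega> \<T> (Suc k)"
  shows "negligible {x\<in>\<Omega>. curl \<Omega> (classical_grad f) x \<noteq> 0}"
  using has_weak_curl_unique[OF has_weak_curl_curl has_weak_curl_classical_grad[OF Q0_Q[OF f]]] classical_grad_Ned0[OF f]
  by (simp add: Ned0_def Ned_def)

text \<open>The normal component of the curl only involves tangential derivatives of the tangential components,
  which vanish on boundary facets.\<close>
lemma classical_curl_RT0:
  assumes f: "f \<in> Ned0 \<Omega> \<T> k"
  shows "classical_curl f \<in> RT0 \<Omega> \<T> k"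
  unfolding RT0_def RT_def
proof (intro CollectI conjI ballI impI allI)
  note fN = Ned0_Ned[OF f]
  have fc: "has_weak_curl \<Omega> f (curl \<Omega> f)"
    using fN by (intro has_weak_curl_curl) (simp add: Ned_def)
  have "has_weak_curl \<Omega> f (classical_curl f)"
    by (rule has_weak_curl_spike[OF fc _ negligible_neq_sym[OF curl_ae[OF fN]]]) simp
  then show "classical_curl f \<in> Hdiv \<Omega>"
    using has_weak_curl_orthogonal_grad[of f "classical_curl f"]
    by (auto simp: Hdiv_def has_weak_div_def has_weak_curl_def L2_0 intro!: exI[of _ "\<lambda>x. 0"])
  fix K assume K: "K \<in> \<T>"
  obtain p q where p: "p \<in> VPoly k" "q \<in> VPoly k" "\<And>x. x \<in> interior K \<Longrightarrow> f x = p x + cross3 x (q x)" using Ned_E[OF fN K] by metis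
  define P where "P x = p x + cross3 x (q x)" for x
  have P: "P \<in> VPoly (Suc k)" unfolding P_def[abs_def] by (rule nedelec_VPoly[OF p(1,2)])
  have fP: "f x = P x" if "x \<in> interior K" for x using p(3)[OF that] by (simp add: P_def)
  note loc = classical_curl_local[OF open_interior _ fP P]
  obtain p' q' where pq': "p' \<in> VPoly k" "q' \<in> Poly k" "\<And>x. classical_curl P x = p' x + q' x *\<^sub>R x"
    using curl_nedelec[OF p(1,2)] unfolding P_def[abs_def] by metis
  show "\<exists>p\<in>VPoly k. \<exists>q\<in>Poly k. \<forall>x\<in>interior K. classical_curl f x = p x + q x *\<^sub>R x"
    by (rule bexI[OF bexI[OF _ pq'(2)] pq'(1)]) (simp add: loc pq'(3))
  fix F x n assume F: "F \<in> facets K" "F \<subseteq> frontier \<Omega>" "x \<in> F" and n: "outer_normal K x n"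
  have x: "x \<in> K" using facet_in_cell[OF K F(1,3)] .
  obtain r where r: "r > 0" "\<And>y. y \<in> ball x r \<Longrightarrow> n \<bullet> (y - x) = 0 \<Longrightarrow> y \<in> F \<and> outer_normal K y n"
    using facet_contains_disc[OF F(1,3) n] by metis
  have n1: "norm n = 1" using n by (simp add: outer_normal_def)
  have "trace (interior K) (classical_curl f) x = classical_curl P x"
    by (rule trace_cell[OF K x VPoly_continuous[OF classical_curl_VPoly[OF P]]]) (simp add: loc)
  moreover have "n \<bullet> classical_curl P x = 0"
  proof (rule normal_curl_0[OF Poly_differentiable[OF VPoly_nth[OF P]] r(1) n1])
    fix y assume y: "y \<in> ball x r" "n \<bullet> (y - x) = 0"
    have yF: "y \<in> F" "outer_normal K y n" using r(2)[OF y] by auto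
    have "cross3 n (trace (interior K) f y) = 0"
      by (rule Ned0_trace[OF f K F(1,2) yF])
    then show "cross3 n (P y) = 0"
      using trace_cell[OF K facet_in_cell[OF K F(1) yF(1)] VPoly_continuous[OF P] fP] by simp
  qed
  ultimately show "n \<bullet> trace (interior K) (classical_curl f) x = 0" by simp
qed

end

section \<open>Continuity across cells\<close>

lemma integrable_continuous_compact_support:
  fixes f :: "vec3 \<Rightarrow> real"
  assumes "continuous_on (cbox a b) f" "\<And>x. x \<notin> cbox a b \<Longrightarrow> f x = 0" "cbox a b \<subseteq> \<Omega>"
  shows "integral \<Omega> f = integral (cbox a b) f"
proof (rule integral_spike_set)
  have "{x \<in> \<Omega> - cbox a b. f x \<noteq> 0} = {}" "{x \<in> cbox a b - \<Omega>. f x \<noteq> 0} = {}"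
    using assms(2,3) by auto
  then show "negligible {x \<in> \<Omega> - cbox a b. f x \<noteq> 0}" "negligible {x \<in> cbox a b - \<Omega>. f x \<noteq> 0}"
    by (simp_all only: negligible_empty)
qed

lemma bump_0_outside: "x \<notin> cbox a b \<Longrightarrow> bump \<epsilon> a b x = 0"
  using box_subset_cbox[of a b] by (auto simp: bump_eq_0_iff)

lemma continuous_bump: "\<epsilon> > 0 \<Longrightarrow> continuous_on S (bump \<epsilon> a b)"
  by (rule C_diff_continuous[of 0, OF C_diff_bump])

lemma integral_bump_translate:
  assumes "\<epsilon> > 0"
  shows "integral (cbox (a + v) (b + v)) (bump \<epsilon> (a + v) (b + v)) = integral (cbox a b) (bump \<epsilon> a b)"
proof -
  have "(bump \<epsilon> a b has_integral integral (cbox a b) (bump \<epsilon> a b)) (cbox a b)"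
    by (intro integrable_integral integrable_continuous continuous_bump assms)
  from has_integral_affinity[OF this, of 1 "- v"]
  have "((\<lambda>x. bump \<epsilon> a b (x - v)) has_integral integral (cbox a b) (bump \<epsilon> a b)) ((\<lambda>x. x + v) ` cbox a b)"
    by simp
  moreover have "(\<lambda>x. x + v) ` cbox a b = cbox (a + v) (b + v)"
    using cbox_translation[of v a b] by (simp add: add.commute)
  moreover have "(\<lambda>x. bump \<epsilon> a b (x - v)) = bump \<epsilon> (a + v) (b + v)"
    using bump_translate[of \<epsilon> a v b] by (auto simp: fun_eq_iff) (metis diff_add_cancel)
  ultimately show ?thesis by (simp add: integral_unique)
qed

lemma integral_bump_pos:
  assumes "\<epsilon> > 0" "box a b \<noteq> {}"
  shows "integral (cbox a b) (bump \<epsilon> a b) > 0"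
proof -
  have "integral (cbox a b) (bump \<epsilon> a b) \<ge> 0"
    by (intro Henstock_Kurzweil_Integration.integral_nonneg integrable_continuous continuous_bump bump_bounds assms)
  moreover have "integral (cbox a b) (bump \<epsilon> a b) \<noteq> 0"
  proof
    assume "integral (cbox a b) (bump \<epsilon> a b) = 0"
    then have "\<forall>x\<in>cbox a b. bump \<epsilon> a b x = 0"
      using integral_cbox_eq_0_iff[OF continuous_bump[OF assms(1)] assms(2) bump_bounds(1)[OF assms(1)]] by simp
    moreover obtain y where "y \<in> box a b" using assms(2) by blast
    ultimately show False using box_subset_cbox[of a b] by (auto simp: bump_eq_0_iff)
  qed
  ultimately show ?thesis by simp
qed

context bounded_open begin

text \<open>Moving the bump along \<open>e\<^sub>i\<close>, the derivative of the average of \<open>f\<close> is the average of its weak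
  partial derivative, hence bounded by \<open>C\<close> times the mass of the bump.\<close>
lemma integral_bump_diff_along_axis:
  assumes f: "f \<in> L2 \<Omega>" "has_weak_grad \<Omega> f g" and C: "negligible {x\<in>\<Omega>. \<not> \<bar>g x $ i\<bar> \<le> C}" "C \<ge> 0"
    and \<epsilon>: "\<epsilon> > 0" and sub: "\<And>s. s \<in> closed_segment 0 h \<Longrightarrow> cbox (a + s *\<^sub>R axis i 1) (b + s *\<^sub>R axis i 1) \<subseteq> \<Omega>"
  shows "\<bar>integral \<Omega> (\<lambda>x. f x * bump \<epsilon> (a + h *\<^sub>R axis i 1) (b + h *\<^sub>R axis i 1) x) - integral \<Omega> (\<lambda>x. f x * bump \<epsilon> a b x)\<bar>
    \<le> C * integral (cbox a b) (bump \<epsilon> a b) * \<bar>h\<bar>"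
proof -
  let ?e = "axis i 1 :: vec3" and ?u = "bump \<epsilon> a b"
  let ?\<beta> = "\<lambda>s. bump \<epsilon> (a + s *\<^sub>R ?e) (b + s *\<^sub>R ?e)"
  have \<beta>: "?\<beta> s x = ?u (x + (- s) *\<^sub>R ?e)" for s x
    using bump_translate[of \<epsilon> a "s *\<^sub>R ?e" b "x - s *\<^sub>R ?e"] by simp
  have du: "?u differentiable (at x)" for x
    using C_diff_bump[OF \<epsilon>, of "Suc 0" a b] by simp
  have cu: "continuous_on UNIV (partial i ?u)"
    using C_diff_bump[OF \<epsilon>, of "Suc 0" a b] by simp
  obtain B where B: "\<And>x. \<bar>?u x\<bar> \<le> B"
    using compact_support_bounded[OF continuous_bump[OF \<epsilon>] compact_cbox bump_0_outside] by metis
  have p0: "partial i ?u x = 0" if "x \<notin> cbox a b" for x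
    by (rule partial_eq_0_outside[OF closed_cbox bump_0_outside that])
  obtain M where M: "\<And>x. \<bar>partial i ?u x\<bar> \<le> M"
    using compact_support_bounded[OF cu compact_cbox p0] by metis
  define F where "F t = integral \<Omega> (\<lambda>x. f x * ?u (x + t *\<^sub>R ?e))" for t
  define F' where "F' t = integral \<Omega> (\<lambda>x. f x * partial i ?u (x + t *\<^sub>R ?e))" for t
  have dF: "(F has_real_derivative F' t) (at t)" for t
    unfolding F_def[abs_def] F'_def
    by (rule has_real_derivative_integral_shift[OF sets_domain L2_absolutely_integrable[OF lmeasurable_domain f(1)] du B M])
  have dG: "((\<lambda>s. F (- s)) has_real_derivative - F' (- s)) (at s)" for s
  proof -
    have "((\<lambda>s::real. - s) has_real_derivative - 1) (at s)" by (auto intro!: derivative_eq_intros)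
    from DERIV_chain2[OF dF this] show ?thesis by simp
  qed
  have bound: "norm (- F' (- s)) \<le> C * integral (cbox a b) ?u" if s: "s \<in> closed_segment 0 h" for s
  proof -
    have t: "test_fun \<Omega> (?\<beta> s)" by (rule test_fun_bump[OF \<epsilon> sub[OF s]])
    have p\<beta>: "partial i (?\<beta> s) x = partial i ?u (x + (- s) *\<^sub>R ?e)" for x
    proof -
      have "((\<lambda>x. x + (- s) *\<^sub>R ?e) has_derivative (\<lambda>v. v)) (at x)" by (auto intro!: derivative_eq_intros)
      from has_derivative_compose[OF this has_derivative_partial[OF du]]
      have "(?\<beta> s has_derivative (\<lambda>v. \<Sum>j\<in>UNIV. v $ j * partial j ?u (x + (- s) *\<^sub>R ?e))) (at x)"
        unfolding \<beta>[abs_def] .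
      then show ?thesis by (simp add: partial_eq sum_axis_mult)
    qed
    have "- F' (- s) = integral \<Omega> (\<lambda>x. ?\<beta> s x * g x $ i)"
      unfolding has_weak_grad_D(2)[OF f t] F'_def p\<beta> ..
    also have "norm \<dots> \<le> integral \<Omega> (\<lambda>x. C * ?\<beta> s x)"
    proof -
      have eq: "integral \<Omega> (\<lambda>x. ?\<beta> s x * g x $ i) = integral \<Omega> (\<lambda>x. if \<bar>g x $ i\<bar> \<le> C then ?\<beta> s x * g x $ i else 0)"
        by (rule integral_spike_on, rule negligible_subset[OF C(1)]) auto
      have "(\<lambda>x. ?\<beta> s x * g x $ i) integrable_on \<Omega>"
        by (intro integrable_mult_L2 test_L2[OF t] L2_nth[OF sets_domain] has_weak_grad_D(1)[OF f])
      then have 1: "(\<lambda>x. if \<bar>g x $ i\<bar> \<le> C then ?\<beta> s x * g x $ i else 0) integrable_on \<Omega>"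
        by (rule integrable_spike[OF _ C(1)]) auto
      have "(\<lambda>x. C * ?\<beta> s x) integrable_on \<Omega>"
        by (intro integrable_on_mult_right set_lebesgue_integral_eq_integral(1) L2_absolutely_integrable[OF lmeasurable_domain] test_L2[OF t])
      then show ?thesis unfolding eq
      proof (rule integral_norm_bound_integral[OF 1])
        fix x assume "x \<in> \<Omega>"
        show "norm (if \<bar>g x $ i\<bar> \<le> C then ?\<beta> s x * g x $ i else 0) \<le> C * ?\<beta> s x"
          using bump_bounds(1)[OF \<epsilon>, of "a + s *\<^sub>R ?e" "b + s *\<^sub>R ?e" x] C(2)
          by (auto simp: abs_mult mult.commute[of C] intro: mult_left_mono)
      qed
    qed
    also have "\<dots> = C * integral (cbox a b) ?u"
      using integrable_continuous_compact_support[OF continuous_bump[OF \<epsilon>] bump_0_outside sub[OF s]]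
        integral_bump_translate[OF \<epsilon>] by simp
    finally show ?thesis .
  qed
  have "norm (F (- h) - F (- 0)) \<le> (C * integral (cbox a b) ?u) * norm (h - 0)"
    by (rule field_differentiable_bound[OF convex_closed_segment[of 0 h] DERIV_subset[OF dG subset_UNIV] bound]) auto
  moreover have "F (- h) = integral \<Omega> (\<lambda>x. f x * ?\<beta> h x)" "F (- 0) = integral \<Omega> (\<lambda>x. f x * ?u x)"
    unfolding F_def \<beta> by simp_all
  ultimately show ?thesis by simp
qed

text \<open>The displacement \<open>v\<close> is made of three moves along the axes; the boxes in between stay in the convex
  box \<open>cbox l u\<close>, even if they leave the cells under consideration.\<close>
lemma integral_bump_diff:
  assumes f: "f \<in> L2 \<Omega>" "has_weak_grad \<Omega> f g" and C: "\<And>i. negligible {x\<in>\<Omega>. \<not> \<bar>g x $ i\<bar> \<le> C}" "C \<ge> 0"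
    and \<epsilon>: "\<epsilon> > 0" and R: "cbox l u \<subseteq> \<Omega>"
    and ab: "\<And>i. l $ i \<le> a $ i" "\<And>i. b $ i \<le> u $ i" "\<And>i. l $ i \<le> (a + v) $ i" "\<And>i. (b + v) $ i \<le> u $ i"
  shows "\<bar>integral \<Omega> (\<lambda>x. f x * bump \<epsilon> (a + v) (b + v) x) - integral \<Omega> (\<lambda>x. f x * bump \<epsilon> a b x)\<bar>
    \<le> C * integral (cbox a b) (bump \<epsilon> a b) * (\<bar>v $ 1\<bar> + \<bar>v $ 2\<bar> + \<bar>v $ 3\<bar>)"
proof -
  let ?I = "\<lambda>w. integral \<Omega> (\<lambda>x. f x * bump \<epsilon> (a + w) (b + w) x)"
  let ?m = "integral (cbox a b) (bump \<epsilon> a b)"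
  have step: "\<bar>?I (w + h *\<^sub>R axis i 1) - ?I w\<bar> \<le> C * ?m * \<bar>h\<bar>"
    if w: "\<And>j s. s \<in> closed_segment 0 h \<Longrightarrow> l $ j \<le> (a + w + s *\<^sub>R axis i 1) $ j \<and> (b + w + s *\<^sub>R axis i 1) $ j \<le> u $ j" for w i h
  proof -
    have "\<bar>integral \<Omega> (\<lambda>x. f x * bump \<epsilon> (a + w + h *\<^sub>R axis i 1) (b + w + h *\<^sub>R axis i 1) x) - ?I w\<bar>
      \<le> C * integral (cbox (a + w) (b + w)) (bump \<epsilon> (a + w) (b + w)) * \<bar>h\<bar>"
    proof (rule integral_bump_diff_along_axis[OF f C \<epsilon>])
      fix s assume s: "s \<in> closed_segment 0 h"
      have "cbox (a + w + s *\<^sub>R axis i 1) (b + w + s *\<^sub>R axis i 1) \<subseteq> cbox l u"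
      proof
        fix z assume z: "z \<in> cbox (a + w + s *\<^sub>R axis i 1) (b + w + s *\<^sub>R axis i 1)"
        show "z \<in> cbox l u" unfolding mem_box_cart
        proof
          fix j show "l $ j \<le> z $ j \<and> z $ j \<le> u $ j"
            using w[OF s, of j] z[unfolded mem_box_cart, rule_format, of j] by linarith
        qed
      qed
      then show "cbox (a + w + s *\<^sub>R axis i 1) (b + w + s *\<^sub>R axis i 1) \<subseteq> \<Omega>" using R by (rule order_trans)
    qed
    then show ?thesis by (simp only: integral_bump_translate[OF \<epsilon>] add.assoc)
  qed
  have ax: "(s *\<^sub>R axis i 1 :: vec3) $ j = (if i = j then s else 0)" for s i j by (simp add: axis_def)
  have sg: "(0 \<le> s \<and> s \<le> h) \<or> (h \<le> s \<and> s \<le> 0)" if "s \<in> closed_segment 0 h" for s h :: real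
    using that by (auto simp: closed_segment_eq_real_ivl split: if_splits)
  have f3: "(\<forall>j::3. P j) \<Longrightarrow> P j" for P and j :: 3 by simp
  let ?w1 = "0 + v $ 1 *\<^sub>R axis 1 1 :: vec3"
  let ?w2 = "?w1 + v $ 2 *\<^sub>R axis 2 1 :: vec3"
  let ?w3 = "?w2 + v $ 3 *\<^sub>R axis 3 1 :: vec3"
  have 1: "\<bar>?I ?w1 - ?I 0\<bar> \<le> C * ?m * \<bar>v $ 1\<bar>"
    by (rule step, rule f3, unfold forall_3 vector_add_component ax)
       (drule sg, use ab(1)[of 1] ab(1)[of 2] ab(1)[of 3] ab(2)[of 1] ab(2)[of 2] ab(2)[of 3]
         ab(3)[of 1] ab(3)[of 2] ab(3)[of 3] ab(4)[of 1] ab(4)[of 2] ab(4)[of 3] in auto)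
  have 2: "\<bar>?I ?w2 - ?I ?w1\<bar> \<le> C * ?m * \<bar>v $ 2\<bar>"
    by (rule step, rule f3, unfold forall_3 vector_add_component ax)
       (drule sg, use ab(1)[of 1] ab(1)[of 2] ab(1)[of 3] ab(2)[of 1] ab(2)[of 2] ab(2)[of 3]
         ab(3)[of 1] ab(3)[of 2] ab(3)[of 3] ab(4)[of 1] ab(4)[of 2] ab(4)[of 3] in auto)
  have 3: "\<bar>?I ?w3 - ?I ?w2\<bar> \<le> C * ?m * \<bar>v $ 3\<bar>"
    by (rule step, rule f3, unfold forall_3 vector_add_component ax)
       (drule sg, use ab(1)[of 1] ab(1)[of 2] ab(1)[of 3] ab(2)[of 1] ab(2)[of 2] ab(2)[of 3]
         ab(3)[of 1] ab(3)[of 2] ab(3)[of 3] ab(4)[of 1] ab(4)[of 2] ab(4)[of 3] in auto)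
  have w3: "?w3 = v" by (simp add: vec_eq_iff forall_3 axis_def)
  have "\<bar>?I v - ?I 0\<bar> \<le> C * ?m * \<bar>v $ 1\<bar> + C * ?m * \<bar>v $ 2\<bar> + C * ?m * \<bar>v $ 3\<bar>"
    using 1 2 3 unfolding w3 by linarith
  then show ?thesis by (simp add: distrib_left)
qed

end

lemma open_contains_cube:
  fixes y :: vec3
  assumes "open U" "y \<in> U"
  shows "\<exists>\<eta>>0. \<forall>\<eta>'\<le>\<eta>. cbox (y - (\<chi> i. \<eta>')) (y + (\<chi> i. \<eta>')) \<subseteq> U"
proof -
  obtain e where e: "e > 0" "ball y e \<subseteq> U" using assms open_contains_ball by blast
  show ?thesis
  proof (intro exI[of _ "e / 4"] conjI allI impI)
    show "e / 4 > 0" using e by simp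
    fix \<eta>' assume \<eta>': "\<eta>' \<le> e / 4"
    show "cbox (y - (\<chi> i. \<eta>')) (y + (\<chi> i. \<eta>')) \<subseteq> U"
    proof
      fix z assume z: "z \<in> cbox (y - (\<chi> i. \<eta>')) (y + (\<chi> i. \<eta>'))"
      have "\<bar>(z - y) $ i\<bar> \<le> \<eta>'" for i
        using z[unfolded mem_box_cart, rule_format, of i] by auto
      then have "norm (z - y) \<le> 3 * \<eta>'"
        using norm_le_l1_cart[of "z - y"] sum_mono[of UNIV "\<lambda>i. \<bar>(z - y) $ i\<bar>" "\<lambda>_. \<eta>'"] by simp
      then have "dist y z < e" using \<eta>' e(1) by (simp add: dist_norm norm_minus_commute)
      then show "z \<in> U" using e(2) by auto
    qed
  qed
qed

context mesh begin

lemma Q_grad_bounded: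
  assumes f: "f \<in> Q \<Omega> \<T> k"
  shows "\<exists>C\<ge>0. \<forall>i. negligible {x\<in>\<Omega>. \<not> \<bar>grad \<Omega> f x $ i\<bar> \<le> C}"
proof -
  have "\<exists>C. \<forall>x\<in>interior K. \<forall>i. \<bar>classical_grad f x $ i\<bar> \<le> C" if K: "K \<in> \<T>" for K
  proof -
    obtain p where p: "p \<in> Poly k" "\<And>x. x \<in> interior K \<Longrightarrow> f x = p x" using Q_E[OF f K] by metis
    have gV: "classical_grad p \<in> VPoly (k - 1)"
      using Poly_partial[OF p(1)] by (simp add: VPoly_def classical_grad_def)
    have "compact (classical_grad p ` K)"
      by (rule compact_continuous_image[OF VPoly_continuous[OF gV] polyhedral_cell_closed(4)[OF mesh_cell[OF K]]])
    then obtain C where C: "\<forall>y\<in>classical_grad p ` K. norm y \<le> C"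
      using compact_imp_bounded bounded_iff by metis
    have "\<bar>classical_grad f x $ i\<bar> \<le> C" if x: "x \<in> interior K" for x i
    proof -
      have "norm (classical_grad p x) \<le> C" using C x interior_subset by blast
      then show ?thesis
        using component_le_norm_cart[of "classical_grad p x" i] classical_grad_local[OF open_interior x p(2,1)] by simp
    qed
    then show ?thesis by blast
  qed
  then obtain C where C: "\<And>K x i. K \<in> \<T> \<Longrightarrow> x \<in> interior K \<Longrightarrow> \<bar>classical_grad f x $ i\<bar> \<le> C K" by metis
  define D where "D = (\<Sum>K\<in>\<T>. \<bar>C K\<bar>)"
  have D: "\<bar>classical_grad f x $ i\<bar> \<le> D" if "K \<in> \<T>" "x \<in> interior K" for K x i
  proof -
    have "\<bar>C K\<bar> \<le> D" unfolding D_def using that(1) finite_mesh by (intro member_le_sum) auto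
    then show ?thesis using C[OF that, of i] by linarith
  qed
  show ?thesis
  proof (intro exI[of _ D] conjI allI)
    show "D \<ge> 0" by (simp add: D_def sum_nonneg)
    fix i
    have "negligible {x\<in>\<Omega>. \<not> \<bar>classical_grad f x $ i\<bar> \<le> D}"
    proof (rule negligible_cells)
      fix K assume "K \<in> \<T>"
      then have "{x \<in> interior K. \<not> \<bar>classical_grad f x $ i\<bar> \<le> D} = {}" using D by auto
      then show "negligible {x \<in> interior K. \<not> \<bar>classical_grad f x $ i\<bar> \<le> D}" by (simp only: negligible_empty)
    qed
    from negligible_Un[OF this grad_ae[OF f]]
    show "negligible {x\<in>\<Omega>. \<not> \<bar>grad \<Omega> f x $ i\<bar> \<le> D}" by (rule negligible_subset) auto
  qed
qed

text \<open>If \<open>p x > q x\<close>, then in a small cube around \<open>x\<close> the averages of \<open>f\<close> over small cubes of equal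
  size, one inside each cell, differ by at least \<open>d / 2\<close> where \<open>d = p x - q x\<close>, while \<open>integral_bump_diff\<close> bounds
  their difference by a multiple of the size \<open>r\<close> of the cube around \<open>x\<close>.\<close>
lemma Q_le_across_cells:
  assumes f: "f \<in> Q \<Omega> \<T> k" and x: "x \<in> \<Omega>" "x \<in> K" "x \<in> K'" and K: "K \<in> \<T>" "K' \<in> \<T>"
    and p: "p \<in> Poly k" "\<And>y. y \<in> interior K \<Longrightarrow> f y = p y"
    and q: "q \<in> Poly k" "\<And>y. y \<in> interior K' \<Longrightarrow> f y = q y"
  shows "p x \<le> q x"
proof (rule ccontr)
  assume "\<not> p x \<le> q x"
  define d where "d = p x - q x"
  have d: "d > 0" using \<open>\<not> p x \<le> q x\<close> by (simp add: d_def)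
  obtain C where C0: "C \<ge> 0" "\<forall>i. negligible {x\<in>\<Omega>. \<not> \<bar>grad \<Omega> f x $ i\<bar> \<le> C}"
    using Q_grad_bounded[OF f] by (elim exE conjE)
  note C = C0(1) C0(2)[THEN spec]
  have "open {y. p x - d / 4 < p y}" "open {y. q y < q x + d / 4}"
    by (intro open_Collect_less continuous_intros Poly_continuous[OF p(1)] Poly_continuous[OF q(1)])+
  then have op: "open (\<Omega> \<inter> {y. p x - d / 4 < p y} \<inter> {y. q y < q x + d / 4})" by (intro open_Int open_domain)
  have xin: "x \<in> \<Omega> \<inter> {y. p x - d / 4 < p y} \<inter> {y. q y < q x + d / 4}" using x(1) d by simp
  obtain \<eta>0 where \<eta>0: "\<eta>0 > 0" "\<forall>\<eta>'\<le>\<eta>0. cbox (x - (\<chi> i. \<eta>')) (x + (\<chi> i. \<eta>')) \<subseteq>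
      \<Omega> \<inter> {y. p x - d / 4 < p y} \<inter> {y. q y < q x + d / 4}"
    using open_contains_cube[OF op xin] by (elim exE conjE)
  \<comment> \<open>the displacement has components of size at most \<open>2 r\<close>, so the averages differ by at most \<open>6 C r \<le> d / 4\<close>\<close>
  define r where "r = min \<eta>0 (d / (24 * (C + 1)))"
  have r: "r > 0" using \<eta>0(1) d C(1) by (simp add: r_def)
  define l u where "l = x - (\<chi> i. r)" and "u = x + (\<chi> i. r)"
  have R: "cbox l u \<subseteq> \<Omega> \<inter> {y. p x - d / 4 < p y} \<inter> {y. q y < q x + d / 4}"
    unfolding l_def u_def by (rule \<eta>0(2)[rule_format]) (simp add: r_def)
  have xb: "x \<in> box l u" using r by (simp add: mem_box_cart l_def u_def)
  have cube: "\<exists>y \<eta>. \<eta> > 0 \<and> (\<forall>\<eta>'\<le>\<eta>. cbox (y - (\<chi> i. \<eta>')) (y + (\<chi> i. \<eta>')) \<subseteq> interior L \<inter> box l u)"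
    if "L \<in> \<T>" "x \<in> L" for L
  proof -
    have "x \<in> closure (interior L)" using that by (simp add: closure_interior_cell)
    then have "interior L \<inter> box l u \<noteq> {}" using open_Int_closure_eq_empty[OF open_box, of l u "interior L"] xb by auto
    then obtain y where y: "y \<in> interior L \<inter> box l u" by auto
    have "open (interior L \<inter> box l u)" by (intro open_Int open_box open_interior)
    from open_contains_cube[OF this y] show ?thesis by (rule exI)
  qed
  obtain y \<eta>1 where y: "\<eta>1 > 0" "\<forall>\<eta>'\<le>\<eta>1. cbox (y - (\<chi> i. \<eta>')) (y + (\<chi> i. \<eta>')) \<subseteq> interior K \<inter> box l u"
    using cube[OF K(1) x(2)] by (elim exE conjE)
  obtain z \<eta>2 where z: "\<eta>2 > 0" "\<forall>\<eta>'\<le>\<eta>2. cbox (z - (\<chi> i. \<eta>')) (z + (\<chi> i. \<eta>')) \<subseteq> interior K' \<inter> box l u"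
    using cube[OF K(2) x(3)] by (elim exE conjE)
  define \<eta> where "\<eta> = min \<eta>1 \<eta>2"
  have \<eta>: "\<eta> > 0" "\<eta> \<le> \<eta>1" "\<eta> \<le> \<eta>2" using y(1) z(1) by (auto simp: \<eta>_def)
  define a b v where "a = y - (\<chi> i. \<eta>)" and "b = y + (\<chi> i. \<eta>)" and "v = z - y"
  have av: "a + v = z - (\<chi> i. \<eta>)" "b + v = z + (\<chi> i. \<eta>)" by (simp_all add: a_def b_def v_def)
  have sub1: "cbox a b \<subseteq> interior K \<inter> box l u" unfolding a_def b_def by (rule y(2)[rule_format, OF \<eta>(2)])
  have sub2: "cbox (a + v) (b + v) \<subseteq> interior K' \<inter> box l u" unfolding av by (rule z(2)[rule_format, OF \<eta>(3)])
  have mem: "a \<in> cbox a b" "b \<in> cbox a b" "a + v \<in> cbox (a + v) (b + v)" "b + v \<in> cbox (a + v) (b + v)" "y \<in> cbox a b" "z \<in> cbox (a + v) (b + v)"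
    using \<eta>(1) by (simp_all add: mem_box_cart a_def b_def v_def)
  have inR: "a \<in> box l u" "b \<in> box l u" "a + v \<in> box l u" "b + v \<in> box l u" "y \<in> box l u" "z \<in> box l u"
    using mem sub1 sub2 by blast+
  have ab: "l $ i \<le> a $ i" "b $ i \<le> u $ i" "l $ i \<le> (a + v) $ i" "(b + v) $ i \<le> u $ i" for i
    using inR(1-4)[unfolded mem_box_cart, THEN spec, of i] by auto
  have vr: "\<bar>v $ i\<bar> \<le> 2 * r" for i
    using inR(5,6)[unfolded mem_box_cart, THEN spec, of i] by (auto simp: v_def l_def u_def)
  \<comment> \<open>the two bumps are translates of each other and have the same mass\<close>
  define m where "m = integral (cbox a b) (bump 1 a b)"
  have m: "m > 0" unfolding m_def
  proof (rule integral_bump_pos)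
    have "y \<in> box a b" using \<eta>(1) by (simp add: mem_box_cart a_def b_def)
    then show "box a b \<noteq> {}" by blast
  qed simp
  have m2: "integral (cbox (a + v) (b + v)) (bump 1 (a + v) (b + v)) = m" unfolding m_def by (rule integral_bump_translate) simp
  have RO: "cbox l u \<subseteq> \<Omega>" using R by blast
  have "\<bar>integral \<Omega> (\<lambda>x. f x * bump 1 (a + v) (b + v) x) - integral \<Omega> (\<lambda>x. f x * bump 1 a b x)\<bar>
    \<le> C * m * (\<bar>v $ 1\<bar> + \<bar>v $ 2\<bar> + \<bar>v $ 3\<bar>)"
    unfolding m_def
    by (rule integral_bump_diff[OF Q_L2[OF f] has_weak_grad_grad[OF Q_H1[OF f]] C(2,1) _ RO ab]) simp
  also have "\<dots> \<le> C * m * (6 * r)"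
    using vr[of 1] vr[of 2] vr[of 3] C(1) m by (intro mult_left_mono) auto
  finally have diff: "\<bar>integral \<Omega> (\<lambda>x. f x * bump 1 (a + v) (b + v) x) - integral \<Omega> (\<lambda>x. f x * bump 1 a b x)\<bar> \<le> m * (6 * C * r)"
    by (simp add: mult_ac)
  have int: "integral \<Omega> (\<lambda>x. f x * bump 1 a' b' x) = integral (cbox a' b') (\<lambda>x. s x * bump 1 a' b' x)"
    "(\<lambda>x. s x * bump 1 a' b' x) integrable_on cbox a' b'"
    if "cbox a' b' \<subseteq> interior L" "L \<in> \<T>" "s \<in> Poly k" "\<And>y. y \<in> interior L \<Longrightarrow> f y = s y" for a' b' L s
  proof -
    have c: "continuous_on S (\<lambda>x. s x * bump 1 a' b' x)" for S
      by (intro continuous_on_mult Poly_continuous[OF that(3)] continuous_bump) simp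
    have "(\<lambda>x. f x * bump 1 a' b' x) = (\<lambda>x. s x * bump 1 a' b' x)"
    proof
      fix w show "f w * bump 1 a' b' w = s w * bump 1 a' b' w"
        using that(1,4) bump_0_outside[of w a' b' 1] by (cases "w \<in> cbox a' b'") auto
    qed
    then show "integral \<Omega> (\<lambda>x. f x * bump 1 a' b' x) = integral (cbox a' b') (\<lambda>x. s x * bump 1 a' b' x)"
      using integrable_continuous_compact_support[OF c _ order_trans[OF that(1) cell_interior[OF that(2)]]] bump_0_outside by simp
    show "(\<lambda>x. s x * bump 1 a' b' x) integrable_on cbox a' b'" by (intro integrable_continuous c)
  qed
  have bi: "(\<lambda>x. t * bump 1 a' b' x) integrable_on cbox a' b'" for t a' b'
    by (intro integrable_continuous continuous_on_mult continuous_on_const continuous_bump) simp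
  have sK: "cbox a b \<subseteq> interior K" "cbox (a + v) (b + v) \<subseteq> interior K'" using sub1 sub2 by blast+
  have pq: "p x - d / 4 \<le> p w" "q w \<le> q x + d / 4" if "w \<in> cbox a b \<or> w \<in> cbox (a + v) (b + v)" for w
  proof -
    have "w \<in> cbox l u" using that sub1 sub2 box_subset_cbox by blast
    then show "p x - d / 4 \<le> p w" "q w \<le> q x + d / 4" using R by auto
  qed
  have "(p x - d / 4) * m = integral (cbox a b) (\<lambda>w. (p x - d / 4) * bump 1 a b w)"
    by (simp add: m_def)
  also have "\<dots> \<le> integral (cbox a b) (\<lambda>w. p w * bump 1 a b w)"
    by (rule integral_le[OF bi int(2)[OF sK(1) K(1) p]]) (auto intro!: mult_right_mono pq bump_bounds)
  also have "\<dots> = integral \<Omega> (\<lambda>x. f x * bump 1 a b x)" by (rule int(1)[OF sK(1) K(1) p, symmetric])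
  finally have lower: "(p x - d / 4) * m \<le> integral \<Omega> (\<lambda>x. f x * bump 1 a b x)" .
  have "integral \<Omega> (\<lambda>x. f x * bump 1 (a + v) (b + v) x) = integral (cbox (a + v) (b + v)) (\<lambda>w. q w * bump 1 (a + v) (b + v) w)"
    by (rule int(1)[OF sK(2) K(2) q])
  also have "\<dots> \<le> integral (cbox (a + v) (b + v)) (\<lambda>w. (q x + d / 4) * bump 1 (a + v) (b + v) w)"
    by (rule integral_le[OF int(2)[OF sK(2) K(2) q] bi]) (auto intro!: mult_right_mono pq bump_bounds)
  also have "\<dots> = (q x + d / 4) * m" by (simp add: m2)
  finally have upper: "integral \<Omega> (\<lambda>x. f x * bump 1 (a + v) (b + v) x) \<le> (q x + d / 4) * m" .
  have "(p x - d / 4) * m - (q x + d / 4) * m \<le> m * (6 * C * r)" using diff lower upper by linarith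
  then have "m * (d / 2) \<le> m * (6 * C * r)" by (simp add: d_def algebra_simps)
  then have "d / 2 \<le> 6 * C * r" using m by simp
  also have "\<dots> \<le> 6 * C * (d / (24 * (C + 1)))" using C(1) by (intro mult_left_mono) (auto simp: r_def)
  also have "\<dots> \<le> d / 4" using C(1) d by (simp add: field_simps)
  finally show False using d by simp
qed

lemma Q_continuous_across_cells:
  assumes f: "f \<in> Q \<Omega> \<T> k" and x: "x \<in> \<Omega>" "x \<in> K" "x \<in> K'" and K: "K \<in> \<T>" "K' \<in> \<T>"
  shows "trace (interior K) f x = trace (interior K') f x"
proof -
  obtain p where p: "p \<in> Poly k" "\<And>x. x \<in> interior K \<Longrightarrow> f x = p x" using Q_E[OF f K(1)] by metis
  obtain q where q: "q \<in> Poly k" "\<And>x. x \<in> interior K' \<Longrightarrow> f x = q x" using Q_E[OF f K(2)] by metis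
  have "p x = q x"
    using Q_le_across_cells[OF f x K p q] Q_le_across_cells[OF f x(1,3,2) K(2,1) q p] by simp
  then show ?thesis
    using trace_cell[OF K(1) x(2) Poly_continuous[OF p(1)] p(2)] trace_cell[OF K(2) x(3) Poly_continuous[OF q(1)] q(2)] by simp
qed

text \<open>A point of the domain is covered by \<open>Q_continuous_across_cells\<close>. At the boundary, where \<open>H1\<close>
  regularity does not imply continuity, all traces are 0.\<close>
lemma Q0_trace_unique:
  assumes f: "f \<in> Q0 \<Omega> \<T> k" and x: "x \<in> K" "x \<in> K'" and K: "K \<in> \<T>" "K' \<in> \<T>"
  shows "trace (interior K) f x = trace (interior K') f x"
proof (cases "x \<in> \<Omega>")
  case True
  then show ?thesis using Q_continuous_across_cells[OF Q0_Q[OF f] True x K] by simp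
next
  case False
  have "x \<in> closure \<Omega>" using x(1) K(1) Union_mesh by auto
  then have "x \<in> frontier \<Omega>" using False open_domain by (simp add: frontier_def interior_open)
  then show ?thesis using Q0_trace[OF f K(1) x(1)] Q0_trace[OF f K(2) x(2)] by simp
qed

lemma Q0_trace_mesh:
  assumes f: "f \<in> Q0 \<Omega> \<T> k" and x: "x \<in> K" and K: "K \<in> \<T>"
  shows "trace (\<Union>K\<in>\<T>. interior K) f x = trace (interior K) f x"
  unfolding trace_def[of "\<Union>K\<in>\<T>. interior K"]
proof (rule tendsto_Lim)
  let ?c = "trace (interior K) f x"
  have "x islimpt interior K" using x K by (intro islimpt_open_closure) (simp_all add: closure_interior_cell)
  then have "x islimpt (\<Union>K\<in>\<T>. interior K)" by (rule islimpt_subset) (use K in auto)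
  then show "at x within (\<Union>K\<in>\<T>. interior K) \<noteq> bot" by (simp add: trivial_limit_within)
  have lim: "(f \<longlongrightarrow> ?c) (at x within interior K')" if K': "K' \<in> \<T>" for K'
  proof (cases "x \<in> K'")
    case True
    obtain p where p: "p \<in> Poly k" "\<And>x. x \<in> interior K' \<Longrightarrow> f x = p x" using Q_E[OF Q0_Q[OF f] K'] by metis
    have "p x = ?c"
      using trace_cell[OF K' True Poly_continuous[OF p(1)] p(2)] Q0_trace_unique[OF f True x K' K] by simp
    moreover have "(p \<longlongrightarrow> p x) (at x within interior K')"
      using Poly_continuous[OF p(1), of UNIV] by (simp add: continuous_on_def tendsto_within_subset[of _ _ _ UNIV])
    ultimately have "(p \<longlongrightarrow> ?c) (at x within interior K')" by simp
    then show ?thesis by (rule Lim_transform_eventually) (simp add: eventually_at_filter p(2))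
  next
    case False
    then have "\<not> x islimpt interior K'"
      using cell_closed[OF K'] closed_limpt islimpt_subset[OF _ interior_subset] by metis
    then have "at x within interior K' = bot" by (simp add: trivial_limit_within)
    then show ?thesis by simp
  qed
  have "(f \<longlongrightarrow> ?c) (at x within (\<Union>K\<in>A. interior K))" if "finite A" "A \<subseteq> \<T>" for A
    using that by (induction A rule: finite_induct) (simp_all add: Lim_within_Un lim)
  from this[OF finite_mesh order_refl] show "(f \<longlongrightarrow> ?c) (at x within (\<Union>K\<in>\<T>. interior K))" .
qed

end

section \<open>The discrete divergence\<close>

context bounded_open begin

lemma integral_mult_null:
  assumes "negligible {x\<in>\<Omega>. v x \<noteq> (0::real)}"
  shows "integral \<Omega> (\<lambda>x. w x * v x) = 0"
proof -
  have "integral \<Omega> (\<lambda>x. w x * v x) = integral \<Omega> (\<lambda>x. 0)"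
    by (rule integral_spike_on, rule negligible_subset[OF assms]) auto
  then show ?thesis by simp
qed

lemma null_if_integral_square_0:
  assumes v: "v \<in> L2 \<Omega>" and 0: "integral \<Omega> (\<lambda>x. v x * v x) = (0::real)"
  shows "negligible {x\<in>\<Omega>. v x \<noteq> 0}"
proof -
  have "negligible {x\<in>\<Omega>. v x * v x \<noteq> 0}"
    by (rule negligible_if_integral_norm_0[OF L2_mult_absolutely_integrable[OF sets_domain v v]]) (use 0 in simp)
  then show ?thesis by simp
qed

text \<open>The Riesz representation theorem for a space \<open>V\<close> of functions that is finite-dimensional modulo
  null functions. The induction is on the size of a family spanning \<open>V\<close> almost everywhere: a
  representative for the subspace spanned without \<open>g j\<close> is corrected by a multiple of
  a function \<open>r\<close> in \<open>V\<close> orthogonal to that subspace; \<open>r\<close> is itself obtained from the induction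
  hypothesis, applied to the functional given by the inner product with \<open>v0\<close>.\<close>
lemma L2_riesz_finite:
  fixes g :: "'i \<Rightarrow> vec3 \<Rightarrow> real"
  assumes "finite I"
  shows "V \<subseteq> L2 \<Omega> \<Longrightarrow> (\<lambda>x. 0) \<in> V \<Longrightarrow>
    (\<And>u v. u \<in> V \<Longrightarrow> v \<in> V \<Longrightarrow> (\<lambda>x. u x + v x) \<in> V) \<Longrightarrow> (\<And>t v. v \<in> V \<Longrightarrow> (\<lambda>x. t * v x) \<in> V) \<Longrightarrow>
    (\<And>v. v \<in> V \<Longrightarrow> \<exists>c. negligible {x\<in>\<Omega>. v x \<noteq> (\<Sum>i\<in>I. c i * g i x)}) \<Longrightarrow>
    (\<And>u v. u \<in> V \<Longrightarrow> v \<in> V \<Longrightarrow> l (\<lambda>x. u x + v x) = l u + l v) \<Longrightarrow>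
    (\<And>t v. v \<in> V \<Longrightarrow> l (\<lambda>x. t * v x) = t * l v) \<Longrightarrow>
    (\<And>v. v \<in> V \<Longrightarrow> negligible {x\<in>\<Omega>. v x \<noteq> 0} \<Longrightarrow> l v = 0) \<Longrightarrow>
    \<exists>d\<in>V. \<forall>v\<in>V. integral \<Omega> (\<lambda>x. d x * v x) = l v"
  using assms
proof (induction I arbitrary: V l rule: finite_induct)
  case empty
  have "l v = 0" if "v \<in> V" for v
    using empty.prems(5)[OF that] empty.prems(8)[OF that] by simp
  then show ?case using empty.prems(2) by (intro bexI[of _ "\<lambda>x. 0"]) simp_all
next
  case (insert j I)
  note VL = insert.prems(1) and V0 = insert.prems(2) and Vadd = insert.prems(3) and Vmult = insert.prems(4)
    and span = insert.prems(5) and ladd = insert.prems(6) and lmult = insert.prems(7) and lnull = insert.prems(8)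
  note IH = insert.IH
  define V' where "V' = {v\<in>V. \<exists>c. negligible {x\<in>\<Omega>. v x \<noteq> (\<Sum>i\<in>I. c i * g i x)}}"
  have V'V: "v \<in> V" if "v \<in> V'" for v using that by (simp add: V'_def)
  have V'add: "(\<lambda>x. u x + v x) \<in> V'" if uv: "u \<in> V'" "v \<in> V'" for u v
  proof -
    obtain c where c: "negligible {x\<in>\<Omega>. u x \<noteq> (\<Sum>i\<in>I. c i * g i x)}" using uv(1) by (auto simp: V'_def)
    obtain c' where c': "negligible {x\<in>\<Omega>. v x \<noteq> (\<Sum>i\<in>I. c' i * g i x)}" using uv(2) by (auto simp: V'_def)
    have "negligible {x\<in>\<Omega>. u x + v x \<noteq> (\<Sum>i\<in>I. (c i + c' i) * g i x)}"
      by (rule negligible_subset[OF negligible_Un[OF c c']]) (auto simp: distrib_right sum.distrib)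
    then show ?thesis using Vadd[OF V'V[OF uv(1)] V'V[OF uv(2)]] by (auto simp: V'_def)
  qed
  have V'mult: "(\<lambda>x. t * v x) \<in> V'" if v: "v \<in> V'" for t v
  proof -
    obtain c where c: "negligible {x\<in>\<Omega>. v x \<noteq> (\<Sum>i\<in>I. c i * g i x)}" using v by (auto simp: V'_def)
    have "negligible {x\<in>\<Omega>. t * v x \<noteq> (\<Sum>i\<in>I. (t * c i) * g i x)}"
      by (rule negligible_subset[OF c]) (auto simp: sum_distrib_left mult.assoc)
    then show ?thesis using Vmult[OF V'V[OF v]] by (auto simp: V'_def)
  qed
  have V'0: "(\<lambda>x. 0) \<in> V'"
    using V0 by (auto simp: V'_def intro!: exI[of _ "\<lambda>_. 0"])
  have V'L: "V' \<subseteq> L2 \<Omega>" using VL by (auto simp: V'_def)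
  have V'span: "\<exists>c. negligible {x\<in>\<Omega>. v x \<noteq> (\<Sum>i\<in>I. c i * g i x)}" if "v \<in> V'" for v
    using that by (simp add: V'_def)
  have L: "v \<in> L2 \<Omega>" if "v \<in> V" for v using VL that by auto
  have badd: "integral \<Omega> (\<lambda>x. w x * (u x + v x)) = integral \<Omega> (\<lambda>x. w x * u x) + integral \<Omega> (\<lambda>x. w x * v x)"
    if "w \<in> V" "u \<in> V" "v \<in> V" for w u v
    unfolding distrib_left by (intro integral_add integrable_mult_L2 L that)
  have bmult: "integral \<Omega> (\<lambda>x. w x * (t * v x)) = t * integral \<Omega> (\<lambda>x. w x * v x)" for w t and v :: "vec3 \<Rightarrow> real"
    by (simp add: mult.left_commute)
  have bsym: "integral \<Omega> (\<lambda>x. v x * w x) = integral \<Omega> (\<lambda>x. w x * v x)" for v w :: "vec3 \<Rightarrow> real"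
    by (simp add: mult.commute)
  have "\<exists>d\<in>V'. \<forall>v\<in>V'. integral \<Omega> (\<lambda>x. d x * v x) = l v"
    by (rule IH[OF V'L V'0 V'add V'mult V'span]) (simp_all add: ladd lmult lnull V'V)
  then obtain d' where d': "d' \<in> V'" "\<And>v. v \<in> V' \<Longrightarrow> integral \<Omega> (\<lambda>x. d' x * v x) = l v" by auto
  show ?case
  proof (cases "V \<subseteq> V'")
    case True
    then show ?thesis using d' V'V by (intro bexI[of _ d']) auto
  next
    case False
    then obtain v0 where v0: "v0 \<in> V" "v0 \<notin> V'" by auto
    obtain c0 where c0: "negligible {x\<in>\<Omega>. v0 x \<noteq> (\<Sum>i\<in>insert j I. c0 i * g i x)}" using span[OF v0(1)] by auto
    have c0j: "c0 j \<noteq> 0"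
    proof
      assume "c0 j = 0"
      then have "negligible {x\<in>\<Omega>. v0 x \<noteq> (\<Sum>i\<in>I. c0 i * g i x)}" using c0 insert.hyps by simp
      then show False using v0 by (auto simp: V'_def)
    qed
    have "\<exists>d\<in>V'. \<forall>v\<in>V'. integral \<Omega> (\<lambda>x. d x * v x) = integral \<Omega> (\<lambda>x. v0 x * v x)"
      by (rule IH[OF V'L V'0 V'add V'mult V'span]) (simp_all add: badd v0 V'V bmult integral_mult_null)
    then obtain e where e: "e \<in> V'" "\<And>v. v \<in> V' \<Longrightarrow> integral \<Omega> (\<lambda>x. e x * v x) = integral \<Omega> (\<lambda>x. v0 x * v x)" by auto
    define r where "r x = v0 x + (-1) * e x" for x
    have r: "r \<in> V" unfolding r_def[abs_def] by (rule Vadd[OF v0(1) Vmult[OF V'V[OF e(1)]]])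
    have orth: "integral \<Omega> (\<lambda>x. v x * r x) = 0" if v: "v \<in> V'" for v
    proof -
      have "integral \<Omega> (\<lambda>x. v x * r x) = integral \<Omega> (\<lambda>x. v x * v0 x) + -1 * integral \<Omega> (\<lambda>x. v x * e x)"
        unfolding r_def badd[OF V'V[OF v] v0(1) Vmult[OF V'V[OF e(1)]]] bmult ..
      then show ?thesis using e(2)[OF v] bsym[of v v0] bsym[of v e] by simp
    qed
    define R where "R = integral \<Omega> (\<lambda>x. r x * r x)"
    \<comment> \<open>if \<open>R = 0\<close>, then \<open>r\<close> is null, so that \<open>l r = 0\<close> and the value 0 of the quotient is the right one\<close>
    define s where "s = l r / R"
    have sR: "s * R = l r"
    proof (cases "R = 0")
      case True
      then have "l r = 0" using null_if_integral_square_0[OF L[OF r]] lnull[OF r] by (simp add: R_def)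
      with True show ?thesis by simp
    qed (simp add: s_def)
    define d where "d x = d' x + s * r x" for x
    have dV: "d \<in> V" unfolding d_def[abs_def] by (rule Vadd[OF V'V[OF d'(1)] Vmult[OF r]])
    have "integral \<Omega> (\<lambda>x. d x * v x) = l v" if v: "v \<in> V" for v
    proof -
      obtain c where c: "negligible {x\<in>\<Omega>. v x \<noteq> (\<Sum>i\<in>insert j I. c i * g i x)}" using span[OF v] by auto
      \<comment> \<open>subtracting \<open>t\<close> times \<open>v0\<close> removes the component of \<open>v\<close> along \<open>g j\<close>\<close>
      define t where "t = c j / c0 j"
      define u where "u x = v x + (- t) * v0 x" for x
      have uV: "u \<in> V" unfolding u_def[abs_def] by (rule Vadd[OF v Vmult[OF v0(1)]])
      have "negligible {x\<in>\<Omega>. u x \<noteq> (\<Sum>i\<in>I. (c i - t * c0 i) * g i x)}"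
      proof (rule negligible_subset[OF negligible_Un[OF c c0]], rule subsetI, rule ccontr)
        fix x assume x: "x \<in> {x\<in>\<Omega>. u x \<noteq> (\<Sum>i\<in>I. (c i - t * c0 i) * g i x)}"
          "x \<notin> {x\<in>\<Omega>. v x \<noteq> (\<Sum>i\<in>insert j I. c i * g i x)} \<union> {x\<in>\<Omega>. v0 x \<noteq> (\<Sum>i\<in>insert j I. c0 i * g i x)}"
        then have vx: "v x = c j * g j x + (\<Sum>i\<in>I. c i * g i x)" "v0 x = c0 j * g j x + (\<Sum>i\<in>I. c0 i * g i x)"
          using insert.hyps by auto
        have "u x = (\<Sum>i\<in>I. c i * g i x) - t * (\<Sum>i\<in>I. c0 i * g i x)"
          unfolding u_def vx using c0j by (simp add: t_def field_simps)
        then have "u x = (\<Sum>i\<in>I. (c i - t * c0 i) * g i x)"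
          by (simp add: left_diff_distrib sum_subtractf sum_distrib_left mult.assoc)
        then show False using x(1) by simp
      qed
      then have uV': "u \<in> V'" using uV by (auto simp: V'_def)
      define w where "w x = u x + t * e x" for x
      have w: "w \<in> V'" unfolding w_def[abs_def] by (rule V'add[OF uV' V'mult[OF e(1)]])
      have vw: "v = (\<lambda>x. w x + t * r x)"
        by (simp add: fun_eq_iff w_def u_def r_def algebra_simps)
      have tr: "(\<lambda>x. t * r x) \<in> V" by (rule Vmult[OF r])
      have "l v = l w + t * l r"
        unfolding vw by (simp add: ladd[OF V'V[OF w] tr] lmult[OF r])
      moreover have "integral \<Omega> (\<lambda>x. d x * v x) = integral \<Omega> (\<lambda>x. d x * w x) + t * integral \<Omega> (\<lambda>x. d x * r x)"
        unfolding vw by (simp add: badd[OF dV V'V[OF w] tr] bmult)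
      moreover have "integral \<Omega> (\<lambda>x. d x * w x) = l w"
      proof -
        have sr: "(\<lambda>x. s * r x) \<in> V" by (rule Vmult[OF r])
        have "integral \<Omega> (\<lambda>x. d x * w x) = integral \<Omega> (\<lambda>x. w x * (d' x + s * r x))"
          by (simp add: d_def mult.commute)
        also have "\<dots> = integral \<Omega> (\<lambda>x. w x * d' x) + s * integral \<Omega> (\<lambda>x. w x * r x)"
          by (simp add: badd[OF V'V[OF w] V'V[OF d'(1)] sr] bmult)
        finally show ?thesis using orth[OF w] d'(2)[OF w] bsym[of w d'] by simp
      qed
      moreover have "integral \<Omega> (\<lambda>x. d x * r x) = s * R"
      proof -
        have sr: "(\<lambda>x. s * r x) \<in> V" by (rule Vmult[OF r])
        have "integral \<Omega> (\<lambda>x. d x * r x) = integral \<Omega> (\<lambda>x. r x * (d' x + s * r x))"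
          by (simp add: d_def mult.commute)
        also have "\<dots> = integral \<Omega> (\<lambda>x. r x * d' x) + s * integral \<Omega> (\<lambda>x. r x * r x)"
          by (simp add: badd[OF r V'V[OF d'(1)] sr] bmult)
        finally show ?thesis using orth[OF d'(1)] bsym[of r d'] by (simp add: R_def)
      qed
      ultimately show ?thesis using sR by simp
    qed
    then show ?thesis using dV by blast
  qed
qed

lemma integral_inner_grad_cong:
  assumes "negligible {x\<in>\<Omega>. g x \<noteq> h x}"
  shows "integral \<Omega> (\<lambda>x. E x \<bullet> g x) = integral \<Omega> (\<lambda>x. E x \<bullet> h x)"
  by (rule integral_spike_on, rule negligible_subset[OF assms]) auto

end

context mesh begin

lemma Q_finite_span:
  assumes v: "v \<in> Q \<Omega> \<T> k"
  shows "\<exists>c. negligible {x\<in>\<Omega>. v x \<noteq> (\<Sum>i\<in>\<T> \<times> {\<alpha>. sum \<alpha> UNIV \<le> k}. c i * (indicator (interior (fst i)) x * monomial (snd i) x))}"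
proof -
  let ?A = "{\<alpha> :: 3 \<Rightarrow> nat. sum \<alpha> UNIV \<le> k}"
  have "\<forall>K\<in>\<T>. \<exists>a. \<forall>x\<in>interior K. v x = (\<Sum>\<alpha>\<in>?A. a \<alpha> * monomial \<alpha> x)"
  proof
    fix K assume K: "K \<in> \<T>"
    obtain p where p: "p \<in> Poly k" "\<And>x. x \<in> interior K \<Longrightarrow> v x = p x" using Q_E[OF v K] by metis
    obtain a where "p = (\<lambda>x. \<Sum>\<alpha>\<in>?A. a \<alpha> * monomial \<alpha> x)" using Poly_E[OF p(1)] .
    then show "\<exists>a. \<forall>x\<in>interior K. v x = (\<Sum>\<alpha>\<in>?A. a \<alpha> * monomial \<alpha> x)" using p(2) by (intro exI[of _ a]) simp
  qed
  from bchoice[OF this] obtain a where a: "v x = (\<Sum>\<alpha>\<in>?A. a K \<alpha> * monomial \<alpha> x)" if "K \<in> \<T>" "x \<in> interior K" for K x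
    by auto
  define c where "c i = a (fst i) (snd i)" for i
  have "negligible {x\<in>\<Omega>. v x \<noteq> (\<Sum>i\<in>\<T> \<times> ?A. c i * (indicator (interior (fst i)) x * monomial (snd i) x))}"
  proof (rule negligible_cells)
    fix K assume K: "K \<in> \<T>"
    have "v x = (\<Sum>i\<in>\<T> \<times> ?A. c i * (indicator (interior (fst i)) x * monomial (snd i) x))" if x: "x \<in> interior K" for x
    proof -
      have ind: "indicator (interior L) x = (if L = K then 1 else (0::real))" if "L \<in> \<T>" for L
      proof (cases "L = K")
        case False
        then have "interior L \<inter> interior K = {}" using conforming that K by (simp add: conforming_mesh_def)
        then have "x \<notin> interior L" using x by blast
        then show ?thesis using False by simp
      qed (use x in simp)
      have "(\<Sum>i\<in>\<T> \<times> ?A. c i * (indicator (interior (fst i)) x * monomial (snd i) x)) =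
        (\<Sum>L\<in>\<T>. \<Sum>\<alpha>\<in>?A. a L \<alpha> * (indicator (interior L) x * monomial \<alpha> x))"
        unfolding sum.cartesian_product by (rule sum.cong) (auto simp: c_def)
      also have "\<dots> = (\<Sum>L\<in>\<T>. if L = K then (\<Sum>\<alpha>\<in>?A. a K \<alpha> * monomial \<alpha> x) else 0)"
        by (rule sum.cong) (simp_all add: ind)
      also have "\<dots> = v x" using a[OF K x] K finite_mesh by simp
      finally show ?thesis by simp
    qed
    then have "{x \<in> interior K. v x \<noteq> (\<Sum>i\<in>\<T> \<times> ?A. c i * (indicator (interior (fst i)) x * monomial (snd i) x))} = {}" by simp
    then show "negligible {x \<in> interior K. v x \<noteq> (\<Sum>i\<in>\<T> \<times> ?A. c i * (indicator (interior (fst i)) x * monomial (snd i) x))}"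
      by (simp only: negligible_empty)
  qed
  then show ?thesis by blast
qed

lemma grad_add_ae:
  assumes "f \<in> Q \<Omega> \<T> k" "g \<in> Q \<Omega> \<T> k"
  shows "negligible {x\<in>\<Omega>. grad \<Omega> (\<lambda>x. f x + g x) x \<noteq> grad \<Omega> f x + grad \<Omega> g x}"
  by (rule has_weak_grad_unique[OF Q_L2[OF Q_add[OF assms]] has_weak_grad_grad[OF Q_H1[OF Q_add[OF assms]]]
      has_weak_grad_add[OF Q_L2[OF assms(1)] has_weak_grad_grad[OF Q_H1[OF assms(1)]]
      Q_L2[OF assms(2)] has_weak_grad_grad[OF Q_H1[OF assms(2)]]]])

lemma grad_cmult_ae:
  assumes "f \<in> Q \<Omega> \<T> k"
  shows "negligible {x\<in>\<Omega>. grad \<Omega> (\<lambda>x. c * f x) x \<noteq> c *\<^sub>R grad \<Omega> f x}"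
  by (rule has_weak_grad_unique[OF Q_L2[OF Q_cmult[OF assms]] has_weak_grad_grad[OF Q_H1[OF Q_cmult[OF assms]]]
      has_weak_grad_cmult[OF Q_L2[OF assms] has_weak_grad_grad[OF Q_H1[OF assms]]]])

lemma grad_null_ae:
  assumes "f \<in> Q \<Omega> \<T> k" "negligible {x\<in>\<Omega>. f x \<noteq> 0}"
  shows "negligible {x\<in>\<Omega>. grad \<Omega> f x \<noteq> 0}"
  by (rule has_weak_grad_unique[OF Q_L2[OF assms(1)] has_weak_grad_grad[OF Q_H1[OF assms(1)]] has_weak_grad_0[OF Q_L2[OF assms(1)] assms(2)]])

lemma grad_const_ae: "negligible {x\<in>\<Omega>. grad \<Omega> (\<lambda>x. c) x \<noteq> 0}"
  by (rule has_weak_grad_unique[OF Q_L2[OF Q_const] has_weak_grad_grad[OF Q_H1[OF Q_const]] has_weak_grad_const])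

lemma Q0_0: "(\<lambda>x. 0) \<in> Q0 \<Omega> \<T> k"
  unfolding Q0_def
proof (intro CollectI conjI ballI Q_const)
  fix K x assume K: "K \<in> \<T>" and x: "x \<in> K \<inter> frontier \<Omega>"
  show "trace (interior K) (\<lambda>x. 0 :: real) x = 0"
    using x by (intro trace_cell[OF K]) auto
qed

text \<open>The choice in the definition of the discrete divergence is meaningful: the functional
  \<open>\<phi> \<mapsto> - \<integral> E \<bullet> \<nabla>\<phi>\<close> is well defined modulo null functions, because weak gradients are
  unique, and can be represented by \<open>L2_riesz_finite\<close>.\<close>
lemma weak_divergence_spec:
  assumes E: "E \<in> L2 \<Omega>"
  shows "weak_divergence \<Omega> \<T> k E \<in> Q0 \<Omega> \<T> (k + 1)"
    "\<phi> \<in> Q0 \<Omega> \<T> (k + 1) \<Longrightarrow> integral \<Omega> (\<lambda>x. weak_divergence \<Omega> \<T> k E x * \<phi> x) = - integral \<Omega> (\<lambda>x. E x \<bullet> grad \<Omega> \<phi> x)"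
proof -
  let ?V = "Q0 \<Omega> \<T> (k + 1)"
  let ?l = "\<lambda>\<phi>. - integral \<Omega> (\<lambda>x. E x \<bullet> grad \<Omega> \<phi> x)"
  have "\<exists>d\<in>?V. \<forall>v\<in>?V. integral \<Omega> (\<lambda>x. d x * v x) = ?l v"
  proof (rule L2_riesz_finite[OF _ _ Q0_0 Q0_add Q0_cmult Q_finite_span[OF Q0_Q]])
    show "finite (\<T> \<times> {\<alpha> :: 3 \<Rightarrow> nat. sum \<alpha> UNIV \<le> k + 1})"
      by (intro finite_cartesian_product finite_mesh finite_multiindices)
    show "?V \<subseteq> L2 \<Omega>" using Q_L2[OF Q0_Q] by auto
    fix u v assume uv: "u \<in> ?V" "v \<in> ?V"
    have "integral \<Omega> (\<lambda>x. E x \<bullet> grad \<Omega> (\<lambda>x. u x + v x) x) = integral \<Omega> (\<lambda>x. E x \<bullet> (grad \<Omega> u x + grad \<Omega> v x))"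
      by (rule integral_inner_grad_cong[OF grad_add_ae[OF Q0_Q[OF uv(1)] Q0_Q[OF uv(2)]]])
    also have "\<dots> = integral \<Omega> (\<lambda>x. E x \<bullet> grad \<Omega> u x) + integral \<Omega> (\<lambda>x. E x \<bullet> grad \<Omega> v x)"
      unfolding inner_add_right by (intro integral_add integrable_inner_L2 E grad_L2[OF Q0_Q[OF uv(1)]] grad_L2[OF Q0_Q[OF uv(2)]])
    finally show "?l (\<lambda>x. u x + v x) = ?l u + ?l v" by simp
  next
    fix t v assume v: "v \<in> ?V"
    have "integral \<Omega> (\<lambda>x. E x \<bullet> grad \<Omega> (\<lambda>x. t * v x) x) = integral \<Omega> (\<lambda>x. E x \<bullet> (t *\<^sub>R grad \<Omega> v x))"
      by (rule integral_inner_grad_cong[OF grad_cmult_ae[OF Q0_Q[OF v]]])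
    then show "?l (\<lambda>x. t * v x) = t * ?l v" by simp
  next
    fix v assume v: "v \<in> ?V" "negligible {x\<in>\<Omega>. v x \<noteq> 0}"
    have "integral \<Omega> (\<lambda>x. E x \<bullet> grad \<Omega> v x) = integral \<Omega> (\<lambda>x. E x \<bullet> 0)"
      by (rule integral_inner_grad_cong[OF grad_null_ae[OF Q0_Q[OF v(1)] v(2)]])
    then show "?l v = 0" by simp
  qed
  then have ex: "\<exists>d. d \<in> ?V \<and> (\<forall>\<phi>\<in>?V. integral \<Omega> (\<lambda>x. d x * \<phi> x) = ?l \<phi>)" by auto
  from someI_ex[OF ex, folded weak_divergence_def]
  show "weak_divergence \<Omega> \<T> k E \<in> ?V"
    "\<phi> \<in> ?V \<Longrightarrow> integral \<Omega> (\<lambda>x. weak_divergence \<Omega> \<T> k E x * \<phi> x) = - integral \<Omega> (\<lambda>x. E x \<bullet> grad \<Omega> \<phi> x)"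
    by auto
qed

end

section \<open>The energy of the fluid\<close>

definition fluid_energy_density :: "real \<Rightarrow> real \<Rightarrow> real \<Rightarrow> vec3 \<Rightarrow> real" where
  "fluid_energy_density m c r M = r * (lorentz m c ((m / r) *\<^sub>R M) - 1) * c\<^sup>2"

text \<open>The derivative of \<open>fluid_energy_density\<close> with respect to the momentum density \<open>M\<close>.\<close>
definition fluid_velocity :: "real \<Rightarrow> real \<Rightarrow> real \<Rightarrow> vec3 \<Rightarrow> vec3" where
  "fluid_velocity m c r M = (1 / (r * lorentz m c ((m / r) *\<^sub>R M))) *\<^sub>R M"

text \<open>Up to the factor \<open>c\<^sup>2\<close>, the derivative of \<open>fluid_energy_density\<close> with respect to the mass
  density \<open>r\<close>.\<close>
definition fluid_potential :: "real \<Rightarrow> real \<Rightarrow> real \<Rightarrow> vec3 \<Rightarrow> real" where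
  "fluid_potential m c r M = (let g = lorentz m c ((m / r) *\<^sub>R M) in g - 1 - (norm M)\<^sup>2 / (c\<^sup>2 * r\<^sup>2 * g))"

lemma mean_velocity_eq: "mean_velocity m c st st' x =
    integral {0..1} (\<lambda>\<xi>. fluid_velocity m c (interp \<xi> (density st x) (density st' x)) (interp \<xi> (momentum st x) (momentum st' x)))"
  by (simp add: mean_velocity_def fluid_velocity_def Let_def)

lemma mean_G_eq: "mean_G m c st st' x =
    integral {0..1} (\<lambda>\<xi>. fluid_potential m c (interp \<xi> (density st x) (density st' x)) (interp \<xi> (momentum st x) (momentum st' x)))"
  by (simp add: mean_G_def fluid_potential_def Let_def)

lemma lorentz_ge_1: "lorentz m c u \<ge> 1"
  by (simp add: lorentz_def)

lemma lorentz_neq_0 [simp]: "lorentz m c u \<noteq> 0"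
  using lorentz_ge_1[of m c u] by linarith

lemma lorentz_momentum:
  assumes "m > 0"
  shows "lorentz m c ((m / r) *\<^sub>R M) = sqrt (1 + M \<bullet> M / (r\<^sup>2 * c\<^sup>2))"
  using assms by (simp add: lorentz_def power_divide power2_eq_square)

lemma continuous_on_lorentz [continuous_intros]:
  "continuous_on S f \<Longrightarrow> continuous_on S (\<lambda>x. lorentz m c (f x))"
  unfolding lorentz_def divide_inverse by (intro continuous_intros)

lemma continuous_on_interp [continuous_intros]:
  fixes f g :: "'a::topological_space \<Rightarrow> 'b::real_normed_vector"
  assumes "continuous_on S s" "continuous_on S f" "continuous_on S g"
  shows "continuous_on S (\<lambda>x. interp (s x) (f x) (g x))"
  unfolding interp_def by (intro continuous_intros assms)

lemma continuous_on_fluid_velocity: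
  assumes "continuous_on S r" "continuous_on S M" "\<And>x. x \<in> S \<Longrightarrow> r x \<noteq> 0"
  shows "continuous_on S (\<lambda>x. fluid_velocity m c (r x) (M x))"
  unfolding fluid_velocity_def using assms by (intro continuous_intros) auto

lemma continuous_on_fluid_potential:
  assumes "continuous_on S r" "continuous_on S M" "\<And>x. x \<in> S \<Longrightarrow> r x \<noteq> 0" "c > 0"
  shows "continuous_on S (\<lambda>x. fluid_potential m c (r x) (M x))"
  unfolding fluid_potential_def Let_def using assms by (intro continuous_intros) auto

lemma continuous_on_fluid_energy_density:
  assumes "continuous_on S r" "continuous_on S M" "\<And>x. x \<in> S \<Longrightarrow> r x \<noteq> 0"
  shows "continuous_on S (\<lambda>x. fluid_energy_density m c (r x) (M x))"
  unfolding fluid_energy_density_def using assms by (intro continuous_intros) auto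

text \<open>The right-hand side stays meaningful as \<open>r\<close> tends to 0. This gives bounds for the velocity and the
  energy that are uniform in \<open>r \<noteq> 0\<close>; they are needed since the density may vanish on the boundary
  of the domain.\<close>
lemma abs_density_times_lorentz:
  assumes "m > 0" "c > 0" "r \<noteq> 0"
  shows "\<bar>r\<bar> * lorentz m c ((m / r) *\<^sub>R M) = sqrt (r\<^sup>2 + (norm M / c)\<^sup>2)"
proof -
  have "\<bar>r\<bar> * lorentz m c ((m / r) *\<^sub>R M) = sqrt (r\<^sup>2) * sqrt (1 + M \<bullet> M / (r\<^sup>2 * c\<^sup>2))"
    using assms by (simp add: lorentz_momentum)
  also have "\<dots> = sqrt (r\<^sup>2 * (1 + M \<bullet> M / (r\<^sup>2 * c\<^sup>2)))" by (simp only: real_sqrt_mult)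
  also have "r\<^sup>2 * (1 + M \<bullet> M / (r\<^sup>2 * c\<^sup>2)) = r\<^sup>2 + (norm M / c)\<^sup>2"
    using assms by (simp add: field_simps power2_norm_eq_inner)
  finally show ?thesis .
qed

lemma norm_fluid_velocity_le:
  assumes "m > 0" "c > 0" "r \<noteq> 0"
  shows "norm (fluid_velocity m c r M) \<le> c"
proof -
  have "norm M / c \<le> \<bar>r\<bar> * lorentz m c ((m / r) *\<^sub>R M)"
    unfolding abs_density_times_lorentz[OF assms] by (rule real_le_rsqrt) simp
  then have "norm M \<le> c * (\<bar>r\<bar> * lorentz m c ((m / r) *\<^sub>R M))"
    using assms by (simp add: field_simps)
  moreover have "\<bar>r\<bar> * lorentz m c ((m / r) *\<^sub>R M) > 0"
    using assms lorentz_ge_1[of m c "(m / r) *\<^sub>R M"] by (intro mult_pos_pos) auto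
  ultimately show ?thesis
    using lorentz_ge_1[of m c "(m / r) *\<^sub>R M"] by (simp add: fluid_velocity_def abs_mult divide_le_eq)
qed

lemma fluid_potential_eq:
  assumes "m > 0" "c > 0" "r \<noteq> 0"
  shows "fluid_potential m c r M = 1 / lorentz m c ((m / r) *\<^sub>R M) - 1"
proof -
  let ?g = "lorentz m c ((m / r) *\<^sub>R M)"
  have g: "?g \<noteq> 0" by simp
  have "?g\<^sup>2 = 1 + M \<bullet> M / (r\<^sup>2 * c\<^sup>2)"
    using assms by (simp add: lorentz_momentum add_nonneg_nonneg)
  then have "(norm M)\<^sup>2 = (?g\<^sup>2 - 1) * (c\<^sup>2 * r\<^sup>2)"
    using assms by (simp add: power2_norm_eq_inner field_simps)
  then have "(norm M)\<^sup>2 / (c\<^sup>2 * r\<^sup>2 * ?g) = (?g\<^sup>2 - 1) / ?g"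
    using assms g by (simp add: field_simps)
  also have "\<dots> = ?g - 1 / ?g" using g by (simp add: field_simps power2_eq_square)
  finally show ?thesis by (simp add: fluid_potential_def Let_def)
qed

lemma abs_fluid_potential_le:
  assumes "m > 0" "c > 0" "r \<noteq> 0"
  shows "\<bar>fluid_potential m c r M\<bar> \<le> 1"
  using lorentz_ge_1[of m c "(m / r) *\<^sub>R M"] by (simp add: fluid_potential_eq[OF assms] abs_le_iff field_simps)

lemma abs_fluid_energy_density_le:
  assumes "m > 0" "c > 0" "r \<noteq> 0"
  shows "\<bar>fluid_energy_density m c r M\<bar> \<le> (2 * \<bar>r\<bar> + norm M / c) * c\<^sup>2"
proof -
  let ?g = "lorentz m c ((m / r) *\<^sub>R M)"
  have "\<bar>r\<bar> * ?g \<le> \<bar>r\<bar> + norm M / c"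
    unfolding abs_density_times_lorentz[OF assms] using sqrt_sum_squares_le_sum_abs[of r "norm M / c"] assms(2) by simp
  moreover have "\<bar>r * (?g - 1)\<bar> = \<bar>r\<bar> * ?g - \<bar>r\<bar>"
  proof -
    have "\<bar>r * (?g - 1)\<bar> = \<bar>r\<bar> * (?g - 1)"
      using lorentz_ge_1[of m c "(m / r) *\<^sub>R M"] unfolding abs_mult by simp
    then show ?thesis by (simp add: right_diff_distrib)
  qed
  ultimately have "\<bar>r * (?g - 1)\<bar> \<le> 2 * \<bar>r\<bar> + norm M / c" by linarith
  then show ?thesis unfolding fluid_energy_density_def abs_mult[of _ "c\<^sup>2"] by (simp add: mult_right_mono)
qed

lemma has_real_derivative_fluid_energy_density:
  fixes r :: "real \<Rightarrow> real" and M :: "real \<Rightarrow> vec3"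
  assumes mc: "m > 0" "c > 0" and r: "(r has_real_derivative r') (at \<xi> within S)" "r \<xi> \<noteq> 0"
    and M: "(M has_vector_derivative M') (at \<xi> within S)"
  shows "((\<lambda>\<xi>. fluid_energy_density m c (r \<xi>) (M \<xi>)) has_real_derivative
     r' * c\<^sup>2 * fluid_potential m c (r \<xi>) (M \<xi>) + M' \<bullet> fluid_velocity m c (r \<xi>) (M \<xi>)) (at \<xi> within S)"
proof -
  let ?N = "\<lambda>\<xi>. M \<xi> \<bullet> M \<xi>"
  have "((\<lambda>\<xi>. M \<xi> \<bullet> M \<xi>) has_derivative (\<lambda>h. M \<xi> \<bullet> (h *\<^sub>R M') + (h *\<^sub>R M') \<bullet> M \<xi>)) (at \<xi> within S)"
    using M unfolding has_vector_derivative_def by (intro has_derivative_inner)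
  then have N: "(?N has_real_derivative 2 * (M' \<bullet> M \<xi>)) (at \<xi> within S)"
    unfolding has_field_derivative_def
    by (rule has_derivative_eq_rhs) (simp add: fun_eq_iff inner_commute algebra_simps)
  let ?g = "sqrt (1 + ?N \<xi> / ((r \<xi>)\<^sup>2 * c\<^sup>2))"
  have pos: "1 + ?N \<xi> / ((r \<xi>)\<^sup>2 * c\<^sup>2) > 0" by (intro add_pos_nonneg) auto
  have g: "?g > 0" using pos by simp
  have "((\<lambda>\<xi>. r \<xi> * (sqrt (1 + ?N \<xi> / ((r \<xi>)\<^sup>2 * c\<^sup>2)) - 1) * c\<^sup>2) has_real_derivative
     (r' * (?g - 1) + r \<xi> * ((2 * (M' \<bullet> M \<xi>) * ((r \<xi>)\<^sup>2 * c\<^sup>2) - ?N \<xi> * (2 * r \<xi> * r' * c\<^sup>2)) / ((r \<xi>)\<^sup>2 * c\<^sup>2)\<^sup>2 * (inverse ?g / 2))) * c\<^sup>2) (at \<xi> within S)"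
    using pos r(2) mc
    by (auto intro!: derivative_eq_intros N r(1) simp: power2_eq_square mult_ac)
  moreover have "(r' * (?g - 1) + r \<xi> * ((2 * (M' \<bullet> M \<xi>) * ((r \<xi>)\<^sup>2 * c\<^sup>2) - ?N \<xi> * (2 * r \<xi> * r' * c\<^sup>2)) / ((r \<xi>)\<^sup>2 * c\<^sup>2)\<^sup>2 * (inverse ?g / 2))) * c\<^sup>2 =
     r' * c\<^sup>2 * (?g - 1 - ?N \<xi> / (c\<^sup>2 * (r \<xi>)\<^sup>2 * ?g)) + (M' \<bullet> M \<xi>) / (r \<xi> * ?g)"
  proof -
    define G where "G = ?g"
    have "G \<noteq> 0" using g by (simp add: G_def)
    then show ?thesis unfolding G_def[symmetric] using r(2) mc
      by (simp add: field_simps power2_eq_square)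
  qed
  ultimately show ?thesis
    by (simp add: fluid_energy_density_def fluid_potential_def fluid_velocity_def Let_def lorentz_momentum[OF mc(1)] power2_norm_eq_inner)
qed

text \<open>The fundamental theorem of calculus along the segment between the two states, for which
  \<open>\<xi> = 0\<close> is the new one.\<close>
lemma fluid_energy_density_increment:
  fixes r r' :: real and M M' :: vec3
  assumes mc: "m > 0" "c > 0" and nz: "\<And>\<xi>. \<xi> \<in> {0..1} \<Longrightarrow> interp \<xi> r r' \<noteq> 0"
  shows "fluid_energy_density m c r' M' - fluid_energy_density m c r M =
    c\<^sup>2 * ((r' - r) * integral {0..1} (\<lambda>\<xi>. fluid_potential m c (interp \<xi> r r') (interp \<xi> M M')))
    + (M' - M) \<bullet> integral {0..1} (\<lambda>\<xi>. fluid_velocity m c (interp \<xi> r r') (interp \<xi> M M'))"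
proof -
  let ?h = "\<lambda>\<xi>. fluid_energy_density m c (interp \<xi> r r') (interp \<xi> M M')"
  let ?G = "\<lambda>\<xi>. fluid_potential m c (interp \<xi> r r') (interp \<xi> M M')"
  let ?W = "\<lambda>\<xi>. fluid_velocity m c (interp \<xi> r r') (interp \<xi> M M')"
  have dr: "((\<lambda>\<xi>. interp \<xi> r r') has_real_derivative (r - r')) (at \<xi> within S)" for \<xi> S
    unfolding interp_def by (auto intro!: derivative_eq_intros)
  have dM: "((\<lambda>\<xi>. interp \<xi> M M') has_vector_derivative (M - M')) (at \<xi> within S)" for \<xi> S
    unfolding interp_def by (auto intro!: derivative_eq_intros)
  have 1: "((\<lambda>\<xi>. (r - r') * c\<^sup>2 * ?G \<xi> + (M - M') \<bullet> ?W \<xi>) has_integral ?h 1 - ?h 0) {0..1}"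
  proof (rule fundamental_theorem_of_calculus)
    fix \<xi> :: real assume "\<xi> \<in> {0..1}"
    then show "(?h has_vector_derivative (r - r') * c\<^sup>2 * ?G \<xi> + (M - M') \<bullet> ?W \<xi>) (at \<xi> within {0..1})"
      unfolding has_real_derivative_iff_has_vector_derivative[symmetric]
      by (intro has_real_derivative_fluid_energy_density mc dr dM nz)
  qed simp
  have cG: "continuous_on {0..1} ?G" and cW: "continuous_on {0..1} ?W"
    using nz mc by (intro continuous_on_fluid_potential continuous_on_fluid_velocity continuous_intros; simp)+
  have G: "(?G has_integral integral {0..1} ?G) {0..1}" and W: "(?W has_integral integral {0..1} ?W) {0..1}"
    by (intro integrable_integral integrable_continuous_real cG cW)+
  have W': "((\<lambda>\<xi>. (M - M') \<bullet> ?W \<xi>) has_integral (M - M') \<bullet> integral {0..1} ?W) {0..1}"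
    using has_integral_linear[OF W bounded_linear_inner_right[of "M - M'"]] by (simp add: o_def)
  have "((\<lambda>\<xi>. (r - r') * c\<^sup>2 * ?G \<xi> + (M - M') \<bullet> ?W \<xi>) has_integral
      (r - r') * c\<^sup>2 * integral {0..1} ?G + (M - M') \<bullet> integral {0..1} ?W) {0..1}"
    by (intro has_integral_add has_integral_mult_right G W')
  from has_integral_unique[OF this 1]
  have "?h 1 - ?h 0 = (r - r') * c\<^sup>2 * integral {0..1} ?G + (M - M') \<bullet> integral {0..1} ?W" by simp
  then show ?thesis by (simp add: interp_def algebra_simps)
qed

context mesh begin

lemma cellwise_continuous_L2:
  fixes f :: "vec3 \<Rightarrow> 'a::euclidean_space"
  assumes cont: "\<And>K. K \<in> \<T> \<Longrightarrow> continuous_on (interior K) f"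
    and B: "\<And>K x. K \<in> \<T> \<Longrightarrow> x \<in> interior K \<Longrightarrow> norm (f x) \<le> B"
  shows "f \<in> L2 \<Omega>"
proof -
  let ?S = "\<Union>K\<in>\<T>. interior K"
  let ?g = "\<lambda>x. if x \<in> ?S then f x else 0"
  have S: "?S \<in> sets lebesgue"
  proof (rule fmeasurableD[OF lmeasurable_open])
    have "?S \<subseteq> \<Omega>" using cell_interior by auto
    then show "bounded ?S" using bounded_domain bounded_subset by auto
  qed auto
  have "continuous_on ?S f" using cont by (intro continuous_on_open_UN) auto
  then have "f \<in> borel_measurable (lebesgue_on ?S)" using S by (rule continuous_imp_measurable_on_sets_lebesgue)
  then have "?g \<in> borel_measurable lebesgue" unfolding borel_measurable_if[OF S] .
  then have gm: "?g \<in> borel_measurable (lebesgue_on \<Omega>)" by (rule measurable_restrict_space1)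
  have "?g \<in> L2 \<Omega>"
  proof (rule L2_bounded[OF lmeasurable_domain gm])
    show "norm (?g x) \<le> max B 0" for x using B by (auto simp: le_max_iff_disj)
  qed
  then show ?thesis
  proof (rule L2_spike[OF sets_domain _ negligible_skeleton])
    fix x assume x: "x \<in> \<Omega> - skeleton"
    then have "x \<in> \<Union>\<T>" using Union_mesh closure_subset by auto
    then obtain K where "K \<in> \<T>" "x \<in> interior K" using in_cell_interior[of x] x by auto
    then show "f x = ?g x" by auto
  qed
qed

end

context mesh begin

lemma VQ_E:
  assumes "f \<in> VQ \<Omega> \<T> k" "K \<in> \<T>"
  obtains p where "p \<in> VPoly k" "\<And>x. x \<in> interior K \<Longrightarrow> f x = p x"
proof -
  have "\<exists>p. p \<in> Poly k \<and> (\<forall>x\<in>interior K. f x $ j = p x)" for j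
  proof -
    have "(\<lambda>x. f x $ j) \<in> Q \<Omega> \<T> k" using assms(1) by (simp add: VQ_def)
    then have "\<exists>p\<in>Poly k. \<forall>x\<in>interior K. f x $ j = p x" using assms(2) by (simp add: Q_def)
    then show ?thesis by auto
  qed
  then obtain p where p: "\<forall>j. p j \<in> Poly k \<and> (\<forall>x\<in>interior K. f x $ j = p j x)" using choice[of "\<lambda>j p. p \<in> Poly k \<and> (\<forall>x\<in>interior K. f x $ j = p x)"] by auto
  show ?thesis
  proof (rule that[of "\<lambda>x. \<chi> j. p j x"])
    show "(\<lambda>x. \<chi> j. p j x) \<in> VPoly k" using p by (simp add: VPoly_def)
    show "f x = (\<chi> j. p j x)" if "x \<in> interior K" for x using p that by (simp add: vec_eq_iff)
  qed
qed

lemma continuous_bounded_on_cell: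
  fixes p :: "vec3 \<Rightarrow> 'a::real_normed_vector"
  assumes "K \<in> \<T>" "continuous_on UNIV p"
  obtains B where "\<And>x. x \<in> interior K \<Longrightarrow> norm (p x) \<le> B"
proof -
  have "compact (p ` K)"
    by (intro compact_continuous_image continuous_on_subset[OF assms(2)] polyhedral_cell_closed(4)[OF mesh_cell[OF assms(1)]]) simp
  then obtain B where "\<forall>y\<in>p ` K. norm y \<le> B" using compact_imp_bounded bounded_iff by metis
  then have "norm (p x) \<le> B" if "x \<in> interior K" for x using that interior_subset by blast
  then show ?thesis by (rule that)
qed

lemma cellwise_continuous_bounded_L2:
  fixes f :: "vec3 \<Rightarrow> 'a::euclidean_space"
  assumes cont: "\<And>K. K \<in> \<T> \<Longrightarrow> continuous_on (interior K) f"
    and B: "\<And>K. K \<in> \<T> \<Longrightarrow> \<exists>B. \<forall>x\<in>interior K. norm (f x) \<le> B"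
  shows "f \<in> L2 \<Omega>"
proof -
  have "\<forall>K\<in>\<T>. \<exists>B. \<forall>x\<in>interior K. norm (f x) \<le> B" using B by simp
  from bchoice[OF this] obtain b where b: "\<forall>K\<in>\<T>. \<forall>x\<in>interior K. norm (f x) \<le> b K" by auto
  have "norm (f x) \<le> (\<Sum>K\<in>\<T>. \<bar>b K\<bar>)" if "K \<in> \<T>" "x \<in> interior K" for K x
  proof -
    have "norm (f x) \<le> \<bar>b K\<bar>" using b that by force
    also have "\<dots> \<le> (\<Sum>K\<in>\<T>. \<bar>b K\<bar>)" using that(1) finite_mesh by (intro member_le_sum) auto
    finally show ?thesis .
  qed
  then show ?thesis by (intro cellwise_continuous_L2 cont)
qed

context
  fixes m c :: real and k :: nat and st st' :: pic_state
  assumes mc: "m > 0" "c > 0"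
    and \<rho>: "density st \<in> Q \<Omega> \<T> k" "density st' \<in> Q \<Omega> \<T> k"
    and M: "momentum st \<in> VQ \<Omega> \<T> k" "momentum st' \<in> VQ \<Omega> \<T> k"
    and nz: "\<forall>\<xi>\<in>{0..1}. \<forall>K\<in>\<T>. \<forall>x\<in>K \<inter> \<Omega>. trace (interior K) (interp_field \<xi> (density st) (density st')) x \<noteq> 0"
begin

lemma interp_density_neq_0:
  assumes K: "K \<in> \<T>" "x \<in> interior K" and \<xi>: "\<xi> \<in> {0..1}"
  shows "interp \<xi> (density st x) (density st' x) \<noteq> 0"
proof -
  obtain p where p: "p \<in> Poly k" "\<And>x. x \<in> interior K \<Longrightarrow> density st x = p x" using Q_E[OF \<rho>(1) K(1)] by metis
  obtain q where q: "q \<in> Poly k" "\<And>x. x \<in> interior K \<Longrightarrow> density st' x = q x" using Q_E[OF \<rho>(2) K(1)] by metis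
  have x: "x \<in> K" "x \<in> \<Omega>" using K interior_subset cell_interior by auto
  have "trace (interior K) (interp_field \<xi> (density st) (density st')) x = interp \<xi> (p x) (q x)"
    by (rule trace_cell[OF K(1) x(1)])
       (simp_all add: interp_field_def p q continuous_on_interp Poly_continuous[OF p(1)] Poly_continuous[OF q(1)])
  then show ?thesis using nz \<xi> K(1) x p(2)[OF K(2)] q(2)[OF K(2)] by auto
qed

lemma density_neq_0:
  assumes K: "K \<in> \<T>" "x \<in> interior K"
  shows "density st x \<noteq> 0" "density st' x \<noteq> 0"
  using interp_density_neq_0[OF K, of 1] interp_density_neq_0[OF K, of 0] by (simp_all add: interp_def)

lemma continuous_on_density:
  assumes K: "K \<in> \<T>"
  shows "continuous_on (interior K) (density st)" "continuous_on (interior K) (density st')"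
    "continuous_on (interior K) (momentum st)" "continuous_on (interior K) (momentum st')"
proof -
  have Q: "continuous_on (interior K) f" if f: "f \<in> Q \<Omega> \<T> k" for f
  proof -
    obtain p where p: "p \<in> Poly k" "\<And>x. x \<in> interior K \<Longrightarrow> f x = p x" using Q_E[OF f K] by metis
    show ?thesis by (rule continuous_on_eq[OF Poly_continuous[OF p(1)]]) (simp add: p(2))
  qed
  have V: "continuous_on (interior K) f" if f: "f \<in> VQ \<Omega> \<T> k" for f
  proof -
    obtain p where p: "p \<in> VPoly k" "\<And>x. x \<in> interior K \<Longrightarrow> f x = p x" using VQ_E[OF f K] by metis
    show ?thesis by (rule continuous_on_eq[OF VPoly_continuous[OF p(1)]]) (simp add: p(2))
  qed
  show "continuous_on (interior K) (density st)" "continuous_on (interior K) (density st')"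
    "continuous_on (interior K) (momentum st)" "continuous_on (interior K) (momentum st')"
    by (rule Q[OF \<rho>(1)], rule Q[OF \<rho>(2)], rule V[OF M(1)], rule V[OF M(2)])
qed

lemma fluid_energy_density_L2:
  "(\<lambda>x. fluid_energy_density m c (density st x) (momentum st x)) \<in> L2 \<Omega>"
  "(\<lambda>x. fluid_energy_density m c (density st' x) (momentum st' x)) \<in> L2 \<Omega>"
proof -
  have *: "(\<lambda>x. fluid_energy_density m c (r x) (N x)) \<in> L2 \<Omega>"
    if r: "r \<in> Q \<Omega> \<T> k" and N: "N \<in> VQ \<Omega> \<T> k" and cont: "\<And>K. K \<in> \<T> \<Longrightarrow> continuous_on (interior K) r" "\<And>K. K \<in> \<T> \<Longrightarrow> continuous_on (interior K) N"
      and nz: "\<And>K x. K \<in> \<T> \<Longrightarrow> x \<in> interior K \<Longrightarrow> r x \<noteq> 0" for r N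
  proof (rule cellwise_continuous_bounded_L2)
    fix K assume K: "K \<in> \<T>"
    show "continuous_on (interior K) (\<lambda>x. fluid_energy_density m c (r x) (N x))"
      by (intro continuous_on_fluid_energy_density cont[OF K] nz[OF K])
    obtain p where p: "p \<in> Poly k" "\<And>x. x \<in> interior K \<Longrightarrow> r x = p x" using Q_E[OF r K] by metis
    obtain q where q: "q \<in> VPoly k" "\<And>x. x \<in> interior K \<Longrightarrow> N x = q x" using VQ_E[OF N K] by metis
    obtain B where B: "\<And>x. x \<in> interior K \<Longrightarrow> norm (p x) \<le> B" using continuous_bounded_on_cell[OF K Poly_continuous[OF p(1)]] by metis
    obtain D where D: "\<And>x. x \<in> interior K \<Longrightarrow> norm (q x) \<le> D" using continuous_bounded_on_cell[OF K VPoly_continuous[OF q(1)]] by metis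
    have "norm (fluid_energy_density m c (r x) (N x)) \<le> (2 * B + D / c) * c\<^sup>2" if x: "x \<in> interior K" for x
    proof -
      have "\<bar>fluid_energy_density m c (r x) (N x)\<bar> \<le> (2 * \<bar>r x\<bar> + norm (N x) / c) * c\<^sup>2"
        by (rule abs_fluid_energy_density_le[OF mc nz[OF K x]])
      also have "\<dots> \<le> (2 * B + D / c) * c\<^sup>2"
        using B[OF x] D[OF x] mc by (intro mult_right_mono add_mono divide_right_mono mult_left_mono) (simp_all add: p(2)[OF x] q(2)[OF x])
      finally show ?thesis by simp
    qed
    then show "\<exists>B. \<forall>x\<in>interior K. norm (fluid_energy_density m c (r x) (N x)) \<le> B" by auto
  qed
  show "(\<lambda>x. fluid_energy_density m c (density st x) (momentum st x)) \<in> L2 \<Omega>"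
    by (rule *[OF \<rho>(1) M(1) continuous_on_density(1,3) density_neq_0(1)])
  show "(\<lambda>x. fluid_energy_density m c (density st' x) (momentum st' x)) \<in> L2 \<Omega>"
    by (rule *[OF \<rho>(2) M(2) continuous_on_density(2,4) density_neq_0(2)])
qed

lemma continuous_on_interp_state:
  assumes K: "K \<in> \<T>"
  shows "continuous_on (interior K \<times> cbox 0 1) (\<lambda>z. interp (snd z) (density st (fst z)) (density st' (fst z)))"
    "continuous_on (interior K \<times> cbox 0 1) (\<lambda>z. interp (snd z) (momentum st (fst z)) (momentum st' (fst z)))"
  by (intro continuous_on_interp continuous_on_snd continuous_on_id
      continuous_on_compose2[OF continuous_on_density(1)[OF K]] continuous_on_compose2[OF continuous_on_density(2)[OF K]]
      continuous_on_compose2[OF continuous_on_density(3)[OF K]] continuous_on_compose2[OF continuous_on_density(4)[OF K]]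
      continuous_on_fst; auto)+

lemma mean_velocity_L2: "mean_velocity m c st st' \<in> L2 \<Omega>"
proof (rule cellwise_continuous_L2)
  fix K assume K: "K \<in> \<T>"
  have ne: "interp (snd z) (density st (fst z)) (density st' (fst z)) \<noteq> 0" if "z \<in> interior K \<times> cbox 0 1" for z
    using that by (intro interp_density_neq_0[OF K]) auto
  have "continuous_on (interior K \<times> cbox 0 1) (\<lambda>(x, \<xi>). fluid_velocity m c (interp \<xi> (density st x) (density st' x)) (interp \<xi> (momentum st x) (momentum st' x)))"
    using continuous_on_fluid_velocity[OF continuous_on_interp_state[OF K] ne] by (simp add: case_prod_unfold)
  from integral_continuous_on_param[OF this] show "continuous_on (interior K) (mean_velocity m c st st')"
    unfolding mean_velocity_eq[abs_def] by simp
  fix x assume x: "x \<in> interior K"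
  show "norm (mean_velocity m c st st' x) \<le> c"
  proof -
    have "continuous_on {0..1} (\<lambda>\<xi>. fluid_velocity m c (interp \<xi> (density st x) (density st' x)) (interp \<xi> (momentum st x) (momentum st' x)))"
      by (intro continuous_on_fluid_velocity continuous_intros interp_density_neq_0[OF K x])
    from integral_bound[OF zero_le_one this norm_fluid_velocity_le[OF mc interp_density_neq_0[OF K x]]]
    show ?thesis by (simp add: mean_velocity_eq)
  qed
qed

lemma mean_G_L2: "mean_G m c st st' \<in> L2 \<Omega>"
proof (rule cellwise_continuous_L2)
  fix K assume K: "K \<in> \<T>"
  have ne: "interp (snd z) (density st (fst z)) (density st' (fst z)) \<noteq> 0" if "z \<in> interior K \<times> cbox 0 1" for z
    using that by (intro interp_density_neq_0[OF K]) auto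
  have "continuous_on (interior K \<times> cbox 0 1) (\<lambda>(x, \<xi>). fluid_potential m c (interp \<xi> (density st x) (density st' x)) (interp \<xi> (momentum st x) (momentum st' x)))"
    using continuous_on_fluid_potential[OF continuous_on_interp_state[OF K] ne mc(2)] by (simp add: case_prod_unfold)
  from integral_continuous_on_param[OF this] show "continuous_on (interior K) (mean_G m c st st')"
    unfolding mean_G_eq[abs_def] by simp
  fix x assume x: "x \<in> interior K"
  show "norm (mean_G m c st st' x) \<le> 1"
  proof -
    have "continuous_on {0..1} (\<lambda>\<xi>. fluid_potential m c (interp \<xi> (density st x) (density st' x)) (interp \<xi> (momentum st x) (momentum st' x)))"
      by (intro continuous_on_fluid_potential continuous_intros interp_density_neq_0[OF K x] mc(2))
    from integral_bound[OF zero_le_one this] abs_fluid_potential_le[OF mc interp_density_neq_0[OF K x]]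
    show ?thesis by (simp add: mean_G_eq)
  qed
qed

text \<open>The increments of the density and of the momentum density belong to the finite element spaces onto
  which the means are projected, so that the projections have the same integrals against them.\<close>
lemma fluid_energy_step:
  assumes w: "is_L2_projection \<Omega> (VQ \<Omega> \<T> k) (mean_velocity m c st st') w"
    and G: "is_L2_projection \<Omega> (Q \<Omega> \<T> k) (mean_G m c st st') G"
  shows "integral \<Omega> (\<lambda>x. fluid_energy_density m c (density st' x) (momentum st' x))
    - integral \<Omega> (\<lambda>x. fluid_energy_density m c (density st x) (momentum st x))
    = c\<^sup>2 * integral \<Omega> (\<lambda>x. (density st' x - density st x) * G x)
    + integral \<Omega> (\<lambda>x. (momentum st' x - momentum st x) \<bullet> w x)"
proof -
  let ?H = "\<lambda>st x. fluid_energy_density m c (density st x) (momentum st x)"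
  let ?d\<rho> = "\<lambda>x. density st' x - density st x" and ?dM = "\<lambda>x. momentum st' x - momentum st x"
  have dQ: "?d\<rho> \<in> Q \<Omega> \<T> k" by (rule Q_diff[OF \<rho>(2,1)])
  have dV: "?dM \<in> VQ \<Omega> \<T> k" by (rule VQ_diff[OF M(2,1)])
  have "integral \<Omega> (?H st') - integral \<Omega> (?H st) = integral \<Omega> (\<lambda>x. ?H st' x - ?H st x)"
    using fluid_energy_density_L2
    by (intro integral_diff[symmetric] set_lebesgue_integral_eq_integral(1) L2_absolutely_integrable[OF lmeasurable_domain])
  also have "\<dots> = integral \<Omega> (\<lambda>x. c\<^sup>2 * (?d\<rho> x * mean_G m c st st' x) + ?dM x \<bullet> mean_velocity m c st st' x)"
  proof (rule integral_spike_on, rule negligible_cells)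
    fix K assume K: "K \<in> \<T>"
    have "?H st' x - ?H st x = c\<^sup>2 * (?d\<rho> x * mean_G m c st st' x) + ?dM x \<bullet> mean_velocity m c st st' x" if x: "x \<in> interior K" for x
      unfolding mean_G_eq mean_velocity_eq
      by (rule fluid_energy_density_increment[OF mc interp_density_neq_0[OF K x]])
    then have "{x \<in> interior K. ?H st' x - ?H st x \<noteq> c\<^sup>2 * (?d\<rho> x * mean_G m c st st' x) + ?dM x \<bullet> mean_velocity m c st st' x} = {}"
      by simp
    then show "negligible {x \<in> interior K. ?H st' x - ?H st x \<noteq> c\<^sup>2 * (?d\<rho> x * mean_G m c st st' x) + ?dM x \<bullet> mean_velocity m c st st' x}"
      by (simp only: negligible_empty)
  qed
  also have "\<dots> = integral \<Omega> (\<lambda>x. c\<^sup>2 * (?d\<rho> x * mean_G m c st st' x)) + integral \<Omega> (\<lambda>x. ?dM x \<bullet> mean_velocity m c st st' x)"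
    by (intro integral_add integrable_on_mult_right integrable_mult_L2 integrable_inner_L2 Q_L2[OF dQ] VQ_L2[OF dV] mean_G_L2 mean_velocity_L2)
  also have "integral \<Omega> (\<lambda>x. c\<^sup>2 * (?d\<rho> x * mean_G m c st st' x)) = c\<^sup>2 * integral \<Omega> (\<lambda>x. ?d\<rho> x * mean_G m c st st' x)"
    by simp
  also have "integral \<Omega> (\<lambda>x. ?d\<rho> x * mean_G m c st st' x) = integral \<Omega> (\<lambda>x. ?d\<rho> x * G x)"
  proof -
    have "integral \<Omega> (\<lambda>x. G x \<bullet> ?d\<rho> x) = integral \<Omega> (\<lambda>x. mean_G m c st st' x \<bullet> ?d\<rho> x)"
      using G[unfolded is_L2_projection_def, THEN conjunct2] dQ by (rule bspec)
    then show ?thesis by (simp add: mult.commute)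
  qed
  also have "integral \<Omega> (\<lambda>x. ?dM x \<bullet> mean_velocity m c st st' x) = integral \<Omega> (\<lambda>x. ?dM x \<bullet> w x)"
  proof -
    have "integral \<Omega> (\<lambda>x. w x \<bullet> ?dM x) = integral \<Omega> (\<lambda>x. mean_velocity m c st st' x \<bullet> ?dM x)"
      using w[unfolded is_L2_projection_def, THEN conjunct2] dV by (rule bspec)
    then show ?thesis by (simp only: inner_commute)
  qed
  finally show ?thesis .
qed

end

end

section \<open>Particles\<close>

text \<open>The kinetic energy of a particle along the segment from \<open>U'\<close> to \<open>U\<close>, by the fundamental theorem
  of calculus.\<close>
lemma lorentz_increment:
  fixes U U' :: vec3
  assumes mc: "m > 0" "c > 0"
  shows "(lorentz m c U' - lorentz m c U) * (m\<^sup>2 * c\<^sup>2) = (U' - U) \<bullet> integral {0..1} (\<lambda>\<xi>. interp \<xi> U U' /\<^sub>R lorentz m c (interp \<xi> U U'))"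
proof -
  let ?u = "\<lambda>\<xi>. interp \<xi> U U'"
  let ?f = "\<lambda>\<xi>. ?u \<xi> /\<^sub>R lorentz m c (?u \<xi>)"
  have du: "(?u has_vector_derivative (U - U')) (at \<xi> within S)" for \<xi> S
    unfolding interp_def by (auto intro!: derivative_eq_intros)
  have d: "((\<lambda>\<xi>. lorentz m c (?u \<xi>) * (m\<^sup>2 * c\<^sup>2)) has_vector_derivative (U - U') \<bullet> ?f \<xi>) (at \<xi> within S)" for \<xi> S
  proof -
    have "((\<lambda>\<xi>. ?u \<xi> \<bullet> ?u \<xi>) has_derivative (\<lambda>h. ?u \<xi> \<bullet> (h *\<^sub>R (U - U')) + (h *\<^sub>R (U - U')) \<bullet> ?u \<xi>)) (at \<xi> within S)"
      using du unfolding has_vector_derivative_def by (intro has_derivative_inner)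
    then have N: "((\<lambda>\<xi>. ?u \<xi> \<bullet> ?u \<xi>) has_real_derivative 2 * ((U - U') \<bullet> ?u \<xi>)) (at \<xi> within S)"
      unfolding has_field_derivative_def
      by (rule has_derivative_eq_rhs) (simp add: fun_eq_iff inner_commute algebra_simps)
    let ?g = "sqrt (1 + ?u \<xi> \<bullet> ?u \<xi> / (m\<^sup>2 * c\<^sup>2))"
    have pos: "1 + ?u \<xi> \<bullet> ?u \<xi> / (m\<^sup>2 * c\<^sup>2) > 0" by (intro add_pos_nonneg) auto
    have "((\<lambda>\<xi>. sqrt (1 + ?u \<xi> \<bullet> ?u \<xi> / (m\<^sup>2 * c\<^sup>2)) * (m\<^sup>2 * c\<^sup>2)) has_real_derivative
       (2 * ((U - U') \<bullet> ?u \<xi>) / (m\<^sup>2 * c\<^sup>2) * (inverse ?g / 2)) * (m\<^sup>2 * c\<^sup>2)) (at \<xi> within S)"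
      using pos by (auto intro!: derivative_eq_intros N)
    then show ?thesis
      unfolding has_real_derivative_iff_has_vector_derivative[symmetric] lorentz_def
      by (rule DERIV_cong) (use mc in \<open>simp add: field_simps\<close>)
  qed
  have "((\<lambda>\<xi>. (U - U') \<bullet> ?f \<xi>) has_integral lorentz m c (?u 1) * (m\<^sup>2 * c\<^sup>2) - lorentz m c (?u 0) * (m\<^sup>2 * c\<^sup>2)) {0..1}"
    by (rule fundamental_theorem_of_calculus[OF zero_le_one d])
  moreover have "((\<lambda>\<xi>. (U - U') \<bullet> ?f \<xi>) has_integral (U - U') \<bullet> integral {0..1} ?f) {0..1}"
  proof -
    have "continuous_on {0..1} ?f" by (intro continuous_intros) simp
    then have "(?f has_integral integral {0..1} ?f) {0..1}" by (intro integrable_integral integrable_continuous_real)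
    from has_integral_linear[OF this bounded_linear_inner_right[of "U - U'"]] show ?thesis by (simp add: o_def)
  qed
  ultimately have "(U - U') \<bullet> integral {0..1} ?f = lorentz m c (?u 1) * (m\<^sup>2 * c\<^sup>2) - lorentz m c (?u 0) * (m\<^sup>2 * c\<^sup>2)"
    by (rule has_integral_unique[rotated])
  then have "(U - U') \<bullet> integral {0..1} ?f = lorentz m c U * (m\<^sup>2 * c\<^sup>2) - lorentz m c U' * (m\<^sup>2 * c\<^sup>2)"
    by (simp add: interp_def)
  then show ?thesis by (simp add: left_diff_distrib inner_diff_left)
qed

lemma trajectory_breakpoints:
  assumes "is_trajectory \<T> X X' tr"
  shows "\<exists>t. t 0 = 0 \<and> t (nseg tr) = 1 \<and> (\<forall>i\<le>nseg tr. breakpt tr i = X + t i *\<^sub>R (X' - X))"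
proof -
  have "\<exists>t. t 0 = 0 \<and> t (nseg tr) = 1 \<and> strict_mono_on {0..nseg tr} t \<and>
      (\<forall>i\<le>nseg tr. breakpt tr i = X + t i *\<^sub>R (X' - X))"
    using assms unfolding is_trajectory_def by (elim conjE)
  then show ?thesis by (elim exE conjE) (intro exI conjI; assumption)
qed

lemma step_vec_eq:
  assumes "is_trajectory \<T> X X' tr" "i \<in> {1..nseg tr}"
  obtains s where "step_vec tr i = s *\<^sub>R (X' - X)"
proof -
  obtain t where t: "\<forall>i\<le>nseg tr. breakpt tr i = X + t i *\<^sub>R (X' - X)"
    using trajectory_breakpoints[OF assms(1)] by (elim exE conjE)
  have "i \<le> nseg tr" "i - 1 \<le> nseg tr" using assms(2) by auto
  then have "step_vec tr i = (t i - t (i - 1)) *\<^sub>R (X' - X)"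
    using t[rule_format, of i] t[rule_format, of "i - 1"] by (simp add: step_vec_def scaleR_left_diff_distrib)
  then show ?thesis by (rule that)
qed

text \<open>The purpose of the matrices \<open>D\<close>: they exchange the displacement over the time step for the one over a
  sub-segment. In a component where the former vanishes, so does the latter, and both sides
  receive the contribution 0.\<close>
lemma inner_D_matrix:
  assumes "is_trajectory \<T> X X' tr" "i \<in> {1..nseg tr}"
  shows "(X' - X) \<bullet> (D_matrix X X' tr i *v v) = step_vec tr i \<bullet> v"
proof -
  obtain s where s: "step_vec tr i = s *\<^sub>R (X' - X)" using step_vec_eq[OF assms] by metis
  have D: "(D_matrix X X' tr i *v v) $ j = D_matrix X X' tr i $ j $ j * v $ j" for j
  proof -
    have "(D_matrix X X' tr i *v v) $ j = (\<Sum>l\<in>UNIV. if l = j then D_matrix X X' tr i $ j $ j * v $ j else 0)"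
      unfolding matrix_vector_mult_def vec_lambda_beta
      by (rule sum.cong) (simp_all add: D_matrix_def)
    then show ?thesis by simp
  qed
  have "(X' - X) $ j * (D_matrix X X' tr i $ j $ j * v $ j) = step_vec tr i $ j * v $ j" for j
    using s by (cases "(X' - X) $ j = 0") (auto simp: D_matrix_def)
  then show ?thesis unfolding inner_vec_def inner_real_def D by (intro sum.cong refl)
qed

context mesh begin

text \<open>The fundamental theorem of calculus for the polynomial in the cell of the sub-segment. The end
  values are traces from that cell, but these do not depend on the cell.\<close>
lemma segment_mean_grad:
  assumes f: "f \<in> Q0 \<Omega> \<T> k" and tr: "is_trajectory \<T> X X' tr" and i: "i \<in> {1..nseg tr}"
  shows "step_vec tr i \<bullet> segment_mean tr (classical_grad f) i =
    trace (\<Union>K\<in>\<T>. interior K) f (breakpt tr i) - trace (\<Union>K\<in>\<T>. interior K) f (breakpt tr (i - 1))"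
proof -
  let ?K = "cell tr i" and ?A = "breakpt tr (i - 1)" and ?B = "breakpt tr i"
  have K: "?K \<in> \<T>" and seg: "closed_segment ?A ?B \<subseteq> ?K"
    using tr i by (auto simp: is_trajectory_def)
  obtain p where p: "p \<in> Poly k" "\<And>x. x \<in> interior ?K \<Longrightarrow> f x = p x" using Q_E[OF Q0_Q[OF f] K] by metis
  have gV: "classical_grad p \<in> VPoly (k - 1)"
    using Poly_partial[OF p(1)] by (simp add: VPoly_def classical_grad_def)
  have AB: "?A \<in> ?K" "?B \<in> ?K" using seg by auto
  have tp: "trace (\<Union>K\<in>\<T>. interior K) f x = p x" if "x \<in> ?K" for x
    using Q0_trace_mesh[OF f that K] trace_cell[OF K that Poly_continuous[OF p(1)] p(2)] by simp
  have tg: "trace (interior ?K) (classical_grad f) x = classical_grad p x" if "x \<in> ?K" for x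
    by (rule trace_cell[OF K that VPoly_continuous[OF gV]]) (simp add: classical_grad_local[OF open_interior _ p(2,1)])
  let ?x = "\<lambda>\<xi>. interp \<xi> ?A ?B"
  have xK: "?x \<xi> \<in> ?K" if "\<xi> \<in> {0..1}" for \<xi>
  proof -
    have "?x \<xi> \<in> closed_segment ?B ?A" using that by (auto simp: interp_def closed_segment_def)
    then show ?thesis using seg by (auto simp: closed_segment_commute)
  qed
  have mean: "segment_mean tr (classical_grad f) i = integral {0..1} (\<lambda>\<xi>. classical_grad p (?x \<xi>))"
    unfolding segment_mean_def by (rule integral_cong) (rule tg[OF xK])
  have cx: "continuous_on {0..1} ?x" by (intro continuous_intros)
  have "continuous_on {0..1} (\<lambda>\<xi>. classical_grad p (?x \<xi>))"
    by (rule continuous_on_compose2[OF VPoly_continuous[OF gV, of UNIV] cx]) simp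
  then have "((\<lambda>\<xi>. classical_grad p (?x \<xi>)) has_integral segment_mean tr (classical_grad f) i) {0..1}"
    unfolding mean by (intro integrable_integral integrable_continuous_real)
  from has_integral_linear[OF this bounded_linear_inner_right[of "?A - ?B"]]
  have 1: "((\<lambda>\<xi>. (?A - ?B) \<bullet> classical_grad p (?x \<xi>)) has_integral (?A - ?B) \<bullet> segment_mean tr (classical_grad f) i) {0..1}"
    by (simp add: o_def)
  have "((\<lambda>\<xi>. (?A - ?B) \<bullet> classical_grad p (?x \<xi>)) has_integral p (?x 1) - p (?x 0)) {0..1}"
  proof (rule fundamental_theorem_of_calculus[OF zero_le_one])
    fix \<xi> :: real
    have "(?x has_derivative (\<lambda>h. h *\<^sub>R (?A - ?B))) (at \<xi> within {0..1})"
      unfolding interp_def by (auto intro!: derivative_eq_intros simp: algebra_simps)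
    from has_derivative_compose[OF this has_derivative_partial[OF Poly_differentiable[OF p(1)]]]
    have "((\<lambda>\<xi>. p (?x \<xi>)) has_derivative (\<lambda>h. \<Sum>j\<in>UNIV. (h *\<^sub>R (?A - ?B)) $ j * partial j p (?x \<xi>))) (at \<xi> within {0..1})" .
    moreover have "(\<lambda>h. \<Sum>j\<in>UNIV. (h *\<^sub>R (?A - ?B)) $ j * partial j p (?x \<xi>)) = (\<lambda>h. h *\<^sub>R ((?A - ?B) \<bullet> classical_grad p (?x \<xi>)))"
      by (simp add: fun_eq_iff inner_vec_def classical_grad_nth sum_distrib_left mult.assoc)
    ultimately show "((\<lambda>\<xi>. p (?x \<xi>)) has_vector_derivative (?A - ?B) \<bullet> classical_grad p (?x \<xi>)) (at \<xi> within {0..1})"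
      by (simp add: has_vector_derivative_def)
  qed
  from has_integral_unique[OF this 1]
  have "(?A - ?B) \<bullet> segment_mean tr (classical_grad f) i = p ?A - p ?B" by (simp add: interp_def)
  then show ?thesis unfolding step_vec_def tp[OF AB(1)] tp[OF AB(2)] by (simp add: inner_diff_left)
qed

lemma sum_segment_mean_grad:
  assumes f: "f \<in> Q0 \<Omega> \<T> k" and tr: "is_trajectory \<T> X X' tr"
  shows "(\<Sum>i\<in>{1..nseg tr}. step_vec tr i \<bullet> segment_mean tr (classical_grad f) i) =
    trace (\<Union>K\<in>\<T>. interior K) f X' - trace (\<Union>K\<in>\<T>. interior K) f X"
proof -
  let ?t = "\<lambda>i. trace (\<Union>K\<in>\<T>. interior K) f (breakpt tr i)"
  have "(\<Sum>i\<in>{1..nseg tr}. step_vec tr i \<bullet> segment_mean tr (classical_grad f) i) = (\<Sum>i\<in>{1..nseg tr}. ?t i - ?t (i - 1))"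
    by (rule sum.cong[OF refl]) (rule segment_mean_grad[OF f tr])
  also have "\<dots> = ?t (nseg tr) - ?t 0"
  proof -
    have "(\<Sum>i\<in>{1..n}. ?t i - ?t (i - 1)) = ?t n - ?t 0" for n by (induction n) simp_all
    then show ?thesis .
  qed
  finally have s: "(\<Sum>i\<in>{1..nseg tr}. step_vec tr i \<bullet> segment_mean tr (classical_grad f) i) = ?t (nseg tr) - ?t 0" .
  obtain t where "t 0 = 0" "t (nseg tr) = 1" "\<forall>i\<le>nseg tr. breakpt tr i = X + t i *\<^sub>R (X' - X)"
    using trajectory_breakpoints[OF tr] by (elim exE conjE)
  then have "breakpt tr 0 = X" "breakpt tr (nseg tr) = X'" by simp_all
  with s show ?thesis by simp
qed

end

section \<open>Conservation laws\<close>

lemma inner_diff_interp_half: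
  fixes a b :: "'a::real_inner"
  shows "(b - a) \<bullet> interp (1/2) a b = ((norm b)\<^sup>2 - (norm a)\<^sup>2) / 2"
  by (simp add: interp_def power2_norm_eq_inner inner_add_right inner_diff_left inner_commute algebra_simps)

lemma eq_mult_if_inverse_mult_eq:
  fixes a b r t :: real
  assumes "a = r" "a = inverse t * b" "t > 0"
  shows "b = t * r"
  using assms by (simp add: field_simps)

lemma eq_mult_diff_if_inverse_mult_eq:
  fixes a b r t q s s' :: real
  assumes "a = r - q * s'" "a = inverse t * b" "s' = inverse t * s" "t > 0"
  shows "b = t * r - q * s"
  using assms by (simp add: field_simps)

context mesh begin

lemma interp_field_lincomb:
  "interp_field \<alpha> f g = (\<lambda>x. \<alpha> *\<^sub>R f x + (1 - \<alpha>) *\<^sub>R g x)"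
  by (simp add: interp_field_def interp_def fun_eq_iff add.commute)

context
  fixes k N :: nat and wt :: "nat \<Rightarrow> real" and m c e \<theta> dt :: real and st st' :: pic_state
    and w :: "vec3 \<Rightarrow> vec3" and G :: "vec3 \<Rightarrow> real" and tr :: "nat \<Rightarrow> trajectory"
  assumes mc: "m > 0" "c > 0" and dt: "dt > 0"
    and st: "st \<in> pic_states \<Omega> \<T> k N" "st' \<in> pic_states \<Omega> \<T> k N"
    and nz: "\<forall>\<xi>\<in>{0..1}. \<forall>K\<in>\<T>. \<forall>x\<in>K \<inter> \<Omega>. trace (interior K) (interp_field \<xi> (density st) (density st')) x \<noteq> 0"
    and w: "is_L2_projection \<Omega> (VQ \<Omega> \<T> (k + 1)) (mean_velocity m c st st') w"
    and G: "is_L2_projection \<Omega> (Q \<Omega> \<T> (k + 1)) (mean_G m c st st') G"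
    and tr: "\<forall>p\<in>{1..N}. is_trajectory \<T> (position st p) (position st' p) (tr p)"
    and continuity: "continuity_eq \<Omega> \<T> k \<theta> dt w st st'"
    and momentum: "momentum_eq \<Omega> \<T> k m c e \<theta> dt w G st st'"
    and ampere: "ampere_eq \<Omega> \<T> k N wt m c e \<theta> dt w tr st st'"
    and faraday: "faraday_eq \<Omega> \<T> k c dt st st'"
    and particle: "particle_eqs N m c e dt tr st st'"
begin

abbreviation "\<rho>\<theta> \<equiv> interp_field \<theta> (density st) (density st')"
abbreviation "E\<theta> \<equiv> interp_field (1/2) (electric st) (electric st')"
abbreviation "B\<theta> \<equiv> interp_field (1/2) (magnetic st) (magnetic st')"

lemma states:
  "density st \<in> Q \<Omega> \<T> (k + 1)" "density st' \<in> Q \<Omega> \<T> (k + 1)"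
  "momentum st \<in> VQ \<Omega> \<T> (k + 1)" "momentum st' \<in> VQ \<Omega> \<T> (k + 1)"
  "electric st \<in> Ned0 \<Omega> \<T> k" "electric st' \<in> Ned0 \<Omega> \<T> k"
  "magnetic st \<in> RT0 \<Omega> \<T> k" "magnetic st' \<in> RT0 \<Omega> \<T> k"
  using st by (simp_all add: pic_states_def)

lemma E_Ned0: "E\<theta> \<in> Ned0 \<Omega> \<T> k"
  unfolding interp_field_lincomb by (rule Ned0_lincomb[OF states(5,6)])

lemma B_RT0: "B\<theta> \<in> RT0 \<Omega> \<T> k"
  unfolding interp_field_lincomb by (rule RT0_lincomb[OF states(7,8)])

lemma w_VQ: "w \<in> VQ \<Omega> \<T> (k + 1)" and G_Q: "G \<in> Q \<Omega> \<T> (k + 1)"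
  using w G by (simp_all add: is_L2_projection_def)

lemma continuity_test:
  assumes "\<phi> \<in> Q \<Omega> \<T> (k + 1)"
  shows "integral \<Omega> (\<lambda>x. (density st' x - density st x) * \<phi> x) = dt * integral \<Omega> (\<lambda>x. \<rho>\<theta> x * (w x \<bullet> grad \<Omega> \<phi> x))"
proof -
  have "integral \<Omega> (\<lambda>x. (density st' x - density st x) / dt * \<phi> x) = integral \<Omega> (\<lambda>x. \<rho>\<theta> x * (w x \<bullet> grad \<Omega> \<phi> x))"
    using continuity[unfolded continuity_eq_def] assms by (rule bspec)
  moreover have "integral \<Omega> (\<lambda>x. (density st' x - density st x) / dt * \<phi> x) = integral \<Omega> (\<lambda>x. (density st' x - density st x) * \<phi> x) / dt"
    by (simp flip: integral_divide)
  ultimately show ?thesis using dt by (simp add: field_simps)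
qed

lemma momentum_test:
  assumes "\<mu> \<in> VQ \<Omega> \<T> (k + 1)"
  shows "integral \<Omega> (\<lambda>x. (momentum st' x - momentum st x) \<bullet> \<mu> x) = dt *
    (integral \<Omega> (\<lambda>x. convect \<Omega> w \<mu> (interp_field (1/2) (momentum st) (momentum st')) x
       - convect \<Omega> \<mu> w (interp_field (1/2) (momentum st) (momentum st')) x)
     - integral \<Omega> (\<lambda>x. \<rho>\<theta> x * (\<mu> x \<bullet> grad \<Omega> G x) * c\<^sup>2)
     + e / m * integral \<Omega> (\<lambda>x. \<rho>\<theta> x * ((E\<theta> x + cross3 (w x) (B\<theta> x /\<^sub>R c)) \<bullet> \<mu> x)))"
proof -
  have "integral \<Omega> (\<lambda>x. ((momentum st' x - momentum st x) /\<^sub>R dt) \<bullet> \<mu> x) =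
    integral \<Omega> (\<lambda>x. convect \<Omega> w \<mu> (interp_field (1/2) (momentum st) (momentum st')) x
       - convect \<Omega> \<mu> w (interp_field (1/2) (momentum st) (momentum st')) x)
     - integral \<Omega> (\<lambda>x. \<rho>\<theta> x * (\<mu> x \<bullet> grad \<Omega> G x) * c\<^sup>2)
     + e / m * integral \<Omega> (\<lambda>x. \<rho>\<theta> x * ((E\<theta> x + cross3 (w x) (B\<theta> x /\<^sub>R c)) \<bullet> \<mu> x))"
    using momentum[unfolded momentum_eq_def Let_def] assms by (rule bspec)
  moreover have "integral \<Omega> (\<lambda>x. ((momentum st' x - momentum st x) /\<^sub>R dt) \<bullet> \<mu> x) = inverse dt * integral \<Omega> (\<lambda>x. (momentum st' x - momentum st x) \<bullet> \<mu> x)"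
    by simp
  ultimately show ?thesis using dt by (rule eq_mult_if_inverse_mult_eq)
qed

lemma ampere_test:
  assumes "\<nu> \<in> Ned0 \<Omega> \<T> k"
  shows "integral \<Omega> (\<lambda>x. (electric st' x - electric st x) \<bullet> \<nu> x) =
    dt * (c * integral \<Omega> (\<lambda>x. B\<theta> x \<bullet> curl \<Omega> \<nu> x) - 4 * pi * e / m * integral \<Omega> (\<lambda>x. \<rho>\<theta> x * (w x \<bullet> \<nu> x)))
    - 4 * pi * e * (\<Sum>p\<in>{1..N}. wt p * (\<Sum>i\<in>{1..nseg (tr p)}. step_vec (tr p) i \<bullet> segment_mean (tr p) \<nu> i))"
proof -
  have "integral \<Omega> (\<lambda>x. ((electric st' x - electric st x) /\<^sub>R dt) \<bullet> \<nu> x) =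
        c * integral \<Omega> (\<lambda>x. B\<theta> x \<bullet> curl \<Omega> \<nu> x)
        - 4 * pi * e / m * integral \<Omega> (\<lambda>x. \<rho>\<theta> x * (w x \<bullet> \<nu> x))
        - 4 * pi * e * (\<Sum>p\<in>{1..N}. \<Sum>i\<in>{1..nseg (tr p)}.
            wt p * ((step_vec (tr p) i /\<^sub>R dt) \<bullet> segment_mean (tr p) \<nu> i))"
    using ampere[unfolded ampere_eq_def Let_def] assms by (rule bspec)
  moreover have "integral \<Omega> (\<lambda>x. ((electric st' x - electric st x) /\<^sub>R dt) \<bullet> \<nu> x) = inverse dt * integral \<Omega> (\<lambda>x. (electric st' x - electric st x) \<bullet> \<nu> x)"
    by simp
  moreover have "(\<Sum>p\<in>{1..N}. \<Sum>i\<in>{1..nseg (tr p)}. wt p * ((step_vec (tr p) i /\<^sub>R dt) \<bullet> segment_mean (tr p) \<nu> i)) =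
      inverse dt * (\<Sum>p\<in>{1..N}. wt p * (\<Sum>i\<in>{1..nseg (tr p)}. step_vec (tr p) i \<bullet> segment_mean (tr p) \<nu> i))"
    by (simp add: sum_distrib_left mult_ac)
  ultimately show ?thesis using dt by (rule eq_mult_diff_if_inverse_mult_eq)
qed

lemma faraday_test:
  assumes "\<tau> \<in> RT0 \<Omega> \<T> k"
  shows "integral \<Omega> (\<lambda>x. (magnetic st' x - magnetic st x) \<bullet> \<tau> x) = - (dt * c * integral \<Omega> (\<lambda>x. \<tau> x \<bullet> curl \<Omega> E\<theta> x))"
proof -
  have "integral \<Omega> (\<lambda>x. ((magnetic st' x - magnetic st x) /\<^sub>R dt) \<bullet> \<tau> x) = - c * integral \<Omega> (\<lambda>x. \<tau> x \<bullet> curl \<Omega> E\<theta> x)"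
    using faraday[unfolded faraday_eq_def Let_def] assms by (rule bspec)
  moreover have "integral \<Omega> (\<lambda>x. ((magnetic st' x - magnetic st x) /\<^sub>R dt) \<bullet> \<tau> x) = inverse dt * integral \<Omega> (\<lambda>x. (magnetic st' x - magnetic st x) \<bullet> \<tau> x)"
    by simp
  ultimately show ?thesis using dt by (simp add: field_simps)
qed

lemma integrable_L2: "f \<in> L2 \<Omega> \<Longrightarrow> f integrable_on \<Omega>" for f :: "vec3 \<Rightarrow> real"
  by (intro set_lebesgue_integral_eq_integral(1) L2_absolutely_integrable[OF lmeasurable_domain])

lemma fluid_mass_step: "fluid_mass \<T> st' = fluid_mass \<T> st"
proof -
  have "integral \<Omega> (density st') - integral \<Omega> (density st) = integral \<Omega> (\<lambda>x. (density st' x - density st x) * 1)"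
    using integral_diff[OF integrable_L2[OF Q_L2[OF states(2)]] integrable_L2[OF Q_L2[OF states(1)]]] by simp
  also have "\<dots> = dt * integral \<Omega> (\<lambda>x. \<rho>\<theta> x * (w x \<bullet> grad \<Omega> (\<lambda>x. 1) x))"
    by (rule continuity_test[OF Q_const])
  also have "integral \<Omega> (\<lambda>x. \<rho>\<theta> x * (w x \<bullet> grad \<Omega> (\<lambda>x. 1) x)) = integral \<Omega> (\<lambda>x. 0)"
    by (rule integral_spike_on, rule negligible_subset[OF grad_const_ae[of 1]]) auto
  finally show ?thesis by (simp add: fluid_mass_def integral_Union_mesh)
qed

text \<open>With \<open>\<mu> = w\<close> the convective terms cancel each other and the magnetic force is orthogonal to \<open>w\<close>.
  The force term with \<open>\<nabla> G\<close> cancels against the contribution of the density by the continuity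
  equation for \<open>\<phi> = G\<close>.\<close>
lemma fluid_work:
  "integral \<Omega> (\<lambda>x. fluid_energy_density m c (density st' x) (momentum st' x))
    - integral \<Omega> (\<lambda>x. fluid_energy_density m c (density st x) (momentum st x))
    = dt * (e / m) * integral \<Omega> (\<lambda>x. \<rho>\<theta> x * (w x \<bullet> E\<theta> x))"
proof -
  have "integral \<Omega> (\<lambda>x. \<rho>\<theta> x * ((E\<theta> x + cross3 (w x) (B\<theta> x /\<^sub>R c)) \<bullet> w x)) = integral \<Omega> (\<lambda>x. \<rho>\<theta> x * (w x \<bullet> E\<theta> x))"
  proof -
    have "(E\<theta> x + cross3 (w x) b) \<bullet> w x = w x \<bullet> E\<theta> x" for x b
      unfolding inner_add_left dot_cross_self by (simp add: inner_commute)
    then show ?thesis by simp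
  qed
  then have mom: "integral \<Omega> (\<lambda>x. (momentum st' x - momentum st x) \<bullet> w x) =
    dt * (- (c\<^sup>2 * integral \<Omega> (\<lambda>x. \<rho>\<theta> x * (w x \<bullet> grad \<Omega> G x))) + e / m * integral \<Omega> (\<lambda>x. \<rho>\<theta> x * (w x \<bullet> E\<theta> x)))"
    using momentum_test[OF w_VQ] by (simp add: mult.commute[of _ "c\<^sup>2"])
  show ?thesis
    unfolding fluid_energy_step[OF mc states(1-4) nz w G] mom continuity_test[OF G_Q]
    by (simp add: algebra_simps)
qed

text \<open>With the mean fields as test functions the left-hand sides of Ampere's and Faraday's equations
  become differences of squares, and the two curl terms cancel.\<close>
lemma field_energy_step:
  "integral \<Omega> (\<lambda>x. (norm (electric st' x))\<^sup>2 + (norm (magnetic st' x))\<^sup>2)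
    - integral \<Omega> (\<lambda>x. (norm (electric st x))\<^sup>2 + (norm (magnetic st x))\<^sup>2)
    = - 8 * pi * (dt * (e / m) * integral \<Omega> (\<lambda>x. \<rho>\<theta> x * (w x \<bullet> E\<theta> x))
       + e * (\<Sum>p\<in>{1..N}. wt p * (\<Sum>i\<in>{1..nseg (tr p)}. step_vec (tr p) i \<bullet> segment_mean (tr p) E\<theta> i)))"
proof -
  note EL = Ned_L2[OF Ned0_Ned[OF states(5)]] Ned_L2[OF Ned0_Ned[OF states(6)]]
  note BL = RT_L2[OF RT0_RT[OF states(7)]] RT_L2[OF RT0_RT[OF states(8)]]
  have sq: "(\<lambda>x. (norm (f x))\<^sup>2) integrable_on \<Omega>" if "f \<in> L2 \<Omega>" for f :: "vec3 \<Rightarrow> vec3"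
    using that by (simp add: L2_def)
  have half: "integral \<Omega> (\<lambda>x. (g x - f x) \<bullet> interp_field (1/2) f g x) = (integral \<Omega> (\<lambda>x. (norm (g x))\<^sup>2) - integral \<Omega> (\<lambda>x. (norm (f x))\<^sup>2)) / 2"
    if "f \<in> L2 \<Omega>" "g \<in> L2 \<Omega>" for f g :: "vec3 \<Rightarrow> vec3"
    unfolding interp_field_def inner_diff_interp_half
    by (simp add: integral_diff[OF sq[OF that(2)] sq[OF that(1)]])
  have E: "(integral \<Omega> (\<lambda>x. (norm (electric st' x))\<^sup>2) - integral \<Omega> (\<lambda>x. (norm (electric st x))\<^sup>2)) / 2 =
    dt * (c * integral \<Omega> (\<lambda>x. B\<theta> x \<bullet> curl \<Omega> E\<theta> x) - 4 * pi * e / m * integral \<Omega> (\<lambda>x. \<rho>\<theta> x * (w x \<bullet> E\<theta> x)))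
    - 4 * pi * e * (\<Sum>p\<in>{1..N}. wt p * (\<Sum>i\<in>{1..nseg (tr p)}. step_vec (tr p) i \<bullet> segment_mean (tr p) E\<theta> i))"
    using ampere_test[OF E_Ned0] half[OF EL] by simp
  have B: "(integral \<Omega> (\<lambda>x. (norm (magnetic st' x))\<^sup>2) - integral \<Omega> (\<lambda>x. (norm (magnetic st x))\<^sup>2)) / 2 =
    - (dt * c * integral \<Omega> (\<lambda>x. B\<theta> x \<bullet> curl \<Omega> E\<theta> x))"
    using faraday_test[OF B_RT0] half[OF BL] by simp
  have aux: "(a' + b') - (a + b) = - 8 * pi * (dt * (e / m) * R + e * S)"
    if "(a' - a) / 2 = dt * (C - 4 * pi * e / m * R) - 4 * pi * e * S" "(b' - b) / 2 = - (dt * C)" for a a' b b' C R S :: real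
  proof -
    have "a' = a + 2 * ((a' - a) / 2)" "b' = b + 2 * ((b' - b) / 2)" by (simp_all add: field_simps)
    then have "a' = a + 2 * (dt * (C - 4 * pi * e / m * R) - 4 * pi * e * S)" "b' = b + 2 * (- (dt * C))"
      unfolding that .
    then show ?thesis by (simp add: field_simps)
  qed
  show ?thesis
    unfolding integral_add[OF sq[OF EL(2)] sq[OF BL(2)]] integral_add[OF sq[OF EL(1)] sq[OF BL(1)]]
    using E B[unfolded mult.assoc[of dt c]] by (rule aux)
qed

text \<open>The mean velocity is parallel to the displacement, so that the magnetic force does no work.\<close>
lemma particle_work:
  assumes p: "p \<in> {1..N}"
  shows "(lorentz m c (impulse st' p) - lorentz m c (impulse st p)) * m * c\<^sup>2
    = e * (\<Sum>i\<in>{1..nseg (tr p)}. step_vec (tr p) i \<bullet> segment_mean (tr p) E\<theta> i)"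
proof -
  let ?X = "position st p" and ?X' = "position st' p" and ?U = "impulse st p" and ?U' = "impulse st' p"
  let ?V = "integral {0..1} (\<lambda>\<xi>::real. interp \<xi> ?U ?U' /\<^sub>R lorentz m c (interp \<xi> ?U ?U'))"
  let ?B = "trace (interior (cell (tr p) (midseg (tr p)))) B\<theta> (interp (1/2) ?X ?X') /\<^sub>R c"
  let ?S = "\<Sum>i\<in>{1..nseg (tr p)}. D_matrix ?X ?X' (tr p) i *v segment_mean (tr p) E\<theta> i"
  have eqs: "(?X' - ?X) /\<^sub>R dt = integral {0..1} (\<lambda>\<xi>::real. interp \<xi> ?U ?U' /\<^sub>R (m * lorentz m c (interp \<xi> ?U ?U'))) \<and>
           (?U' - ?U) /\<^sub>R dt = e *\<^sub>R (?S + (1 / m) *\<^sub>R cross3 ?V ?B)"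
    using particle[unfolded particle_eqs_def Let_def] p by (rule bspec)
  have a: "integral {0..1} (\<lambda>\<xi>::real. interp \<xi> ?U ?U' /\<^sub>R (m * lorentz m c (interp \<xi> ?U ?U'))) = inverse m *\<^sub>R ?V"
    by (simp add: inverse_mult_distrib flip: integral_cmul)
  have X: "dt *\<^sub>R ?V = m *\<^sub>R (?X' - ?X)" and U: "?U' - ?U = dt *\<^sub>R (e *\<^sub>R (?S + (1 / m) *\<^sub>R cross3 ?V ?B))"
  proof -
    have "(m * dt) *\<^sub>R ((?X' - ?X) /\<^sub>R dt) = (m * dt) *\<^sub>R (inverse m *\<^sub>R ?V)" using eqs a by simp
    moreover have "m * dt * inverse dt = m" "m * dt * inverse m = dt" using dt mc by simp_all
    ultimately show "dt *\<^sub>R ?V = m *\<^sub>R (?X' - ?X)" by simp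
    have "dt *\<^sub>R ((?U' - ?U) /\<^sub>R dt) = dt *\<^sub>R (e *\<^sub>R (?S + (1 / m) *\<^sub>R cross3 ?V ?B))" using eqs by simp
    then show "?U' - ?U = dt *\<^sub>R (e *\<^sub>R (?S + (1 / m) *\<^sub>R cross3 ?V ?B))" using dt by simp
  qed
  have "(lorentz m c ?U' - lorentz m c ?U) * (m\<^sup>2 * c\<^sup>2) = (?U' - ?U) \<bullet> ?V"
    by (rule lorentz_increment[OF mc])
  also have "\<dots> = dt * e * (?S \<bullet> ?V)"
    unfolding U by (simp add: inner_add_left dot_cross_self)
  also have "\<dots> = e * (?S \<bullet> (dt *\<^sub>R ?V))" by simp
  also have "\<dots> = e * m * (?S \<bullet> (?X' - ?X))" unfolding X by simp
  also have "?S \<bullet> (?X' - ?X) = (\<Sum>i\<in>{1..nseg (tr p)}. step_vec (tr p) i \<bullet> segment_mean (tr p) E\<theta> i)"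
    unfolding inner_sum_left
    by (rule sum.cong[OF refl]) (use inner_D_matrix[OF tr[rule_format, OF p]] in \<open>simp add: inner_commute\<close>)
  finally show ?thesis using mc by (simp add: power2_eq_square)
qed

lemma total_energy_eq:
  "total_energy \<T> N wt m c s = integral \<Omega> (\<lambda>x. fluid_energy_density m c (density s x) (momentum s x))
     + (\<Sum>p\<in>{1..N}. wt p * ((lorentz m c (impulse s p) - 1) * m * c\<^sup>2))
     + 1 / (8 * pi) * integral \<Omega> (\<lambda>x. (norm (electric s x))\<^sup>2 + (norm (magnetic s x))\<^sup>2)"
  by (simp add: total_energy_def integral_Union_mesh fluid_energy_density_def mult.assoc)

lemma total_energy_step: "total_energy \<T> N wt m c st' = total_energy \<T> N wt m c st"
proof -
  let ?J = "\<lambda>p. \<Sum>i\<in>{1..nseg (tr p)}. step_vec (tr p) i \<bullet> segment_mean (tr p) E\<theta> i"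
  have "(\<Sum>p\<in>{1..N}. wt p * ((lorentz m c (impulse st' p) - 1) * m * c\<^sup>2)) - (\<Sum>p\<in>{1..N}. wt p * ((lorentz m c (impulse st p) - 1) * m * c\<^sup>2))
    = (\<Sum>p\<in>{1..N}. wt p * ((lorentz m c (impulse st' p) - lorentz m c (impulse st p)) * m * c\<^sup>2))"
    unfolding sum_subtractf[symmetric] by (rule sum.cong[OF refl]) (simp add: algebra_simps)
  also have "\<dots> = (\<Sum>p\<in>{1..N}. wt p * (e * ?J p))"
    by (rule sum.cong[OF refl]) (simp only: particle_work)
  also have "\<dots> = e * (\<Sum>p\<in>{1..N}. wt p * ?J p)" by (simp add: sum_distrib_left mult_ac)
  finally have part: "(\<Sum>p\<in>{1..N}. wt p * ((lorentz m c (impulse st' p) - 1) * m * c\<^sup>2)) =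
     (\<Sum>p\<in>{1..N}. wt p * ((lorentz m c (impulse st p) - 1) * m * c\<^sup>2)) + e * (\<Sum>p\<in>{1..N}. wt p * ?J p)" by simp
  have field: "1 / (8 * pi) * integral \<Omega> (\<lambda>x. (norm (electric st' x))\<^sup>2 + (norm (magnetic st' x))\<^sup>2) =
    1 / (8 * pi) * integral \<Omega> (\<lambda>x. (norm (electric st x))\<^sup>2 + (norm (magnetic st x))\<^sup>2)
    - (dt * (e / m) * integral \<Omega> (\<lambda>x. \<rho>\<theta> x * (w x \<bullet> E\<theta> x)) + e * (\<Sum>p\<in>{1..N}. wt p * ?J p))"
  proof -
    have aux: "1 / (8 * pi) * a = 1 / (8 * pi) * b - d" if "a - b = - 8 * pi * d" for a b d :: real
    proof -
      have "a = b - 8 * pi * d" using that by simp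
      then show ?thesis by (simp add: field_simps)
    qed
    show ?thesis by (rule aux[OF field_energy_step])
  qed
  show ?thesis unfolding total_energy_eq part field using fluid_work by linarith
qed

lemma gauss_residual_step:
  assumes \<phi>: "\<phi> \<in> Q0 \<Omega> \<T> (k + 1)"
  shows "gauss_residual \<Omega> \<T> k N wt m e st' \<phi> = gauss_residual \<Omega> \<T> k N wt m e st \<phi>"
proof -
  let ?tr = "trace (\<Union>K\<in>\<T>. interior K) \<phi>"
  let ?P = "\<lambda>s. \<Sum>p\<in>{1..N}. wt p * ?tr (position s p)"
  have \<phi>': "\<phi> \<in> Q0 \<Omega> \<T> (Suc k)" using \<phi> by simp
  note \<phi>Q = Q0_Q[OF \<phi>]
  have res: "gauss_residual \<Omega> \<T> k N wt m e s \<phi> =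
      - integral \<Omega> (\<lambda>x. electric s x \<bullet> grad \<Omega> \<phi> x) - 4 * pi * e / m * integral \<Omega> (\<lambda>x. density s x * \<phi> x) - 4 * pi * e * ?P s"
    if s: "density s \<in> Q \<Omega> \<T> (k + 1)" "electric s \<in> Ned0 \<Omega> \<T> k" for s
  proof -
    have EL: "electric s \<in> L2 \<Omega>" by (rule Ned_L2[OF Ned0_Ned[OF s(2)]])
    let ?d = "weak_divergence \<Omega> \<T> k (electric s)"
    have "integral \<Omega> (\<lambda>x. (?d x - 4 * pi * e * (density s x / m)) * \<phi> x) =
      integral \<Omega> (\<lambda>x. ?d x * \<phi> x - 4 * pi * e / m * (density s x * \<phi> x))"
      by (simp add: algebra_simps)
    also have "\<dots> = integral \<Omega> (\<lambda>x. ?d x * \<phi> x) - integral \<Omega> (\<lambda>x. 4 * pi * e / m * (density s x * \<phi> x))"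
      by (intro integral_diff integrable_on_mult_right integrable_mult_L2 Q_L2[OF \<phi>Q] Q_L2[OF s(1)]
          Q_L2[OF Q0_Q[OF weak_divergence_spec(1)[OF EL]]])
    also have "\<dots> = - integral \<Omega> (\<lambda>x. electric s x \<bullet> grad \<Omega> \<phi> x) - 4 * pi * e / m * integral \<Omega> (\<lambda>x. density s x * \<phi> x)"
      unfolding weak_divergence_spec(2)[OF EL \<phi>] by simp
    finally show ?thesis by (simp add: gauss_residual_def integral_Union_mesh)
  qed
  note EL = Ned_L2[OF Ned0_Ned[OF states(5)]] Ned_L2[OF Ned0_Ned[OF states(6)]]
  have dE: "integral \<Omega> (\<lambda>x. electric st' x \<bullet> grad \<Omega> \<phi> x) - integral \<Omega> (\<lambda>x. electric st x \<bullet> grad \<Omega> \<phi> x)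
     = integral \<Omega> (\<lambda>x. (electric st' x - electric st x) \<bullet> classical_grad \<phi> x)"
  proof -
    have "integral \<Omega> (\<lambda>x. electric st' x \<bullet> grad \<Omega> \<phi> x) - integral \<Omega> (\<lambda>x. electric st x \<bullet> grad \<Omega> \<phi> x)
      = integral \<Omega> (\<lambda>x. (electric st' x - electric st x) \<bullet> grad \<Omega> \<phi> x)"
      unfolding inner_diff_left by (intro integral_diff[symmetric] integrable_inner_L2 EL grad_L2[OF \<phi>Q])
    also have "\<dots> = integral \<Omega> (\<lambda>x. (electric st' x - electric st x) \<bullet> classical_grad \<phi> x)"
      by (rule integral_inner_grad_cong[OF grad_ae[OF \<phi>Q]])
    finally show ?thesis .
  qed
  have curl0: "integral \<Omega> (\<lambda>x. B\<theta> x \<bullet> curl \<Omega> (classical_grad \<phi>) x) = 0"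
    using integral_inner_grad_cong[OF curl_classical_grad_ae[OF \<phi>'], of B\<theta>] by simp
  have wg: "integral \<Omega> (\<lambda>x. \<rho>\<theta> x * (w x \<bullet> classical_grad \<phi> x)) = integral \<Omega> (\<lambda>x. \<rho>\<theta> x * (w x \<bullet> grad \<Omega> \<phi> x))"
    by (rule integral_spike_on, rule negligible_subset[OF grad_ae[OF \<phi>Q]]) auto
  have seg: "(\<Sum>p\<in>{1..N}. wt p * (\<Sum>i\<in>{1..nseg (tr p)}. step_vec (tr p) i \<bullet> segment_mean (tr p) (classical_grad \<phi>) i)) = ?P st' - ?P st"
    unfolding sum_subtractf[symmetric]
  proof (rule sum.cong[OF refl])
    fix p assume "p \<in> {1..N}"
    from sum_segment_mean_grad[OF \<phi> tr[rule_format, OF this]]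
    show "wt p * (\<Sum>i\<in>{1..nseg (tr p)}. step_vec (tr p) i \<bullet> segment_mean (tr p) (classical_grad \<phi>) i) =
      wt p * ?tr (position st' p) - wt p * ?tr (position st p)" by (simp only: right_diff_distrib)
  qed
  have d\<rho>: "integral \<Omega> (\<lambda>x. density st' x * \<phi> x) - integral \<Omega> (\<lambda>x. density st x * \<phi> x) = dt * integral \<Omega> (\<lambda>x. \<rho>\<theta> x * (w x \<bullet> grad \<Omega> \<phi> x))"
    unfolding continuity_test[OF \<phi>Q, symmetric] left_diff_distrib
    by (intro integral_diff[symmetric] integrable_mult_L2 Q_L2[OF \<phi>Q] Q_L2[OF states(1)] Q_L2[OF states(2)])
  have amp: "integral \<Omega> (\<lambda>x. (electric st' x - electric st x) \<bullet> classical_grad \<phi> x) =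
     - (4 * pi * e / m * (dt * integral \<Omega> (\<lambda>x. \<rho>\<theta> x * (w x \<bullet> grad \<Omega> \<phi> x)))) - 4 * pi * e * (?P st' - ?P st)"
    using ampere_test[OF classical_grad_Ned0[OF \<phi>']] unfolding curl0 wg seg by simp
  have "gauss_residual \<Omega> \<T> k N wt m e st' \<phi> - gauss_residual \<Omega> \<T> k N wt m e st \<phi> =
     - integral \<Omega> (\<lambda>x. (electric st' x - electric st x) \<bullet> classical_grad \<phi> x)
     - 4 * pi * e / m * (dt * integral \<Omega> (\<lambda>x. \<rho>\<theta> x * (w x \<bullet> grad \<Omega> \<phi> x))) - 4 * pi * e * (?P st' - ?P st)"
    unfolding res[OF states(1,5)] res[OF states(2,6)] dE[symmetric] d\<rho>[symmetric] by (simp add: right_diff_distrib)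
  then show ?thesis unfolding amp by simp
qed

text \<open>By Faraday's equation the field \<open>T = B' - B + \<Delta>t c curl E\<close>, with the mean
  electric field \<open>E\<close>, is orthogonal to all of \<open>RT0\<close>, to
  which it belongs itself; hence it vanishes almost everywhere. As the curl has no weak divergence,
  \<open>B'\<close> and \<open>B\<close> have the same weak divergences, and the choice in the definition of the
  divergence is the same for both.\<close>
lemma divergence_step: "divergence \<Omega> (magnetic st') = divergence \<Omega> (magnetic st)"
proof -
  define R where "R x = classical_curl E\<theta> x" for x
  have EN: "E\<theta> \<in> Ned \<Omega> \<T> k" by (rule Ned0_Ned[OF E_Ned0])
  have R_RT0: "R \<in> RT0 \<Omega> \<T> k" unfolding R_def[abs_def] by (rule classical_curl_RT0[OF E_Ned0])
  define T where "T x = (magnetic st' x - magnetic st x) + (dt * c) *\<^sub>R R x" for x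
  have D_RT0: "(\<lambda>x. magnetic st' x - magnetic st x) \<in> RT0 \<Omega> \<T> k"
    using RT0_lincomb[OF states(8,7), of 1 "-1"] by simp
  have T_RT0: "T \<in> RT0 \<Omega> \<T> k"
    using RT0_lincomb[OF D_RT0 R_RT0, of 1 "dt * c"] by (simp add: T_def[abs_def])
  note L2s = RT_L2[OF RT0_RT[OF D_RT0]] RT_L2[OF RT0_RT[OF R_RT0]] RT_L2[OF RT0_RT[OF T_RT0]]
  have "integral \<Omega> (\<lambda>x. T x \<bullet> T x) = integral \<Omega> (\<lambda>x. (magnetic st' x - magnetic st x) \<bullet> T x + (dt * c) * (R x \<bullet> T x))"
    by (rule arg_cong[where f = "integral \<Omega>"]) (simp add: fun_eq_iff T_def inner_add_left)
  also have "\<dots> = integral \<Omega> (\<lambda>x. (magnetic st' x - magnetic st x) \<bullet> T x) + integral \<Omega> (\<lambda>x. (dt * c) * (R x \<bullet> T x))"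
    by (intro integral_add integrable_on_mult_right integrable_inner_L2 L2s)
  also have "integral \<Omega> (\<lambda>x. (dt * c) * (R x \<bullet> T x)) = dt * c * integral \<Omega> (\<lambda>x. T x \<bullet> R x)"
    by (simp add: inner_commute)
  also have "integral \<Omega> (\<lambda>x. T x \<bullet> R x) = integral \<Omega> (\<lambda>x. T x \<bullet> curl \<Omega> E\<theta> x)"
    unfolding R_def by (rule integral_inner_grad_cong[OF negligible_neq_sym[OF curl_ae[OF EN]]])
  also have "integral \<Omega> (\<lambda>x. (magnetic st' x - magnetic st x) \<bullet> T x) = - (dt * c * integral \<Omega> (\<lambda>x. T x \<bullet> curl \<Omega> E\<theta> x))"
    by (rule faraday_test[OF T_RT0])
  finally have T0: "integral \<Omega> (\<lambda>x. T x \<bullet> T x) = 0" by simp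
  have "negligible {x\<in>\<Omega>. T x \<bullet> T x \<noteq> 0}"
    by (rule negligible_if_integral_norm_0[OF L2_inner_absolutely_integrable[OF sets_domain L2s(3) L2s(3)]]) (use T0 in simp)
  then have Tn: "negligible {x\<in>\<Omega>. T x \<noteq> 0}" by simp
  have wc: "has_weak_curl \<Omega> E\<theta> (curl \<Omega> E\<theta>)"
    using EN by (intro has_weak_curl_curl) (simp add: Ned_def)
  have wR: "has_weak_curl \<Omega> E\<theta> R"
    unfolding R_def[abs_def] by (rule has_weak_curl_spike[OF wc _ negligible_neq_sym[OF curl_ae[OF EN]]]) simp
  have "integral \<Omega> (\<lambda>x. magnetic st' x \<bullet> classical_grad \<psi> x) = integral \<Omega> (\<lambda>x. magnetic st x \<bullet> classical_grad \<psi> x)"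
    if \<psi>: "test_fun \<Omega> \<psi>" for \<psi>
  proof -
    note g = classical_grad_L2[OF \<psi> lmeasurable_domain]
    have "integral \<Omega> (\<lambda>x. magnetic st' x \<bullet> classical_grad \<psi> x) =
       integral \<Omega> (\<lambda>x. magnetic st x \<bullet> classical_grad \<psi> x - (dt * c) * (R x \<bullet> classical_grad \<psi> x))"
    proof (rule integral_spike_on, rule negligible_subset[OF Tn], rule subsetI)
      fix x assume x: "x \<in> {x\<in>\<Omega>. magnetic st' x \<bullet> classical_grad \<psi> x \<noteq> magnetic st x \<bullet> classical_grad \<psi> x - (dt * c) * (R x \<bullet> classical_grad \<psi> x)}"
      have "T x \<noteq> 0"
      proof
        assume "T x = 0"
        then have "magnetic st' x = magnetic st x - (dt * c) *\<^sub>R R x" by (simp add: T_def algebra_simps)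
        then show False using x by (simp add: inner_diff_left)
      qed
      then show "x \<in> {x\<in>\<Omega>. T x \<noteq> 0}" using x by simp
    qed
    also have "\<dots> = integral \<Omega> (\<lambda>x. magnetic st x \<bullet> classical_grad \<psi> x) - integral \<Omega> (\<lambda>x. (dt * c) * (R x \<bullet> classical_grad \<psi> x))"
      by (intro integral_diff integrable_on_mult_right integrable_inner_L2 RT_L2[OF RT0_RT[OF states(7)]] L2s g)
    also have "\<dots> = integral \<Omega> (\<lambda>x. magnetic st x \<bullet> classical_grad \<psi> x)"
      using has_weak_curl_orthogonal_grad[OF wR \<psi>] by simp
    finally show ?thesis .
  qed
  then have "has_weak_div \<Omega> (magnetic st') g = has_weak_div \<Omega> (magnetic st) g" for g
    by (simp add: has_weak_div_def)
  then show ?thesis by (simp add: divergence_def)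
qed

end

lemma conservation_step:
  assumes "m > 0" "c > 0" "dt > 0"
    and "st \<in> pic_states \<Omega> \<T> k N" "st' \<in> pic_states \<Omega> \<T> k N"
    and "scheme_I \<Omega> \<T> k N wt m c e \<theta> dt st st'"
  shows "fluid_mass \<T> st' = fluid_mass \<T> st"
    "total_energy \<T> N wt m c st' = total_energy \<T> N wt m c st"
    "\<phi> \<in> Q0 \<Omega> \<T> (k + 1) \<Longrightarrow> gauss_residual \<Omega> \<T> k N wt m e st' \<phi> = gauss_residual \<Omega> \<T> k N wt m e st \<phi>"
    "divergence \<Omega> (magnetic st') = divergence \<Omega> (magnetic st)"
proof -
  from assms(6) obtain w G tr where s:
    "\<forall>\<xi>\<in>{0..1}. \<forall>K\<in>\<T>. \<forall>x\<in>K \<inter> \<Omega>. trace (interior K) (interp_field \<xi> (density st) (density st')) x \<noteq> 0"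
    "is_L2_projection \<Omega> (VQ \<Omega> \<T> (k + 1)) (mean_velocity m c st st') w"
    "is_L2_projection \<Omega> (Q \<Omega> \<T> (k + 1)) (mean_G m c st st') G"
    "\<forall>p\<in>{1..N}. is_trajectory \<T> (position st p) (position st' p) (tr p)"
    "continuity_eq \<Omega> \<T> k \<theta> dt w st st'"
    "momentum_eq \<Omega> \<T> k m c e \<theta> dt w G st st'"
    "ampere_eq \<Omega> \<T> k N wt m c e \<theta> dt w tr st st'"
    "faraday_eq \<Omega> \<T> k c dt st st'"
    "particle_eqs N m c e dt tr st st'"
    unfolding scheme_I_def by (elim conjE exE)
  note step = assms(1-5) s
  show "fluid_mass \<T> st' = fluid_mass \<T> st" by (rule fluid_mass_step[OF step])
  show "total_energy \<T> N wt m c st' = total_energy \<T> N wt m c st" by (rule total_energy_step[OF step])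
  show "gauss_residual \<Omega> \<T> k N wt m e st' \<phi> = gauss_residual \<Omega> \<T> k N wt m e st \<phi>" if "\<phi> \<in> Q0 \<Omega> \<T> (k + 1)"
    by (rule gauss_residual_step[OF step that])
  show "divergence \<Omega> (magnetic st') = divergence \<Omega> (magnetic st)" by (rule divergence_step[OF step])
qed

end

theorem proposition4p1:
  fixes \<Omega> :: "(real^3) set" and \<T> :: "(real^3) set set"
    and k N :: nat and wt :: "nat \<Rightarrow> real"
    and m c e \<theta> dt :: real
    and S :: "nat \<Rightarrow> pic_state"
  assumes "open \<Omega>" and "connected \<Omega>" and "bounded \<Omega>" and "\<Omega> \<noteq> {}"
    and "conforming_mesh \<Omega> \<T>"
    and "m > 0" and "c > 0" and "e \<noteq> 0"
    and "\<theta> \<in> {0..1}" and "dt > 0"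
    and "\<And>n. S n \<in> pic_states \<Omega> \<T> k N"
    and "\<And>n. scheme_I \<Omega> \<T> k N wt m c e \<theta> dt (S n) (S (Suc n))"
  shows "\<forall>n.
      fluid_mass \<T> (S n) = fluid_mass \<T> (S 0) \<and>
      particle_mass N wt (S n) = particle_mass N wt (S 0) \<and>
      total_energy \<T> N wt m c (S n) = total_energy \<T> N wt m c (S 0) \<and>
      (\<forall>\<phi>\<in>Q0 \<Omega> \<T> (k + 1).
         gauss_residual \<Omega> \<T> k N wt m e (S n) \<phi> = gauss_residual \<Omega> \<T> k N wt m e (S 0) \<phi>) \<and>
      (AE x in lebesgue_on \<Omega>.
         divergence \<Omega> (magnetic (S n)) x = divergence \<Omega> (magnetic (S 0)) x)"
proof
  fix n
  interpret mesh \<Omega> \<T> using assms(1,3,5) by unfold_locales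
  note step = conservation_step[OF assms(6,7,10) assms(11) assms(11) assms(12)]
  have "fluid_mass \<T> (S n) = fluid_mass \<T> (S 0)"
    by (induction n) (simp_all add: step(1))
  moreover have "total_energy \<T> N wt m c (S n) = total_energy \<T> N wt m c (S 0)"
    by (induction n) (simp_all add: step(2))
  moreover have "gauss_residual \<Omega> \<T> k N wt m e (S n) \<phi> = gauss_residual \<Omega> \<T> k N wt m e (S 0) \<phi>"
    if "\<phi> \<in> Q0 \<Omega> \<T> (k + 1)" for \<phi>
    by (induction n) (simp_all add: step(3)[OF that])
  moreover have "divergence \<Omega> (magnetic (S n)) = divergence \<Omega> (magnetic (S 0))"
    by (induction n) (simp_all add: step(4))
  ultimately show "fluid_mass \<T> (S n) = fluid_mass \<T> (S 0) \<and>
      particle_mass N wt (S n) = particle_mass N wt (S 0) \<and>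
      total_energy \<T> N wt m c (S n) = total_energy \<T> N wt m c (S 0) \<and>
      (\<forall>\<phi>\<in>Q0 \<Omega> \<T> (k + 1).
         gauss_residual \<Omega> \<T> k N wt m e (S n) \<phi> = gauss_residual \<Omega> \<T> k N wt m e (S 0) \<phi>) \<and>
      (AE x in lebesgue_on \<Omega>.
         divergence \<Omega> (magnetic (S n)) x = divergence \<Omega> (magnetic (S 0)) x)"
    by (simp add: particle_mass_def)
qed

end
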